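(* Let $K$ be a field and let $G$ be a connected simple graph on the vertex set $[n]$ with $n\ge 6$. Suppose that $G$ has a complete subgraph $\mathcal{K}_4$ on four vertices and that $$G=\mathcal{K}_4\cup_{v_1}T_1\cup_{v_2}\cdots\cup_{v_s}T_s,$$ where $\{v_1,\dots,v_s\}\subset V(\mathcal{K}_4)$, $s\ge 2$, the $v_h$ are pairwise distinct and the $T_h$ are paths. Then $J_2(G)$ is a set-theoretic complete intersection.
   Context: $[n]=\{1,\dots,n\}$. $R=K[x_{ij}: i\in\{1,2\}, j\in[n]]$ is the polynomial ring in $2n$ variables over the field $K$. For a simple graph $G$ on $[n]$, the binomial edge ideal $J_2(G)\subset R$ is the ideal generated by all $x_{1i}x_{2j}-x_{1j}x_{2i}$ with $\{i,j\}$ an edge of $G$, $i<j$. The arithmetical rank $\mathrm{ara}(I)$ of an ideal $I\subset R$ is the smallest integer $s$ for which there exist $f_1,\dots,f_s\in I$ with $\mathrm{rad}(I)=\mathrm{rad}(f_1,\dots,f_s)$. $J_2(G)$ is a set-theoretic complete intersection if $\mathrm{ara}(J_2(G))=\mathrm{ht}(J_2(G))$, where $\mathrm{ht}$ denotes height. For graphs $G_1,G_2$ whose intersection is a single vertex $v$ and neither of which is just the single vertex $v$, the clique sum $G_1\cup_v G_2$ of $G_1$ and $G_2$ along $v$ is the graph with vertex set $V(G_1)\cup V(G_2)$ and edge set $E(G_1)\cup E(G_2)$. $V(\mathcal{K}_4)$ denotes the vertex set of $\mathcal{K}_4$.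
   Formalization: Each path T_h is required to have v_h as an end vertex; if some v_h is an inner vertex of T_h, the height of J_2(G) is at most n-2 while its arithmetical rank is at least n-1, so the claim fails. *)

theory Defs
  imports
    "HOL-Algebra.Ideal"
    "HOL-Library.Poly_Mapping"
    "HOL-Library.Extended_Nat"
    "Graph_Theory.Graph_Theory"
begin

section \<open>Radical, height and arithmetical rank\<close>

definition radical :: "('a, 'b) ring_scheme \<Rightarrow> 'a set \<Rightarrow> 'a set" where
  "radical R I = {a \<in> carrier R. \<exists>k::nat. a [^]\<^bsub>R\<^esub> k \<in> I}"

definition prime_chain :: "('a, 'b) ring_scheme \<Rightarrow> (nat \<Rightarrow> 'a set) \<Rightarrow> nat \<Rightarrow> bool" where
  "prime_chain R P l \<longleftrightarrow>
     (\<forall>i\<le>l. primeideal (P i) R) \<and> (\<forall>i<l. P i \<subset> P (Suc i))"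

definition prime_height :: "('a, 'b) ring_scheme \<Rightarrow> 'a set \<Rightarrow> enat" where
  "prime_height R Q = Sup {enat l |l. \<exists>P. prime_chain R P l \<and> P l = Q}"

definition height :: "('a, 'b) ring_scheme \<Rightarrow> 'a set \<Rightarrow> enat" where
  "height R I = Inf {prime_height R Q |Q. primeideal Q R \<and> I \<subseteq> Q}"

text \<open>
  The infimum in \<^typ>\<open>enat\<close> is attained whenever some \<open>s\<close> qualifies, and is
  \<open>\<infinity>\<close> otherwise. The case \<open>s = 0\<close> compares with the radical of the zero ideal.
\<close>

definition arith_rank :: "('a, 'b) ring_scheme \<Rightarrow> 'a set \<Rightarrow> enat" where
  "arith_rank R I =
     Inf {enat s |s. \<exists>f::nat \<Rightarrow> 'a. f ` {1..s} \<subseteq> I \<and>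
       radical R I = radical R (Idl\<^bsub>R\<^esub> (f ` {1..s}))}"

definition set_theoretic_complete_intersection ::
    "('a, 'b) ring_scheme \<Rightarrow> 'a set \<Rightarrow> bool" where
  "set_theoretic_complete_intersection R I \<longleftrightarrow> arith_rank R I = height R I"


section \<open>The polynomial ring and binomial edge ideals\<close>

text \<open>
  A polynomial maps monomials (finitely supported exponent vectors) to coefficients.
  The type has a variable for every pair of naturals; the ring \<open>K[x\<^sub>i\<^sub>j]\<close> in
  \<open>2n\<close> variables consists of the polynomials that only involve the pairs in
  \<open>{1,2} \<times> {1..n}\<close>.
\<close>

type_synonym 'k mpoly2 = "((nat \<times> nat) \<Rightarrow>\<^sub>0 nat) \<Rightarrow>\<^sub>0 'k"

definition poly_ring :: "nat \<Rightarrow> ('k::field) mpoly2 ring" where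
  "poly_ring n =
     \<lparr>carrier = {p. \<forall>m \<in> Poly_Mapping.keys p. Poly_Mapping.keys m \<subseteq> {1, 2} \<times> {1..n}},
      monoid.mult = (*), one = 1, zero = 0, add = (+)\<rparr>"

definition xvar :: "nat \<Rightarrow> nat \<Rightarrow> ('k::field) mpoly2" where
  "xvar i j = Poly_Mapping.single (Poly_Mapping.single (i, j) 1) 1"

definition binomial_edge_ideal :: "nat \<Rightarrow> nat pair_pre_digraph \<Rightarrow> ('k::field) mpoly2 set" where
  "binomial_edge_ideal n G =
     Idl\<^bsub>poly_ring n\<^esub> {xvar 1 i * xvar 2 j - xvar 1 j * xvar 2 i |i j. (i, j) \<in> parcs G \<and> i < j}"

lemma poly_ring_cring: "cring (poly_ring n :: ('k::field) mpoly2 ring)"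
proof -
  let ?V = "{1, 2} \<times> {1..n} :: (nat \<times> nat) set"
  let ?C = "{p :: 'k mpoly2. \<forall>m \<in> Poly_Mapping.keys p. Poly_Mapping.keys m \<subseteq> ?V}"
  have add: "p + q \<in> ?C" if "p \<in> ?C" "q \<in> ?C" for p q
    using that Poly_Mapping.keys_add[of p q] by blast
  have neg: "- p \<in> ?C" if "p \<in> ?C" for p
    using that by simp
  have mult: "p * q \<in> ?C" if pq: "p \<in> ?C" "q \<in> ?C" for p q
  proof (standard, standard)
    fix m assume "m \<in> Poly_Mapping.keys (p * q)"
    then obtain a b where "a \<in> Poly_Mapping.keys p" "b \<in> Poly_Mapping.keys q" "m = a + b"
      using Poly_Mapping.keys_mult[of p q] by blast
    then show "Poly_Mapping.keys m \<subseteq> ?V"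
      using pq Poly_Mapping.keys_add[of a b] by blast
  qed
  show ?thesis
    unfolding poly_ring_def
  proof (rule cringI)
    show "abelian_group \<lparr>carrier = ?C, monoid.mult = (*), one = 1, zero = 0, add = (+)\<rparr>"
    proof (rule abelian_groupI)
      fix p assume "p \<in> carrier \<lparr>carrier = ?C, monoid.mult = (*), one = 1, zero = 0, add = (+)\<rparr>"
      then show "\<exists>q\<in>carrier \<lparr>carrier = ?C, monoid.mult = (*), one = 1, zero = 0, add = (+)\<rparr>.
          q \<oplus>\<^bsub>\<lparr>carrier = ?C, monoid.mult = (*), one = 1, zero = 0, add = (+)\<rparr>\<^esub> p =
          \<zero>\<^bsub>\<lparr>carrier = ?C, monoid.mult = (*), one = 1, zero = 0, add = (+)\<rparr>\<^esub>"
        using neg by (intro bexI[where x = "- p"]) simp_all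
    qed (use add in \<open>simp_all add: ac_simps del: mem_Collect_eq\<close>, simp)
    show "Group.comm_monoid \<lparr>carrier = ?C, monoid.mult = (*), one = 1, zero = 0, add = (+)\<rparr>"
      by (rule comm_monoidI)
        (use mult in \<open>auto simp: ac_simps simp del: mem_Collect_eq\<close>)
  qed (simp add: distrib_right)
qed

lemma xvar_in_poly_ring:
  "i \<in> {1, 2} \<Longrightarrow> j \<in> {1..n} \<Longrightarrow> xvar i j \<in> carrier (poly_ring n)"
  by (auto simp: xvar_def poly_ring_def)


section \<open>Graphs\<close>

text \<open>
  A finite simple graph is a \<^locale>\<open>pair_graph\<close>: a finite loop-free digraph with
  symmetric arc set, so an edge \<open>{i, j}\<close> is the pair of arcs \<open>(i, j)\<close> and \<open>(j, i)\<close>.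
\<close>

definition path_graph :: "'a list \<Rightarrow> 'a pair_pre_digraph" where
  "path_graph p =
     \<lparr>pverts = set p,
      parcs = (\<Union>i\<in>{i. Suc i < length p}. {(p ! i, p ! Suc i), (p ! Suc i, p ! i)})\<rparr>"

text \<open>
  \<open>path_with_end T v\<close>: \<open>T\<close> is a path and \<open>v\<close> is one of its end vertices. Paths are always
  attached at an end: a path glued at an inner vertex would lower the height of the
  binomial edge ideal below \<open>n - 1\<close>, but not its arithmetical rank.
\<close>

definition path_with_end :: "'a pair_pre_digraph \<Rightarrow> 'a \<Rightarrow> bool" where
  "path_with_end T v \<longleftrightarrow> (\<exists>p. p \<noteq> [] \<and> distinct p \<and> hd p = v \<and> T = path_graph p)"

definition clique_sum ::
    "'a pair_pre_digraph \<Rightarrow> 'a \<Rightarrow> 'a pair_pre_digraph \<Rightarrow> 'a pair_pre_digraph \<Rightarrow> bool" where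
  "clique_sum G1 v G2 G \<longleftrightarrow>
     pverts G1 \<inter> pverts G2 = {v} \<and> pverts G1 \<noteq> {v} \<and> pverts G2 \<noteq> {v} \<and>
     G = \<lparr>pverts = pverts G1 \<union> pverts G2, parcs = parcs G1 \<union> parcs G2\<rparr>"

text \<open>
  \<open>iterated_clique_sum H v T s G\<close> states that
  \<open>G = (\<dots>((H \<union>\<^bsub>v\<^sub>1\<^esub> T\<^sub>1) \<union>\<^bsub>v\<^sub>2\<^esub> T\<^sub>2) \<dots>) \<union>\<^bsub>v\<^sub>s\<^esub> T\<^sub>s\<close> and that every sum is defined.
\<close>

primrec iterated_clique_sum ::
    "'a pair_pre_digraph \<Rightarrow> (nat \<Rightarrow> 'a) \<Rightarrow> (nat \<Rightarrow> 'a pair_pre_digraph) \<Rightarrow> nat \<Rightarrow>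
     'a pair_pre_digraph \<Rightarrow> bool" where
  "iterated_clique_sum H v T 0 G \<longleftrightarrow> G = H"
| "iterated_clique_sum H v T (Suc s) G \<longleftrightarrow>
     (\<exists>G'. iterated_clique_sum H v T s G' \<and> clique_sum G' (v (Suc s)) (T (Suc s)) G)"

end

theory Submission
  imports Defs "HOL-Library.Product_Lexorder"
begin

text \<open>
  Both the height and the arithmetical rank of the ideal \<open>J\<close> equal \<open>n - 1\<close>. Write \<open>[i j]\<close> for the
  2-minor of the columns \<open>i\<close> and \<open>j\<close>.

  Let \<open>1, 2, 3, 4\<close> be the vertices of the complete subgraph, where paths starting with the edges
  \<open>1 a\<close> and \<open>2 b\<close> are attached. The elements \<open>[12]\<close>, \<open>[13]\<close>, \<open>[14] + [23]\<close>, \<open>[24] + [1a]\<close>, \<open>[34] + [2b]\<close>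
  and the minors of the remaining path edges generate \<open>J\<close> up to radical: by the Pluecker relations
  the product of the two summands lies in the radical of the ideal generated by the preceding
  elements, hence so do both summands.

  No fewer elements suffice: at the point where all columns are \<open>(1, 0)\<close> the ideal \<open>J\<close> contains
  \<open>n - 1\<close> elements with independent linear parts. If powers of them lie in an ideal with \<open>s\<close>
  generators that vanish there, then counting dimensions modulo high powers of the maximal ideal
  of that point gives \<open>n - 1 \<le> s\<close>.

  For the height, the kernel of the parametrisation of the matrices of rank one contains \<open>J\<close> and
  has \<open>n + 1\<close> algebraically independent variables modulo it. Together with elements of the
  successive differences of a chain of primes below it they stay algebraically independent, so
  the chain has length at most \<open>n - 1\<close>. Conversely let a prime \<open>Q\<close> contain \<open>J\<close>, and let \<open>S\<close> be the
  set of columns that vanish modulo \<open>Q\<close>. The other columns are parallel modulo \<open>Q\<close> along each of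
  the at most \<open>card S + 1\<close> components of the graph without \<open>S\<close>, so \<open>Q\<close> contains the kernel of the
  generic parametrisation of such matrices; specialising one column at a time gives a chain of
  kernels of length at least \<open>n - 1\<close> ending there.
\<close>

declare One_nat_def [simp del]

section \<open>Polynomials and substitutions\<close>

type_synonym ('v, 'k) mpoly = "('v \<Rightarrow>\<^sub>0 nat) \<Rightarrow>\<^sub>0 'k"

abbreviation mon :: "('v \<Rightarrow>\<^sub>0 nat) \<Rightarrow> ('v, 'k::comm_ring_1) mpoly" where
  "mon m \<equiv> Poly_Mapping.single m 1"

abbreviation var :: "'v \<Rightarrow> ('v, 'k::comm_ring_1) mpoly" where
  "var v \<equiv> mon (Poly_Mapping.single v 1)"

section \<open>Substitution homomorphisms\<close>

definition mon_eval :: "('v \<Rightarrow> 'a::comm_monoid_mult) \<Rightarrow> ('v \<Rightarrow>\<^sub>0 nat) \<Rightarrow> 'a" where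
  "mon_eval \<sigma> m = (\<Prod>v\<in>Poly_Mapping.keys m. \<sigma> v ^ Poly_Mapping.lookup m v)"

text \<open>The algebra homomorphism over the coefficient ring that extends \<open>\<sigma>\<close>.
  Source and target may have different variable types; translations to a point and all
  parametrisations below are instances.\<close>

definition subst ::
    "('v \<Rightarrow> ('w, 'k::comm_ring_1) mpoly) \<Rightarrow> ('v, 'k) mpoly \<Rightarrow> ('w, 'k) mpoly" where
  "subst \<sigma> p =
     (\<Sum>m\<in>Poly_Mapping.keys p. Poly_Mapping.single 0 (Poly_Mapping.lookup p m) * mon_eval \<sigma> m)"

lemma mon_eval_superset:
  assumes "finite A" "Poly_Mapping.keys m \<subseteq> A"
  shows "mon_eval \<sigma> m = (\<Prod>v\<in>A. \<sigma> v ^ Poly_Mapping.lookup m v)"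
  unfolding mon_eval_def using assms
  by (intro prod.mono_neutral_left) (auto simp: in_keys_iff)

lemma mon_eval_0 [simp]: "mon_eval \<sigma> 0 = 1"
  by (simp add: mon_eval_def)

lemma mon_eval_add: "mon_eval \<sigma> (a + b) = mon_eval \<sigma> a * mon_eval \<sigma> b"
proof -
  let ?A = "Poly_Mapping.keys a \<union> Poly_Mapping.keys b"
  have "Poly_Mapping.keys (a + b) \<subseteq> ?A"
    by (rule Poly_Mapping.keys_add)
  then show ?thesis
    by (simp add: mon_eval_superset[of ?A] lookup_add power_add prod.distrib)
qed

lemma mon_eval_single [simp]: "mon_eval \<sigma> (Poly_Mapping.single v k) = \<sigma> v ^ k"
  by (simp add: mon_eval_def)

lemma mon_eval_var: "mon_eval (\<lambda>v. var v) m = (mon m :: ('v, 'k::comm_ring_1) mpoly)"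
proof -
  have *: "(var v :: ('v, 'k) mpoly) ^ k = mon (Poly_Mapping.single v k)" for v k
    by (induction k) (simp_all add: mult_single add: plus_1_eq_Suc flip: single_add)
  have "mon (\<Sum>v\<in>A. Poly_Mapping.single v (f v)) =
      (\<Prod>v\<in>A. mon (Poly_Mapping.single v (f v)) :: ('v, 'k) mpoly)" for A and f :: "'v \<Rightarrow> nat"
  proof (induction A rule: infinite_finite_induct)
    case (insert x F)
    show ?case
      unfolding sum.insert[OF insert.hyps] prod.insert[OF insert.hyps] insert.IH[symmetric]
      by (simp add: mult_single)
  qed auto
  moreover have "(\<Sum>v\<in>Poly_Mapping.keys m. Poly_Mapping.single v (Poly_Mapping.lookup m v)) = m"
    by (rule poly_mapping_eqI) (auto simp: lookup_sum lookup_single when_def sum.delta in_keys_iff)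
  ultimately show ?thesis
    unfolding mon_eval_def * by metis
qed

lemma poly_mapping_sum_singles:
  "(\<Sum>m\<in>Poly_Mapping.keys p. Poly_Mapping.single m (Poly_Mapping.lookup p m)) = p"
  by (rule poly_mapping_eqI) (auto simp: lookup_sum lookup_single when_def sum.delta in_keys_iff)

text \<open>Cancellation can shrink the support of a sum. Over a common finite superset of the
  supports, sums can be compared term by term.\<close>

lemma subst_superset:
  assumes "finite A" "Poly_Mapping.keys p \<subseteq> A"
  shows "subst \<sigma> p = (\<Sum>m\<in>A. Poly_Mapping.single 0 (Poly_Mapping.lookup p m) * mon_eval \<sigma> m)"
  unfolding subst_def using assms
  by (intro sum.mono_neutral_left) (auto simp: in_keys_iff)

lemma subst_add: "subst \<sigma> (p + q) = subst \<sigma> p + subst \<sigma> q"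
proof -
  let ?A = "Poly_Mapping.keys p \<union> Poly_Mapping.keys q"
  have "Poly_Mapping.keys (p + q) \<subseteq> ?A"
    by (rule Poly_Mapping.keys_add)
  then show ?thesis
    by (simp add: subst_superset[of ?A] lookup_add single_add distrib_right sum.distrib)
qed

lemma subst_0 [simp]: "subst \<sigma> 0 = 0"
  by (simp add: subst_def)

lemma subst_single: "subst \<sigma> (Poly_Mapping.single m c) = Poly_Mapping.single 0 c * mon_eval \<sigma> m"
  by (simp add: subst_def)

lemma subst_mon [simp]: "subst \<sigma> (mon m) = mon_eval \<sigma> m"
  by (simp add: subst_single)

lemma subst_1 [simp]: "subst \<sigma> 1 = 1"
  using subst_mon[of \<sigma> 0] by simp

lemma subst_uminus: "subst \<sigma> (- p) = - subst \<sigma> p"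
  using subst_add[of \<sigma> p "- p"] by (simp add: eq_neg_iff_add_eq_0 add.commute)

lemma subst_diff: "subst \<sigma> (p - q) = subst \<sigma> p - subst \<sigma> q"
  using subst_add[of \<sigma> p "- q"] by (simp add: subst_uminus)

lemma subst_sum: "subst \<sigma> (sum f A) = (\<Sum>i\<in>A. subst \<sigma> (f i))"
  by (induction A rule: infinite_finite_induct) (auto simp: subst_add)

lemma mpoly_induct [case_names single add]:
  assumes "\<And>m c. P (Poly_Mapping.single m c)" "\<And>p q. P p \<Longrightarrow> P q \<Longrightarrow> P (p + q)"
  shows "P (p :: ('v, 'k::comm_ring_1) mpoly)"
proof -
  \<comment> \<open>The empty sum is \<open>single 0 0\<close>, so zero needs no case of its
    own.\<close>
  have "P (\<Sum>m\<in>A. Poly_Mapping.single m (Poly_Mapping.lookup p m))" for A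
    using assms(1)[of 0 0] by (induction A rule: infinite_finite_induct) (auto intro: assms)
  from this[of "Poly_Mapping.keys p"] show ?thesis
    by (simp add: poly_mapping_sum_singles)
qed

lemma single_0_mult: "Poly_Mapping.single 0 (c * d) = Poly_Mapping.single 0 c * Poly_Mapping.single 0 d"
  by (simp add: mult_single)

lemma subst_mult: "subst \<sigma> (p * q) = subst \<sigma> p * subst \<sigma> q"
proof (induction p rule: mpoly_induct)
  case (single m c)
  show ?case
  proof (induction q rule: mpoly_induct)
    case (single m' c')
    show ?case
      unfolding mult_single[of m c m' c'] subst_single mon_eval_add single_0_mult
      by (simp only: ac_simps)
  qed (simp add: subst_add algebra_simps)
qed (simp add: subst_add algebra_simps)

lemma subst_power: "subst \<sigma> (p ^ k) = subst \<sigma> p ^ k"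
  by (induction k) (auto simp: subst_mult)

lemma subst_const [simp]: "subst \<sigma> (Poly_Mapping.single 0 c) = Poly_Mapping.single 0 c"
  by (simp add: subst_single)

lemma subst_prod: "subst \<sigma> (prod f A) = (\<Prod>i\<in>A. subst \<sigma> (f i))"
  by (induction A rule: infinite_finite_induct) (auto simp: subst_mult)

lemma subst_mon_eval: "subst \<sigma> (mon_eval \<tau> m) = mon_eval (\<lambda>v. subst \<sigma> (\<tau> v)) m"
  unfolding mon_eval_def by (simp add: subst_prod subst_power)

lemma subst_subst: "subst \<sigma> (subst \<tau> p) = subst (\<lambda>v. subst \<sigma> (\<tau> v)) p"
  by (induction p rule: mpoly_induct) (simp_all add: subst_add subst_mult subst_single subst_mon_eval)

section \<open>Polynomials in a prescribed set of variables, and the scalar action\<close>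

definition polys_in :: "'v set \<Rightarrow> ('v, 'k::comm_ring_1) mpoly set" where
  "polys_in W = {p. \<forall>m\<in>Poly_Mapping.keys p. Poly_Mapping.keys m \<subseteq> W}"

lemma polys_in_add: "p \<in> polys_in W \<Longrightarrow> q \<in> polys_in W \<Longrightarrow> p + q \<in> polys_in W"
  unfolding polys_in_def using Poly_Mapping.keys_add[of p q] by blast

lemma polys_in_uminus: "p \<in> polys_in W \<Longrightarrow> - p \<in> polys_in W"
  by (simp add: polys_in_def)

lemma polys_in_diff: "p \<in> polys_in W \<Longrightarrow> q \<in> polys_in W \<Longrightarrow> p - q \<in> polys_in W"
  using polys_in_add[of p W "- q"] by (simp add: polys_in_uminus)

lemma polys_in_mult: "p \<in> polys_in W \<Longrightarrow> q \<in> polys_in W \<Longrightarrow> p * q \<in> polys_in W"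
proof -
  assume pq: "p \<in> polys_in W" "q \<in> polys_in W"
  have "Poly_Mapping.keys m \<subseteq> W" if "m \<in> Poly_Mapping.keys (p * q)" for m
  proof -
    have "m \<in> {a + b |a b. a \<in> Poly_Mapping.keys p \<and> b \<in> Poly_Mapping.keys q}"
      using Poly_Mapping.keys_mult[of p q] that by auto
    then obtain a b where "a \<in> Poly_Mapping.keys p" "b \<in> Poly_Mapping.keys q" "m = a + b"
      by auto
    then show ?thesis
      using pq Poly_Mapping.keys_add[of a b] unfolding polys_in_def by blast
  qed
  then show ?thesis by (simp add: polys_in_def)
qed

lemma polys_in_0 [simp]: "0 \<in> polys_in W"
  by (simp add: polys_in_def)

lemma polys_in_1 [simp]: "1 \<in> polys_in W"
  by (simp add: polys_in_def)

lemma polys_in_const [simp]: "Poly_Mapping.single 0 c \<in> polys_in W"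
  by (simp add: polys_in_def)

lemma polys_in_mon: "mon m \<in> polys_in W \<longleftrightarrow> Poly_Mapping.keys m \<subseteq> W"
  by (simp add: polys_in_def)

lemma polys_in_var [simp]: "var v \<in> polys_in W \<longleftrightarrow> v \<in> W"
  by (simp add: polys_in_def)

lemma polys_in_sum: "(\<And>i. i \<in> A \<Longrightarrow> f i \<in> polys_in W) \<Longrightarrow> sum f A \<in> polys_in W"
  by (induction A rule: infinite_finite_induct) (auto simp: polys_in_add)

lemma polys_in_prod: "(\<And>i. i \<in> A \<Longrightarrow> f i \<in> polys_in W) \<Longrightarrow> prod f A \<in> polys_in W"
  by (induction A rule: infinite_finite_induct) (auto simp: polys_in_mult)

lemma polys_in_power: "p \<in> polys_in W \<Longrightarrow> p ^ k \<in> polys_in W"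
  by (induction k) (auto simp: polys_in_mult)

lemma polys_in_mon_eval:
  "(\<And>v. v \<in> Poly_Mapping.keys m \<Longrightarrow> \<sigma> v \<in> polys_in W) \<Longrightarrow> mon_eval \<sigma> m \<in> polys_in W"
  unfolding mon_eval_def by (intro polys_in_prod polys_in_power)

lemma polys_in_subst:
  "(\<And>v. v \<in> W \<Longrightarrow> \<sigma> v \<in> polys_in W') \<Longrightarrow> p \<in> polys_in W \<Longrightarrow> subst \<sigma> p \<in> polys_in W'"
  unfolding subst_def
  by (intro polys_in_sum polys_in_mult polys_in_mon_eval) (auto simp: polys_in_def)

text \<open>The scalar action that makes polynomials a \<open>vector_space\<close>, which gives
  access to spans and to the bound on the size of independent sets.\<close>

definition cscale :: "'k::field \<Rightarrow> ('v, 'k) mpoly \<Rightarrow> ('v, 'k) mpoly" where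
  "cscale c p = Poly_Mapping.single 0 c * p"

global_interpretation mpoly: vector_space "cscale :: 'k::field \<Rightarrow> ('v, 'k) mpoly \<Rightarrow> _"
  by unfold_locales (simp_all add: cscale_def distrib_left distrib_right single_add single_0_mult mult.assoc)

lemma lookup_cscale [simp]: "Poly_Mapping.lookup (cscale c p) m = c * Poly_Mapping.lookup p m"
proof -
  have "cscale c p = Poly_Mapping.map ((*) c) p"
    by (simp add: cscale_def mult_map_scale_conv_mult)
  then show ?thesis
    by (simp add: Poly_Mapping.map.rep_eq when_def)
qed

lemma cscale_mult_right: "cscale c (p * q) = p * cscale c q"
  by (simp add: cscale_def ac_simps)

lemma polys_in_cscale: "p \<in> polys_in W \<Longrightarrow> cscale c p \<in> polys_in W"
  by (simp add: cscale_def polys_in_mult)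

lemma keys_cscale_subset: "Poly_Mapping.keys (cscale c p) \<subseteq> Poly_Mapping.keys p"
  by (auto simp: in_keys_iff)

lemma single_eq_cscale_mon: "Poly_Mapping.single m c = cscale c (mon m)"
  by (simp add: cscale_def mult_single)

lemma sum_cscale_mon: "(\<Sum>m\<in>Poly_Mapping.keys p. cscale (Poly_Mapping.lookup p m) (mon m)) = p"
  using poly_mapping_sum_singles[of p] by (simp flip: single_eq_cscale_mon)

lemma xvar_eq_var: "xvar i j = var (i, j)"
  by (simp add: xvar_def)

section \<open>Ideals of the polynomial ring\<close>

definition pvars :: "nat \<Rightarrow> (nat \<times> nat) set" where
  "pvars n = {1, 2} \<times> {1..n}"

lemma finite_pvars [simp]: "finite (pvars n)"
  by (simp add: pvars_def)

lemma card_pvars: "card (pvars n) = 2 * n"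
  by (simp add: pvars_def card_cartesian_product)

lemma in_pvars [simp]: "(i, j) \<in> pvars n \<longleftrightarrow> (i = 1 \<or> i = 2) \<and> j \<in> {1..n}"
  by (auto simp: pvars_def)

lemma carrier_poly_ring: "carrier (poly_ring n) = polys_in (pvars n)"
  by (simp add: poly_ring_def polys_in_def pvars_def)

lemma polys_in_xvar: "i = 1 \<or> i = 2 \<Longrightarrow> j \<in> {1..n} \<Longrightarrow> xvar i j \<in> polys_in (pvars n)"
  by (simp add: xvar_eq_var)

lemma poly_ring_simps [simp]:
  "a \<oplus>\<^bsub>poly_ring n\<^esub> b = a + b" "a \<otimes>\<^bsub>poly_ring n\<^esub> b = a * b"
  "\<zero>\<^bsub>poly_ring n\<^esub> = 0" "\<one>\<^bsub>poly_ring n\<^esub> = 1"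
  by (simp_all add: poly_ring_def)

lemma poly_ring_ring: "ring (poly_ring n)"
  using poly_ring_cring cring.axioms(1) by blast

lemma poly_ring_pow [simp]: "a [^]\<^bsub>poly_ring n\<^esub> (k::nat) = a ^ k"
  by (induction k) (simp_all add: nat_pow_def mult.commute)

lemma ideal_poly_ringI:
  assumes "I \<subseteq> polys_in (pvars n)" "0 \<in> I" "\<And>a b. a \<in> I \<Longrightarrow> b \<in> I \<Longrightarrow> a + b \<in> I"
    and "\<And>a r. a \<in> I \<Longrightarrow> r \<in> polys_in (pvars n) \<Longrightarrow> r * a \<in> I"
  shows "ideal I (poly_ring n)"
proof (rule idealI[OF poly_ring_ring])
  interpret R: ring "poly_ring n :: 'a mpoly2 ring" by (rule poly_ring_ring)
  note I = assms
  have neg: "\<ominus>\<^bsub>poly_ring n\<^esub> a = - a" if "a \<in> polys_in (pvars n)" for a :: "'a mpoly2"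
    using that by (intro R.minus_equality) (auto simp: carrier_poly_ring polys_in_uminus)
  show "subgroup I (add_monoid (poly_ring n))"
  proof (rule R.add.subgroupI)
    fix a assume a: "a \<in> I"
    then have "- 1 * a \<in> I"
      by (intro assms(4)) (auto simp: polys_in_uminus)
    then show "\<ominus>\<^bsub>poly_ring n\<^esub> a \<in> I"
      using a assms(1) by (subst neg) auto
  qed (use I(1-3) in \<open>auto simp: carrier_poly_ring\<close>)
qed (use assms(4) in \<open>auto simp: carrier_poly_ring mult.commute\<close>)

lemma ideal_poly_ringD:
  assumes "ideal I (poly_ring n)"
  shows "I \<subseteq> polys_in (pvars n)" "0 \<in> I" "a \<in> I \<Longrightarrow> b \<in> I \<Longrightarrow> a + b \<in> I"
    "a \<in> I \<Longrightarrow> r \<in> polys_in (pvars n) \<Longrightarrow> r * a \<in> I"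
    "a \<in> I \<Longrightarrow> r \<in> polys_in (pvars n) \<Longrightarrow> a * r \<in> I"
    "a \<in> I \<Longrightarrow> - a \<in> I" "a \<in> I \<Longrightarrow> b \<in> I \<Longrightarrow> a - b \<in> I"
proof -
  interpret I: ideal I "poly_ring n" by fact
  show 1: "I \<subseteq> polys_in (pvars n)"
    using I.a_subset by (simp add: carrier_poly_ring)
  show "0 \<in> I"
    using additive_subgroup.zero_closed[OF I.is_additive_subgroup] by simp
  show add: "a + b \<in> I" if "a \<in> I" "b \<in> I" for a b
    using additive_subgroup.a_closed[OF I.is_additive_subgroup that] by simp
  show mult: "r * a \<in> I" if "a \<in> I" "r \<in> polys_in (pvars n)" for a r
    using I.I_l_closed[of a r] that by (simp add: carrier_poly_ring)
  show "a * r \<in> I" if "a \<in> I" "r \<in> polys_in (pvars n)" for a r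
    using mult[OF that] by (simp add: mult.commute)
  show neg: "- a \<in> I" if "a \<in> I" for a
    using mult[OF that, of "- 1"] by (simp add: polys_in_uminus)
  show "a - b \<in> I" if "a \<in> I" "b \<in> I" for a b
    using add[OF that(1) neg[OF that(2)]] by simp
qed

lemma ideal_poly_ring_sum:
  assumes "ideal I (poly_ring n)" "\<And>i. i \<in> A \<Longrightarrow> f i \<in> I"
  shows "sum f A \<in> I"
  using assms(2)
  by (induction A rule: infinite_finite_induct) (auto intro: ideal_poly_ringD[OF assms(1)])

lemma ideal_poly_ring_cscale:
  "ideal I (poly_ring n) \<Longrightarrow> a \<in> I \<Longrightarrow> cscale c a \<in> I"
  unfolding cscale_def by (rule ideal_poly_ringD) auto

lemma primeideal_poly_ringD:
  assumes "primeideal Q (poly_ring n)"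
  shows "ideal Q (poly_ring n)" "1 \<notin> Q"
    "a \<in> polys_in (pvars n) \<Longrightarrow> b \<in> polys_in (pvars n) \<Longrightarrow> a * b \<in> Q \<Longrightarrow> a \<in> Q \<or> b \<in> Q"
proof -
  interpret Q: primeideal Q "poly_ring n" by fact
  show "ideal Q (poly_ring n)" by (rule Q.is_ideal)
  show "1 \<notin> Q"
    using Q.I_notcarr Q.one_imp_carrier by auto
  show "a \<in> Q \<or> b \<in> Q" if "a \<in> polys_in (pvars n)" "b \<in> polys_in (pvars n)" "a * b \<in> Q"
    using Q.I_prime[of a b] that by (simp add: carrier_poly_ring)
qed

lemma primeideal_poly_ringI:
  assumes "ideal Q (poly_ring n)" "1 \<notin> Q"
    "\<And>a b. a \<in> polys_in (pvars n) \<Longrightarrow> b \<in> polys_in (pvars n) \<Longrightarrow> a * b \<in> Q \<Longrightarrow> a \<in> Q \<or> b \<in> Q"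
  shows "primeideal Q (poly_ring n)"
proof (rule primeidealI[OF assms(1) poly_ring_cring])
  show "carrier (poly_ring n) \<noteq> Q"
    using assms(2) by (auto simp: carrier_poly_ring)
qed (use assms(3) in \<open>auto simp: carrier_poly_ring\<close>)

lemma primeideal_poly_ring_power:
  assumes "primeideal Q (poly_ring n)" "a \<in> polys_in (pvars n)" "a ^ k \<in> Q"
  shows "a \<in> Q"
  using assms(3)
proof (induction k)
  case (Suc k)
  then show ?case
    using primeideal_poly_ringD(3)[OF assms(1,2) polys_in_power[OF assms(2)], of k] by auto
qed (use primeideal_poly_ringD(2)[OF assms(1)] in simp)

lemma primeideal_poly_ring_prod:
  assumes "primeideal Q (poly_ring n)" "\<And>i. i \<in> A \<Longrightarrow> f i \<in> polys_in (pvars n)"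
    "\<And>i. i \<in> A \<Longrightarrow> f i \<notin> Q"
  shows "prod f A \<notin> Q"
  using assms(2,3)
proof (induction A rule: infinite_finite_induct)
  case (insert i A)
  then show ?case
    using primeideal_poly_ringD(3)[OF assms(1), of "f i" "prod f A"] by (auto simp: polys_in_prod)
qed (use primeideal_poly_ringD(2)[OF assms(1)] in simp_all)

lemma primeideal_poly_ring_mon_eval:
  assumes "primeideal Q (poly_ring n)" "\<And>v. v \<in> Poly_Mapping.keys m \<Longrightarrow> f v \<in> polys_in (pvars n)"
    "\<And>v. v \<in> Poly_Mapping.keys m \<Longrightarrow> f v \<notin> Q"
  shows "mon_eval f m \<notin> Q"
  unfolding mon_eval_def
  by (intro primeideal_poly_ring_prod[OF assms(1)])
    (use assms primeideal_poly_ring_power[OF assms(1)] in \<open>auto simp: polys_in_power\<close>)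

lemma genideal_poly_ring:
  assumes "S \<subseteq> polys_in (pvars n)"
  shows "ideal (Idl\<^bsub>poly_ring n\<^esub> S) (poly_ring n)" "S \<subseteq> Idl\<^bsub>poly_ring n\<^esub> S"
    "ideal I (poly_ring n) \<Longrightarrow> S \<subseteq> I \<Longrightarrow> Idl\<^bsub>poly_ring n\<^esub> S \<subseteq> I"
  using assms
  by (simp_all add: ring.genideal_ideal ring.genideal_self ring.genideal_minimal
      poly_ring_ring carrier_poly_ring)

text \<open>The combinations form an ideal that contains the generators, so minimality of the
  generated ideal applies. Summation runs over the index set, which allows repeated
  generators.\<close>

lemma genideal_poly_ring_combination:
  assumes "finite A" "f ` A \<subseteq> polys_in (pvars n)" "p \<in> Idl\<^bsub>poly_ring n\<^esub> (f ` A)"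
  obtains r where "\<And>i. r i \<in> polys_in (pvars n)" "p = (\<Sum>i\<in>A. f i * r i)"
proof -
  let ?C = "{p. \<exists>r. (\<forall>i. r i \<in> polys_in (pvars n)) \<and> p = (\<Sum>i\<in>A. f i * r i)}"
  have "ideal ?C (poly_ring n)"
  proof (rule ideal_poly_ringI)
    show "?C \<subseteq> polys_in (pvars n)"
      using assms(2) by (auto intro!: polys_in_sum polys_in_mult)
    show "0 \<in> ?C"
      by (auto intro!: exI[of _ "\<lambda>_. 0"])
    show "a + b \<in> ?C" if "a \<in> ?C" "b \<in> ?C" for a b
    proof -
      obtain r where "\<forall>i. r i \<in> polys_in (pvars n)" "a = (\<Sum>i\<in>A. f i * r i)"
        using \<open>a \<in> ?C\<close> by auto
      moreover obtain s where "\<forall>i. s i \<in> polys_in (pvars n)" "b = (\<Sum>i\<in>A. f i * s i)"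
        using \<open>b \<in> ?C\<close> by auto
      ultimately show ?thesis
        by (auto intro!: exI[of _ "\<lambda>i. r i + s i"] simp: polys_in_add distrib_left sum.distrib)
    qed
    show "r * a \<in> ?C" if "a \<in> ?C" "r \<in> polys_in (pvars n)" for a r
    proof -
      obtain s where "\<forall>i. s i \<in> polys_in (pvars n)" "a = (\<Sum>i\<in>A. f i * s i)"
        using \<open>a \<in> ?C\<close> by auto
      then show ?thesis
        using \<open>r \<in> polys_in (pvars n)\<close>
        by (auto intro!: exI[of _ "\<lambda>i. r * s i"] simp: polys_in_mult sum_distrib_left ac_simps)
    qed
  qed
  moreover have "f ` A \<subseteq> ?C"
  proof
    fix y assume "y \<in> f ` A"
    then obtain j where "j \<in> A" "y = f j" by auto
    then show "y \<in> ?C"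
      using assms(1) by (auto intro!: exI[of _ "\<lambda>i. if i = j then 1 else 0"] simp: if_distrib cong: if_cong)
  qed
  ultimately show ?thesis
    using genideal_poly_ring(3)[OF assms(2)] assms(3) that by blast
qed

section \<open>Radicals of ideals\<close>

lemma radical_poly_ring:
  "radical (poly_ring n) I = {a \<in> polys_in (pvars n). \<exists>k. a ^ k \<in> I}"
  by (simp add: radical_def carrier_poly_ring)

lemma radical_superset: "ideal I (poly_ring n) \<Longrightarrow> I \<subseteq> radical (poly_ring n) I"
  unfolding radical_poly_ring
  using ideal_poly_ringD(1) by (force intro: exI[of _ 1])

lemma radical_mono: "I \<subseteq> I' \<Longrightarrow> radical (poly_ring n) I \<subseteq> radical (poly_ring n) I'"
  unfolding radical_poly_ring by blast

lemma radical_radical: "radical (poly_ring n) (radical (poly_ring n) I) = radical (poly_ring n) I"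
proof
  show "radical (poly_ring n) (radical (poly_ring n) I) \<subseteq> radical (poly_ring n) I"
    by (auto simp: radical_poly_ring simp flip: power_mult)
  show "radical (poly_ring n) I \<subseteq> radical (poly_ring n) (radical (poly_ring n) I)"
    unfolding radical_poly_ring by (force intro: exI[of _ 1])
qed

text \<open>Closure under sums is the binomial theorem: if \<open>a ^ k\<close> and
  \<open>b ^ l\<close> lie in \<open>I\<close>, every term of \<open>(a + b) ^ (k + l)\<close>
  contains \<open>a\<close> at least \<open>k\<close> times or \<open>b\<close> at least
  \<open>l\<close> times.\<close>

lemma radical_ideal:
  assumes "ideal I (poly_ring n)"
  shows "ideal (radical (poly_ring n) I) (poly_ring n)"
proof (rule ideal_poly_ringI)
  note I = ideal_poly_ringD[OF assms]
  show "radical (poly_ring n) I \<subseteq> polys_in (pvars n)"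
    by (auto simp: radical_poly_ring)
  show "0 \<in> radical (poly_ring n) I"
    using I(2) by (auto simp: radical_poly_ring intro: exI[of _ 1])
  show "r * a \<in> radical (poly_ring n) I"
    if "a \<in> radical (poly_ring n) I" "r \<in> polys_in (pvars n)" for a r
    using that I(4) unfolding radical_poly_ring
    by (auto simp: polys_in_mult power_mult_distrib intro: polys_in_power)
  show "a + b \<in> radical (poly_ring n) I"
    if "a \<in> radical (poly_ring n) I" "b \<in> radical (poly_ring n) I" for a b
  proof -
    obtain k l where ab: "a \<in> polys_in (pvars n)" "b \<in> polys_in (pvars n)" "a ^ k \<in> I" "b ^ l \<in> I"
      using \<open>a \<in> _\<close> \<open>b \<in> _\<close> by (auto simp: radical_poly_ring)
    have "of_nat (k + l choose i) * a ^ i * b ^ (k + l - i) \<in> I" if "i \<le> k + l" for i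
    proof -
      have c: "of_nat (k + l choose i) \<in> polys_in (pvars n)"
        using polys_in_const[of "of_nat (k + l choose i)"] by (simp only: single_of_nat)
      show ?thesis
      proof (cases "k \<le> i")
        case True
        have "(of_nat (k + l choose i) * a ^ (i - k) * b ^ (k + l - i)) * a ^ k \<in> I"
          using c ab by (intro I(4)) (auto intro!: polys_in_mult polys_in_power)
        moreover have "a ^ i = a ^ (i - k) * a ^ k"
          using True by (simp flip: power_add)
        ultimately show ?thesis by (simp add: ac_simps)
      next
        case False
        have "(of_nat (k + l choose i) * a ^ i * b ^ (k - i)) * b ^ l \<in> I"
          using c ab by (intro I(4)) (auto intro!: polys_in_mult polys_in_power)
        moreover have "b ^ (k + l - i) = b ^ (k - i) * b ^ l"
          using False by (simp flip: power_add)
        ultimately show ?thesis by (simp add: ac_simps)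
      qed
    qed
    then have "(a + b) ^ (k + l) \<in> I"
      unfolding binomial_ring by (intro ideal_poly_ring_sum[OF assms]) auto
    then show ?thesis
      using ab by (auto simp: radical_poly_ring polys_in_add)
  qed
qed

text \<open>Taking radicals is monotone and idempotent, so two generated ideals can be compared on
  generators alone.\<close>

lemma radical_genideal_eq:
  assumes "S \<subseteq> polys_in (pvars n)" "F \<subseteq> Idl\<^bsub>poly_ring n\<^esub> S"
    "S \<subseteq> radical (poly_ring n) (Idl\<^bsub>poly_ring n\<^esub> F)"
  shows "radical (poly_ring n) (Idl\<^bsub>poly_ring n\<^esub> S) = radical (poly_ring n) (Idl\<^bsub>poly_ring n\<^esub> F)"
proof
  note S = genideal_poly_ring[OF assms(1)]
  have FW: "F \<subseteq> polys_in (pvars n)"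
    using assms(2) ideal_poly_ringD(1)[OF S(1)] by blast
  note F = genideal_poly_ring[OF FW]
  have "Idl\<^bsub>poly_ring n\<^esub> S \<subseteq> radical (poly_ring n) (Idl\<^bsub>poly_ring n\<^esub> F)"
    by (rule S(3)[OF radical_ideal[OF F(1)] assms(3)])
  from radical_mono[OF this, of n]
  show "radical (poly_ring n) (Idl\<^bsub>poly_ring n\<^esub> S) \<subseteq> radical (poly_ring n) (Idl\<^bsub>poly_ring n\<^esub> F)"
    by (simp add: radical_radical)
  show "radical (poly_ring n) (Idl\<^bsub>poly_ring n\<^esub> F) \<subseteq> radical (poly_ring n) (Idl\<^bsub>poly_ring n\<^esub> S)"
    by (intro radical_mono F(3)[OF S(1) assms(2)])
qed

text \<open>By \<open>x ^ 2 = x * (x + y) - x * y\<close>. This is what allows one generator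
  \<open>x + y\<close> to do the work of the two generators \<open>x\<close> and
  \<open>y\<close>.\<close>

lemma radical_split_sum:
  assumes "ideal I (poly_ring n)" "x \<in> polys_in (pvars n)" "y \<in> polys_in (pvars n)"
    and "x + y \<in> radical (poly_ring n) I" "x * y \<in> radical (poly_ring n) I"
  shows "x \<in> radical (poly_ring n) I" "y \<in> radical (poly_ring n) I"
proof -
  note Rd = ideal_poly_ringD[OF radical_ideal[OF assms(1)]]
  have "x * (x + y) - x * y \<in> radical (poly_ring n) I"
    by (rule Rd(7)[OF Rd(4)[OF assms(4,2)] assms(5)])
  then have "x ^ 2 \<in> radical (poly_ring n) I"
    by (simp add: algebra_simps power2_eq_square)
  then show x: "x \<in> radical (poly_ring n) I"
    using assms(2) radical_radical[of n I] unfolding radical_poly_ring[of n "radical _ _"] by blast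
  show "y \<in> radical (poly_ring n) I"
    using Rd(7)[OF assms(4) x] by simp
qed

section \<open>An upper bound for the arithmetical rank\<close>

definition minor :: "nat \<Rightarrow> nat \<Rightarrow> ('k::field) mpoly2" where
  "minor i j = xvar 1 i * xvar 2 j - xvar 1 j * xvar 2 i"

lemma minor_swap: "minor j i = - minor i j"
  by (simp add: minor_def)

lemma polys_in_minor: "i \<in> {1..n} \<Longrightarrow> j \<in> {1..n} \<Longrightarrow> minor i j \<in> polys_in (pvars n)"
  unfolding minor_def by (intro polys_in_diff polys_in_mult polys_in_xvar) simp_all

lemma binomial_edge_ideal_minor:
  "binomial_edge_ideal n G = Idl\<^bsub>poly_ring n\<^esub> {minor i j |i j. (i, j) \<in> parcs G \<and> i < j}"
  by (simp add: binomial_edge_ideal_def minor_def)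

lemma edge_minors_subset:
  "parcs G \<subseteq> {1..n} \<times> {1..n} \<Longrightarrow> {minor i j |i j. (i, j) \<in> parcs G \<and> i < j} \<subseteq> polys_in (pvars n)"
  by (auto intro!: polys_in_minor)

text \<open>Generators are only listed for \<open>i < j\<close>; reversing an arc merely changes the
  sign of the minor.\<close>

lemma minor_in_binomial_edge_ideal:
  assumes "parcs G \<subseteq> {1..n} \<times> {1..n}" "sym (parcs G)" "(i, j) \<in> parcs G"
  shows "minor i j \<in> binomial_edge_ideal n G"
proof -
  note J = genideal_poly_ring[OF edge_minors_subset[OF assms(1)], folded binomial_edge_ideal_minor]
  consider "i < j" | "j < i" | "i = j" by linarith
  then show ?thesis
  proof cases
    case 1
    then show ?thesis using J(2) assms(3) by auto
  next
    case 2
    then have "minor j i \<in> binomial_edge_ideal n G"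
      using J(2) symD[OF assms(2,3)] by auto
    then show ?thesis
      using ideal_poly_ringD(6)[OF J(1)] minor_swap by metis
  next
    case 3
    then show ?thesis
      using ideal_poly_ringD(2)[OF J(1)] by (simp add: minor_def)
  qed
qed

text \<open>Enumerate \<open>F\<close> and repeat one element to fill the remaining indices. This
  turns a set of generators into the indexed family that the arithmetical rank asks for.\<close>

lemma finite_card_le_image_interval:
  assumes "finite F" "F \<noteq> {}" "card F \<le> m"
  obtains f :: "nat \<Rightarrow> 'a" where "f ` {1..m} = F"
proof -
  obtain h where h: "bij_betw h {1..card F} F"
    using ex_bij_betw_nat_finite_1[OF assms(1)] by blast
  obtain z where "z \<in> F" using assms(2) by blast
  let ?f = "\<lambda>i. if i \<in> {1..card F} then h i else z"
  have "?f ` {1..m} = F"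
  proof
    show "?f ` {1..m} \<subseteq> F"
      using h \<open>z \<in> F\<close> by (auto simp: bij_betw_def)
    show "F \<subseteq> ?f ` {1..m}"
    proof
      fix y assume "y \<in> F"
      then obtain i where "i \<in> {1..card F}" "y = h i"
        using h unfolding bij_betw_def by blast
      then show "y \<in> ?f ` {1..m}"
        using assms(3) by (intro image_eqI[of _ _ i]) auto
    qed
  qed
  then show ?thesis using that by blast
qed

lemma arith_rank_le:
  assumes "S \<subseteq> polys_in (pvars n)" "finite F" "F \<noteq> {}" "card F \<le> m" "F \<subseteq> Idl\<^bsub>poly_ring n\<^esub> S"
    "S \<subseteq> radical (poly_ring n) (Idl\<^bsub>poly_ring n\<^esub> F)"
  shows "arith_rank (poly_ring n) (Idl\<^bsub>poly_ring n\<^esub> S) \<le> enat m"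
proof -
  obtain f where "f ` {1..m} = F"
    using finite_card_le_image_interval[OF assms(2-4)] by blast
  then show ?thesis
    unfolding arith_rank_def using assms(5) radical_genideal_eq[OF assms(1,5,6)]
    by (intro Inf_lower) auto
qed

text \<open>Five elements replace the eight minors of the complete graph and of the edges
  \<open>p1 a\<close> and \<open>p2 b\<close>. Every other edge joins some \<open>w\<close> to
  \<open>par w\<close>, with \<open>w\<close> among the \<open>n - 6\<close> remaining vertices,
  which makes \<open>n - 1\<close> elements in all.\<close>

lemma arith_rank_K4_whiskers_le:
  fixes par :: "nat \<Rightarrow> nat" and G :: "nat pair_pre_digraph"
  assumes V: "parcs G \<subseteq> {1..n} \<times> {1..n}" "sym (parcs G)"
    and Q: "{p1, p2, p3, p4} \<subseteq> {1..n}" "distinct [p1, p2, p3, p4]"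
    and K: "\<And>x y. x \<in> {p1, p2, p3, p4} \<Longrightarrow> y \<in> {p1, p2, p3, p4} \<Longrightarrow> x \<noteq> y \<Longrightarrow> (x, y) \<in> parcs G"
    and E: "\<And>x y. (x, y) \<in> parcs G \<Longrightarrow> x \<in> {p1, p2, p3, p4} \<and> y \<in> {p1, p2, p3, p4} \<or>
        x \<in> {1..n} - {p1, p2, p3, p4} \<and> y = par x \<or> y \<in> {1..n} - {p1, p2, p3, p4} \<and> x = par y"
    and P: "\<And>w. w \<in> {1..n} - {p1, p2, p3, p4} \<Longrightarrow> (w, par w) \<in> parcs G"
    and ab: "{a, b} \<subseteq> {1..n} - {p1, p2, p3, p4}" "par a = p1" "par b = p2"
  shows "arith_rank (poly_ring n :: ('k::field) mpoly2 ring) (binomial_edge_ideal n G) \<le> enat (n - 1)"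
proof -
  let ?S = "{minor i j |i j. (i, j) \<in> parcs G \<and> i < j} :: 'k mpoly2 set"
  let ?K = "{p1, p2, p3, p4}"
  let ?R = "poly_ring n :: 'k mpoly2 ring"
  define F1 :: "'k mpoly2 list" where
    "F1 = [minor p1 p2, minor p1 p3, minor p1 p4 + minor p2 p3, minor p2 p4 + minor p1 a,
           minor p3 p4 + minor p2 b]"
  define F :: "'k mpoly2 set" where
    "F = set F1 \<union> (\<lambda>w. minor w (par w)) ` ({1..n} - ?K - {a, b})"
  note J = genideal_poly_ring[OF edge_minors_subset[OF V(1)], where 'a = 'k, folded binomial_edge_ideal_minor]
  have "a \<noteq> b" using ab Q(2) by auto
  have cK: "card ?K = 4" using Q(2) by simp
  have card1: "card ({1..n} - ?K - {a, b}) = n - 6"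
  proof -
    have "card ({1..n} - ?K) = n - 4"
      using card_Diff_subset[OF _ Q(1)] cK by simp
    moreover have "card ({1..n} - ?K - {a, b}) = card ({1..n} - ?K) - card {a, b}"
      using ab(1) by (intro card_Diff_subset) simp_all
    ultimately show ?thesis
      using \<open>a \<noteq> b\<close> by simp
  qed
  \<comment> \<open>Subtraction is truncated: this bound is what makes \<open>5 + (n - 6)\<close>
    equal to \<open>n - 1\<close>.\<close>
  have "n \<ge> 6"
  proof -
    have "card (?K \<union> {a, b}) \<le> card {1..n}"
      using ab(1) Q(1) by (intro card_mono) auto
    moreover have "card (?K \<union> {a, b}) = card ?K + card {a, b}"
      using ab(1) by (intro card_Un_disjoint) blast+
    then have "card (?K \<union> {a, b}) = 6"
      using cK \<open>a \<noteq> b\<close> by simp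
    ultimately show ?thesis by simp
  qed
  have "card F \<le> card (set F1) + card ((\<lambda>w. minor w (par w) :: 'k mpoly2) ` ({1..n} - ?K - {a, b}))"
    unfolding F_def by (rule card_Un_le)
  also have "\<dots> \<le> 5 + (n - 6)"
    using card_length[of F1] card_image_le[of "{1..n} - ?K - {a, b}" "\<lambda>w. minor w (par w) :: 'k mpoly2"]
    by (intro add_mono) (auto simp: F1_def card1)
  also have "\<dots> = n - 1"
    using \<open>n \<ge> 6\<close> by simp
  finally have card: "card F \<le> n - 1" .
  have fin: "finite F" "F \<noteq> {}"
    by (auto simp: F_def F1_def)
  have mJ: "minor x y \<in> binomial_edge_ideal n G" if "(x, y) \<in> parcs G" for x y
    by (rule minor_in_binomial_edge_ideal[OF V that])
  have arcs: "(p1, a) \<in> parcs G" "(p2, b) \<in> parcs G"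
    using P[of a] P[of b] ab symD[OF V(2)] by auto
  have FJ: "F \<subseteq> binomial_edge_ideal n G"
  proof -
    have "(p1, p2) \<in> parcs G" "(p1, p3) \<in> parcs G" "(p1, p4) \<in> parcs G" "(p2, p3) \<in> parcs G"
      "(p2, p4) \<in> parcs G" "(p3, p4) \<in> parcs G"
      using Q(2) by (simp_all add: K)
    then have "set F1 \<subseteq> binomial_edge_ideal n G"
      using arcs unfolding F1_def by (simp add: mJ ideal_poly_ringD(3)[OF J(1)])
    then show ?thesis
      unfolding F_def using mJ[OF P] by blast
  qed
  then have FW: "F \<subseteq> polys_in (pvars n)"
    using ideal_poly_ringD(1)[OF J(1)] by blast
  define Rd where "Rd = radical ?R (Idl\<^bsub>?R\<^esub> F)"
  note IF = genideal_poly_ring[OF FW]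
  have RdI: "ideal Rd ?R"
    unfolding Rd_def by (rule radical_ideal[OF IF(1)])
  have F_Rd: "F \<subseteq> Rd"
    unfolding Rd_def using IF(2) radical_superset[OF IF(1)] by blast
  have W: "minor x y \<in> polys_in (pvars n)" if "x \<in> ?K \<union> {a, b}" "y \<in> ?K \<union> {a, b}" for x y
    using that Q(1) ab(1) by (intro polys_in_minor) auto
  note split = radical_split_sum[OF IF(1), folded Rd_def]
  note Rd = ideal_poly_ringD[OF RdI]
  have 12: "minor p1 p2 \<in> Rd" and 13: "minor p1 p3 \<in> Rd"
    and s1: "minor p1 p4 + minor p2 p3 \<in> Rd" and s2: "minor p2 p4 + minor p1 a \<in> Rd"
    and s3: "minor p3 p4 + minor p2 b \<in> Rd"
    using F_Rd by (auto simp: F_def F1_def)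
  \<comment> \<open>The Pluecker relation of the columns \<open>p1, p2, p3, p4\<close>. Each product
    on the right has a factor already in \<open>Rd\<close>; the other factor only has to lie in the
    ring. The same pattern follows for \<open>p1, p2, p4, a\<close> and for
    \<open>p2, p3, p4, b\<close>.\<close>
  have "minor p1 p4 * minor p2 p3 = minor p1 p3 * minor p2 p4 - minor p1 p2 * (minor p3 p4 :: 'k mpoly2)"
    by (simp add: minor_def algebra_simps)
  also have "\<dots> \<in> Rd"
    using 12 13 by (intro Rd(7) Rd(5) W) auto
  finally have *: "minor p1 p4 * minor p2 p3 \<in> Rd" .
  have 14: "minor p1 p4 \<in> Rd" and 23: "minor p2 p3 \<in> Rd"
    by (rule split[OF W W s1 *]; simp)+
  have "minor p2 p4 * minor p1 a = minor p1 p4 * minor p2 a - minor p1 p2 * (minor p4 a :: 'k mpoly2)"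
    by (simp add: minor_def algebra_simps)
  also have "\<dots> \<in> Rd"
    using 12 14 by (intro Rd(7) Rd(5) W) auto
  finally have *: "minor p2 p4 * minor p1 a \<in> Rd" .
  have 24: "minor p2 p4 \<in> Rd" and 1: "minor p1 a \<in> Rd"
    by (rule split[OF W W s2 *]; simp)+
  have "minor p3 p4 * minor p2 b = minor p2 p4 * minor p3 b - minor p2 p3 * (minor p4 b :: 'k mpoly2)"
    by (simp add: minor_def algebra_simps)
  also have "\<dots> \<in> Rd"
    using 23 24 by (intro Rd(7) Rd(5) W) auto
  finally have *: "minor p3 p4 * minor p2 b \<in> Rd" .
  have 34: "minor p3 p4 \<in> Rd" and 2: "minor p2 b \<in> Rd"
    by (rule split[OF W W s3 *]; simp)+
  have swap: "minor y x \<in> Rd" if "minor x y \<in> Rd" for x y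
    using Rd(6)[OF that] minor_swap by metis
  have KK: "minor x y \<in> Rd" if "x \<in> ?K" "y \<in> ?K" for x y
  proof -
    have "minor x x \<in> Rd" for x using Rd(2) by (simp add: minor_def)
    with that 12 13 14 23 24 34 12[THEN swap] 13[THEN swap] 14[THEN swap] 23[THEN swap]
      24[THEN swap] 34[THEN swap] show ?thesis
      unfolding insert_iff empty_iff by (elim disjE) (simp_all only:)
  qed
  have PP: "minor w (par w) \<in> Rd" if "w \<in> {1..n} - ?K" for w
  proof (cases "w \<in> {a, b}")
    case True
    then show ?thesis using ab 1[THEN swap] 2[THEN swap] by auto
  next
    case False
    then show ?thesis using F_Rd that by (auto simp: F_def)
  qed
  have "?S \<subseteq> Rd"
  proof
    fix p assume "p \<in> ?S"
    then obtain i j where "p = minor i j" "(i, j) \<in> parcs G" by auto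
    from E[OF \<open>(i, j) \<in> parcs G\<close>] show "p \<in> Rd"
      unfolding \<open>p = minor i j\<close>
      by (elim disjE conjE) (simp_all only: KK PP swap[OF PP])
  qed
  then show ?thesis
    unfolding binomial_edge_ideal_minor
    using FJ[unfolded binomial_edge_ideal_minor]
    by (intro arith_rank_le[OF edge_minors_subset[OF V(1)] fin card]) (auto simp: Rd_def)
qed

section \<open>Counting monomials\<close>

definition mdeg :: "('v \<Rightarrow>\<^sub>0 nat) \<Rightarrow> nat" where
  "mdeg m = (\<Sum>v\<in>Poly_Mapping.keys m. Poly_Mapping.lookup m v)"

lemma mdeg_superset:
  assumes "finite A" "Poly_Mapping.keys m \<subseteq> A"
  shows "mdeg m = (\<Sum>v\<in>A. Poly_Mapping.lookup m v)"
  unfolding mdeg_def using assms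
  by (intro sum.mono_neutral_left) (auto simp: in_keys_iff)

lemma mdeg_add: "mdeg (a + b) = mdeg a + mdeg b"
proof -
  let ?A = "Poly_Mapping.keys a \<union> Poly_Mapping.keys b"
  have "Poly_Mapping.keys (a + b) \<subseteq> ?A"
    by (rule Poly_Mapping.keys_add)
  then show ?thesis
    by (simp add: mdeg_superset[of ?A] lookup_add sum.distrib)
qed

lemma mdeg_0 [simp]: "mdeg 0 = 0"
  by (simp add: mdeg_def)

lemma mdeg_single [simp]: "mdeg (Poly_Mapping.single v k) = k"
  by (simp add: mdeg_def)

lemma lookup_le_mdeg: "Poly_Mapping.lookup m v \<le> mdeg m"
proof (cases "v \<in> Poly_Mapping.keys m")
  case True
  then show ?thesis
    unfolding mdeg_def by (intro member_le_sum) auto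
qed (simp add: in_keys_iff)

text \<open>A box of exponent vectors with exclusive bounds, so that its size is the product of the
  bounds. Bounds that vary with \<open>v\<close> describe the standard monomials used for the
  arithmetical rank.\<close>

definition monoms_below :: "'v set \<Rightarrow> ('v \<Rightarrow> nat) \<Rightarrow> ('v \<Rightarrow>\<^sub>0 nat) set" where
  "monoms_below W u = {m. Poly_Mapping.keys m \<subseteq> W \<and> (\<forall>v\<in>W. Poly_Mapping.lookup m v < u v)}"

lemma monoms_below_le: "m \<in> monoms_below W (\<lambda>_. Suc q) \<Longrightarrow> Poly_Mapping.lookup m v \<le> q"
  by (cases "v \<in> Poly_Mapping.keys m") (fastforce simp: monoms_below_def less_Suc_eq_le, simp add: in_keys_iff)

lemma finite_card_monoms_below:
  assumes "finite W"
  shows "finite (monoms_below W u)" "card (monoms_below W u) = (\<Prod>v\<in>W. u v)"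
proof -
  let ?g = "\<lambda>f. Abs_poly_mapping (\<lambda>v. if v \<in> W then f v else 0)"
  have fin: "finite {v. (if v \<in> W then f v else 0) \<noteq> 0}" for f :: "'a \<Rightarrow> nat"
    by (rule finite_subset[OF _ assms]) auto
  have "bij_betw (\<lambda>m. restrict (Poly_Mapping.lookup m) W) (monoms_below W u) (\<Pi>\<^sub>E v\<in>W. {..<u v})"
  proof (rule bij_betw_byWitness[where f' = ?g])
    show "\<forall>m\<in>monoms_below W u. ?g (restrict (Poly_Mapping.lookup m) W) = m"
    proof
      fix m assume "m \<in> monoms_below W u"
      then show "?g (restrict (Poly_Mapping.lookup m) W) = m"
        by (intro poly_mapping_eqI) (use fin in \<open>auto simp: monoms_below_def in_keys_iff\<close>)
    qed
    show "\<forall>f\<in>\<Pi>\<^sub>E v\<in>W. {..<u v}. restrict (Poly_Mapping.lookup (?g f)) W = f"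
      using fin by (auto simp: fun_eq_iff PiE_def extensional_def)
    show "(\<lambda>m. restrict (Poly_Mapping.lookup m) W) ` monoms_below W u \<subseteq> (\<Pi>\<^sub>E v\<in>W. {..<u v})"
      by (auto simp: monoms_below_def)
    show "?g ` (\<Pi>\<^sub>E v\<in>W. {..<u v}) \<subseteq> monoms_below W u"
      using fin by (auto simp: monoms_below_def in_keys_iff PiE_def Pi_def split: if_splits)
  qed
  moreover have "finite (\<Pi>\<^sub>E v\<in>W. {..<u v})"
    using assms by (intro finite_PiE) auto
  ultimately show "finite (monoms_below W u)" "card (monoms_below W u) = (\<Prod>v\<in>W. u v)"
    using assms by (auto simp: bij_betw_finite card_PiE dest: bij_betw_same_card)
qed

text \<open>The elements of \<open>C\<close> represent distinct, linearly independent residue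
  classes modulo \<open>P\<close>. For \<open>P = {0}\<close> this is ordinary linear
  independence.\<close>

definition indep_mod :: "('v, 'k::field) mpoly set \<Rightarrow> ('v, 'k) mpoly set \<Rightarrow> bool" where
  "indep_mod P C \<longleftrightarrow>
     finite C \<and> (\<forall>a. (\<Sum>c\<in>C. cscale (a c) c) \<in> P \<longrightarrow> (\<forall>c\<in>C. a c = 0))"

text \<open>Two equal members of the family would give a relation with coefficients 1 and -1.
  Injectivity then carries independence and cardinality from the index set to the image.\<close>

lemma indep_mod_image:
  fixes F :: "'i \<Rightarrow> ('v, 'k::field) mpoly"
  assumes "0 \<in> P" "finite I"
    and indep: "\<forall>a. (\<Sum>i\<in>I. cscale (a i) (F i)) \<in> P \<longrightarrow> (\<forall>i\<in>I. a i = 0)"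
  shows "inj_on F I" "indep_mod P (F ` I)"
proof -
  show inj: "inj_on F I"
  proof (rule inj_onI, rule ccontr)
    fix i j assume ij: "i \<in> I" "j \<in> I" "F i = F j" "i \<noteq> j"
    let ?a = "\<lambda>k. if k = i then 1 else if k = j then - 1 else (0 :: 'k)"
    have "(\<Sum>k\<in>I. cscale (?a k) (F k)) = (\<Sum>k\<in>{i, j}. cscale (?a k) (F k))"
      using assms(2) ij by (intro sum.mono_neutral_right) auto
    also have "\<dots> = 0"
      using ij by simp
    finally have "?a i = 0"
      using indep[rule_format, of ?a i] ij(1) assms(1) by simp
    then show False by simp
  qed
  show "indep_mod P (F ` I)"
    unfolding indep_mod_def
  proof (intro conjI allI impI ballI)
    fix a p assume "(\<Sum>c\<in>F ` I. cscale (a c) c) \<in> P" "p \<in> F ` I"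
    then show "a p = 0"
      using indep[rule_format, of "\<lambda>i. a (F i)"] by (auto simp: sum.reindex[OF inj])
  qed (use assms(2) in simp)
qed

text \<open>The exchange bound for families: independence makes \<open>F\<close> injective, so index
  sets can be counted directly.\<close>

lemma card_le_card_spanning:
  fixes F :: "'i \<Rightarrow> ('v, 'k::field) mpoly"
  assumes "finite E" "finite I" "\<And>i. i \<in> I \<Longrightarrow> F i \<in> mpoly.span E"
    and "\<And>a i. (\<Sum>i\<in>I. cscale (a i) (F i)) = 0 \<Longrightarrow> i \<in> I \<Longrightarrow> a i = 0"
  shows "card I \<le> card E"
proof -
  have indep: "\<forall>a. (\<Sum>i\<in>I. cscale (a i) (F i)) \<in> {0} \<longrightarrow> (\<forall>i\<in>I. a i = 0)"
    using assms(4) by blast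
  have inj: "inj_on F I" and "indep_mod {0} (F ` I)"
    using indep_mod_image[OF _ assms(2) indep] by simp_all
  then have "\<not> mpoly.dependent (F ` I)"
    using mpoly.dependent_finite[of "F ` I"] assms(2) by (auto simp: indep_mod_def)
  then have "card (F ` I) \<le> card E"
    using mpoly.independent_span_bound[of E "F ` I"] assms(1,3) by blast
  then show ?thesis
    by (simp add: card_image[OF inj])
qed

section \<open>Chains of primes below a prime with independent variables\<close>

lemma mult_sum_cscale: "h * (\<Sum>c\<in>C. cscale (a c) (F c)) = (\<Sum>c\<in>C. cscale (a c) (h * F c))"
  by (simp add: sum_distrib_left cscale_mult_right)

text \<open>Modulo \<open>P'\<close> only the summand for \<open>j = 0\<close> survives, so its
  coefficients vanish. The rest is \<open>f\<close> times a shorter combination, and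
  \<open>f\<close> cancels because \<open>P\<close> is prime and does not contain it.\<close>

lemma indep_mod_power_combination:
  fixes a :: "nat \<Rightarrow> ('k::field) mpoly2 \<Rightarrow> 'k"
  assumes P: "primeideal P (poly_ring n)" "primeideal P' (poly_ring n)" "P \<subseteq> P'"
    and f: "f \<in> P'" "f \<notin> P" and C: "C \<subseteq> polys_in (pvars n)" "indep_mod P' C"
    and "(\<Sum>j\<le>q. f ^ j * (\<Sum>c\<in>C. cscale (a j c) c)) \<in> P" "j \<le> q" "c \<in> C"
  shows "a j c = 0"
  using assms(8-)
proof (induction q arbitrary: a j)
  case 0
  then show ?case
    using C(2) P(3) unfolding indep_mod_def by auto
next
  case (Suc q)
  note P' = ideal_poly_ringD[OF primeideal_poly_ringD(1)[OF P(2)]]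
  let ?g = "\<lambda>j. \<Sum>c\<in>C. cscale (a j c) c"
  let ?S = "\<Sum>j\<le>q. f ^ j * ?g (Suc j)"
  have fW: "f \<in> polys_in (pvars n)"
    using f(1) P'(1) by blast
  have gW: "?g j \<in> polys_in (pvars n)" for j
    using C(1) by (intro polys_in_sum polys_in_cscale) blast
  have SW: "?S \<in> polys_in (pvars n)"
    by (intro polys_in_sum polys_in_mult polys_in_power fW gW)
  have eq: "(\<Sum>j\<le>Suc q. f ^ j * ?g j) = ?g 0 + f * ?S"
    by (subst sum.atMost_Suc_shift) (simp add: sum_distrib_left mult.assoc)
  then have "?g 0 + f * ?S \<in> P'"
    using Suc.prems(1) P(3) by auto
  from P'(7)[OF this P'(5)[OF f(1) SW]] have "?g 0 \<in> P'"
    by simp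
  then have a0: "a 0 c = 0" if "c \<in> C" for c
    using C(2) that unfolding indep_mod_def by auto
  then have "f * ?S \<in> P"
    using Suc.prems(1) unfolding eq by simp
  then have "?S \<in> P"
    using primeideal_poly_ringD(3)[OF P(1) fW SW] f(2) by blast
  from Suc.IH[OF this] have "a (Suc j) c = 0" if "j \<le> q" for j
    using that Suc.prems(3) by blast
  then show ?case
    using a0 Suc.prems(2,3) by (cases j) auto
qed

text \<open>Going one prime down multiplies the number of independent elements by
  \<open>Suc q\<close>, just as one more independent variable with exponents up to \<open>q\<close>
  would.\<close>

lemma indep_mod_powers:
  fixes P :: "('k::field) mpoly2 set" and q :: nat
  assumes P: "primeideal P (poly_ring n)" "primeideal P' (poly_ring n)" "P \<subseteq> P'"
    and f: "f \<in> P'" "f \<notin> P" and C: "C \<subseteq> polys_in (pvars n)" "indep_mod P' C"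
  defines "C' \<equiv> (\<lambda>(j, c). f ^ j * c) ` ({..q} \<times> C)"
  shows "indep_mod P C'" "card C' = Suc q * card C"
proof -
  have fin: "finite ({..q} \<times> C)"
    using C(2) by (auto simp: indep_mod_def)
  have 0: "0 \<in> P"
    using ideal_poly_ringD(2)[OF primeideal_poly_ringD(1)[OF P(1)]] .
  have *: "a x = 0" if s: "(\<Sum>x\<in>{..q} \<times> C. cscale (a x) (case x of (j, c) \<Rightarrow> f ^ j * c)) \<in> P"
    and x: "x \<in> {..q} \<times> C" for a x
  proof -
    have "(\<Sum>x\<in>{..q} \<times> C. cscale (a x) (case x of (j, c) \<Rightarrow> f ^ j * c)) =
        (\<Sum>j\<le>q. f ^ j * (\<Sum>c\<in>C. cscale (a (j, c)) c))"
      unfolding mult_sum_cscale sum.cartesian_product by (intro sum.cong) auto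
    with s indep_mod_power_combination[OF P f C, where a = "\<lambda>j c. a (j, c)" and q = q] x show ?thesis
      by (cases x) auto
  qed
  then have indep: "\<forall>a. (\<Sum>x\<in>{..q} \<times> C. cscale (a x) (case x of (j, c) \<Rightarrow> f ^ j * c)) \<in> P \<longrightarrow>
      (\<forall>x\<in>{..q} \<times> C. a x = 0)"
    by blast
  show "indep_mod P C'" unfolding C'_def
    by (rule indep_mod_image(2)[OF 0 fin indep])
  have "inj_on (\<lambda>(j, c). f ^ j * c) ({..q} \<times> C)"
    by (rule indep_mod_image(1)[OF 0 fin indep])
  then show "card C' = Suc q * card C"
    unfolding C'_def by (simp add: card_image card_cartesian_product)
qed

text \<open>Exponents are bounded separately, not by total degree, to match the boxes
  \<open>monoms_below\<close>.\<close>

definition exps_le :: "nat \<Rightarrow> ('v, 'k::field) mpoly \<Rightarrow> bool" where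
  "exps_le d p \<longleftrightarrow> (\<forall>m\<in>Poly_Mapping.keys p. \<forall>v. Poly_Mapping.lookup m v \<le> d)"

lemma exps_le_mult:
  assumes "exps_le d p" "exps_le e q"
  shows "exps_le (d + e) (p * q)"
  unfolding exps_le_def
proof (intro ballI allI)
  fix m v assume "m \<in> Poly_Mapping.keys (p * q)"
  then have "m \<in> {a + b |a b. a \<in> Poly_Mapping.keys p \<and> b \<in> Poly_Mapping.keys q}"
    using Poly_Mapping.keys_mult[of p q] by auto
  then obtain a b where "a \<in> Poly_Mapping.keys p" "b \<in> Poly_Mapping.keys q" "m = a + b"
    by auto
  then show "Poly_Mapping.lookup m v \<le> d + e"
    using assms by (auto simp: exps_le_def lookup_add add_mono)
qed

lemma exps_le_power: "exps_le d p \<Longrightarrow> exps_le (k * d) (p ^ k)"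
  by (induction k) (auto simp: exps_le_mult, simp add: exps_le_def)

lemma exps_le_mono: "exps_le d p \<Longrightarrow> d \<le> e \<Longrightarrow> exps_le e p"
  by (auto simp: exps_le_def intro: order_trans)

lemma exps_le_exists: "\<exists>d. exps_le d p"
proof
  \<comment> \<open>The total degree dominates every exponent; the inserted 0 keeps the maximum
    meaningful for \<open>p = 0\<close>.\<close>
  show "exps_le (Max (insert 0 (mdeg ` Poly_Mapping.keys p))) p"
    unfolding exps_le_def
  proof (intro ballI allI)
    fix m v assume "m \<in> Poly_Mapping.keys p"
    then have "mdeg m \<le> Max (insert 0 (mdeg ` Poly_Mapping.keys p))"
      by (intro Max_ge) auto
    then show "Poly_Mapping.lookup m v \<le> Max (insert 0 (mdeg ` Poly_Mapping.keys p))"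
      using lookup_le_mdeg[of m v] by linarith
  qed
qed

lemma exps_le_in_span:
  assumes "p \<in> polys_in W" "exps_le d p"
  shows "p \<in> mpoly.span (mon ` monoms_below W (\<lambda>_. Suc d))"
proof -
  have "mon m \<in> mpoly.span (mon ` monoms_below W (\<lambda>_. Suc d))" if "m \<in> Poly_Mapping.keys p" for m
    using that assms by (intro mpoly.span_base) (auto simp: monoms_below_def polys_in_def exps_le_def less_Suc_eq_le)
  then have "(\<Sum>m\<in>Poly_Mapping.keys p. cscale (Poly_Mapping.lookup p m) (mon m)) \<in>
      mpoly.span (mon ` monoms_below W (\<lambda>_. Suc d))"
    by (intro mpoly.span_sum mpoly.span_scale)
  then show ?thesis
    by (simp add: sum_cscale_mon)
qed

text \<open>A polynomial in \<open>q\<close> of degree \<open>a\<close> cannot stay below one of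
  smaller degree.\<close>

lemma exponent_le_of_power_le:
  fixes a b c :: nat
  assumes "\<And>q. Suc q ^ a \<le> Suc (c * q) ^ b"
  shows "a \<le> b"
proof (rule ccontr)
  assume "\<not> a \<le> b"
  \<comment> \<open>For this value \<open>(c * q + 1) ^ b\<close> is at most
    \<open>((c + 1) * (q + 1)) ^ b = q * (q + 1) ^ b\<close>, which is smaller than
    \<open>(q + 1) ^ (b + 1)\<close>.\<close>
  define q where "q = Suc c ^ b"
  have "Suc q * Suc q ^ b = Suc q ^ Suc b"
    by simp
  also have "\<dots> \<le> Suc q ^ a"
    using \<open>\<not> a \<le> b\<close> by (intro power_increasing) auto
  also have "\<dots> \<le> Suc (c * q) ^ b"
    by (rule assms)
  also have "\<dots> \<le> (Suc c * Suc q) ^ b"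
    by (intro power_mono) auto
  also have "\<dots> = q * Suc q ^ b"
    unfolding q_def by (rule power_mult_distrib)
  finally show False
    by simp
qed

text \<open>A combination of monomials in \<open>Y\<close> that lies in \<open>P\<close> is zero,
  and its coefficients can be read off. This starts the count along a chain of primes.\<close>

lemma indep_mod_mon:
  fixes P :: "('v, 'k::field) mpoly set"
  assumes "finite Y" "Y \<subseteq> W" "0 \<in> P" "\<And>p. p \<in> polys_in Y \<Longrightarrow> p \<in> P \<Longrightarrow> p = 0"
  shows "indep_mod P (mon ` monoms_below Y u)" "card (mon ` monoms_below Y u :: ('v, 'k::field) mpoly set) = card (monoms_below Y u)"
proof -
  have *: "a m = 0" if "(\<Sum>m\<in>monoms_below Y u. cscale (a m) (mon m)) \<in> P" "m \<in> monoms_below Y u"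
    for a m
  proof -
    have "(\<Sum>m\<in>monoms_below Y u. cscale (a m) (mon m)) = 0"
      using that(1)
      by (intro assms(4) polys_in_sum polys_in_cscale) (auto simp: polys_in_mon monoms_below_def)
    then have "Poly_Mapping.lookup (\<Sum>m\<in>monoms_below Y u. cscale (a m) (mon m)) m = 0"
      by simp
    moreover have "Poly_Mapping.lookup (\<Sum>m\<in>monoms_below Y u. cscale (a m) (mon m)) m =
        (\<Sum>m'\<in>monoms_below Y u. if m' = m then a m' else 0)"
      unfolding lookup_sum by (intro sum.cong) (auto simp: lookup_single when_def)
    ultimately show "a m = 0"
      using finite_card_monoms_below(1)[OF assms(1), of u] that(2) by simp
  qed
  then have "\<forall>a. (\<Sum>m\<in>monoms_below Y u. cscale (a m) (mon m)) \<in> P \<longrightarrow> (\<forall>m\<in>monoms_below Y u. a m = 0)"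
    by blast
  from indep_mod_image[OF assms(3) finite_card_monoms_below(1)[OF assms(1)] this]
  show "indep_mod P (mon ` monoms_below Y u)" "card (mon ` monoms_below Y u :: ('v, 'k::field) mpoly set) = card (monoms_below Y u)"
    by (auto simp: card_image)
qed

text \<open>At \<open>k\<close> steps below \<open>Q\<close> there are
  \<open>Suc q ^ (card Y + k)\<close> independent elements with exponents at most
  \<open>c * q\<close>, where \<open>c\<close> does not depend on \<open>q\<close>. At the bottom of
  the chain they fit into a space of dimension at most \<open>Suc (c * q) ^ (2 * n)\<close>, and
  comparing growth in \<open>q\<close> bounds the length.\<close>

lemma prime_chain_length_le:
  fixes Q :: "('k::field) mpoly2 set"
  assumes chain: "prime_chain (poly_ring n) P l" "P l = Q"
    and Y: "Y \<subseteq> pvars n" "\<And>p. p \<in> polys_in Y \<Longrightarrow> p \<in> Q \<Longrightarrow> p = 0"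
  shows "card Y + l \<le> 2 * n"
proof -
  have prime: "primeideal (P i) (poly_ring n)" if "i \<le> l" for i
    using chain(1) that by (auto simp: prime_chain_def)
  have finY: "finite Y"
    by (rule finite_subset[OF Y(1)]) simp
  have "\<exists>c. \<forall>q. \<exists>C. C \<subseteq> polys_in (pvars n) \<and> indep_mod (P (l - k)) C \<and>
      card C = Suc q ^ (card Y + k) \<and> (\<forall>p\<in>C. exps_le (c * q) p)" if "k \<le> l" for k
    using that
  proof (induction k)
    case 0
    have 0: "0 \<in> Q"
      using ideal_poly_ringD(2)[OF primeideal_poly_ringD(1)[OF prime[of l]]] chain(2) by simp
    show ?case
    proof (intro exI[of _ 1] allI)
      fix q
      let ?C = "mon ` monoms_below Y (\<lambda>_. Suc q) :: 'k mpoly2 set"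
      have "card ?C = Suc q ^ (card Y + 0)"
        using indep_mod_mon(2)[OF finY Y(1) 0 Y(2), of "\<lambda>_. Suc q"]
        by (simp add: finite_card_monoms_below[OF finY])
      moreover have "\<forall>p\<in>?C. exps_le (1 * q) p"
        by (auto simp: exps_le_def monoms_below_le)
      moreover have "?C \<subseteq> polys_in (pvars n)"
        using Y(1) by (auto simp: polys_in_mon monoms_below_def)
      ultimately show "\<exists>C. C \<subseteq> polys_in (pvars n) \<and> indep_mod (P (l - 0)) C \<and>
          card C = Suc q ^ (card Y + 0) \<and> (\<forall>p\<in>C. exps_le (1 * q) p)"
        using indep_mod_mon(1)[OF finY Y(1) 0 Y(2), of "\<lambda>_. Suc q"] chain(2) by auto
    qed
  next
    case (Suc k)
    then obtain c where c: "\<And>q. \<exists>C. C \<subseteq> polys_in (pvars n) \<and> indep_mod (P (l - k)) C \<and>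
      card C = Suc q ^ (card Y + k) \<and> (\<forall>p\<in>C. exps_le (c * q) p)"
      by auto
    have "P (l - Suc k) \<subset> P (Suc (l - Suc k))"
      using chain(1) Suc.prems by (auto simp: prime_chain_def)
    then have sub: "P (l - Suc k) \<subset> P (l - k)"
      using Suc.prems by (simp add: Suc_diff_Suc)
    then obtain f where f: "f \<in> P (l - k)" "f \<notin> P (l - Suc k)"
      by blast
    have fW: "f \<in> polys_in (pvars n)"
      using f(1) ideal_poly_ringD(1)[OF primeideal_poly_ringD(1)[OF prime[of "l - k"]]] by auto
    obtain d where d: "exps_le d f"
      using exps_le_exists by blast
    \<comment> \<open>Powers of \<open>f\<close> up to the exponent \<open>q\<close> add at most
      \<open>d * q\<close> to the exponents, hence the new constant \<open>d + c\<close>.\<close>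
    show ?case
    proof (intro exI[of _ "d + c"] allI)
      fix q
      obtain C where C: "C \<subseteq> polys_in (pvars n)" "indep_mod (P (l - k)) C"
        "card C = Suc q ^ (card Y + k)" "\<forall>p\<in>C. exps_le (c * q) p"
        using c by blast
      let ?C = "(\<lambda>(j, c). f ^ j * c) ` ({..q} \<times> C)"
      note step = indep_mod_powers[OF prime prime _ f C(1,2), of q]
      have "indep_mod (P (l - Suc k)) ?C" "card ?C = Suc q ^ (card Y + Suc k)"
        using step sub C(3) by auto
      moreover have "?C \<subseteq> polys_in (pvars n)"
        using C(1) fW by (auto intro!: polys_in_mult polys_in_power)
      moreover have "exps_le ((d + c) * q) (f ^ j * p)" if "j \<le> q" "p \<in> C" for j p
      proof (rule exps_le_mono)
        show "exps_le (j * d + c * q) (f ^ j * p)"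
          using C(4) that(2) by (intro exps_le_mult exps_le_power d) auto
        show "j * d + c * q \<le> (d + c) * q"
          using that(1) by (simp add: algebra_simps)
      qed
      ultimately show "\<exists>C. C \<subseteq> polys_in (pvars n) \<and> indep_mod (P (l - Suc k)) C \<and>
          card C = Suc q ^ (card Y + Suc k) \<and> (\<forall>p\<in>C. exps_le ((d + c) * q) p)"
        by (intro exI[of _ ?C]) auto
    qed
  qed
  from this[of l] obtain c where c: "\<And>q. \<exists>C. C \<subseteq> polys_in (pvars n) \<and> indep_mod (P 0) C \<and>
      card C = Suc q ^ (card Y + l) \<and> (\<forall>p\<in>C. exps_le (c * q) p)"
    by auto
  show ?thesis
  proof (rule exponent_le_of_power_le)
    fix q
    obtain C where C: "C \<subseteq> polys_in (pvars n)" "indep_mod (P 0) C"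
      "card C = Suc q ^ (card Y + l)" "\<forall>p\<in>C. exps_le (c * q) p"
      using c by blast
    have 0: "0 \<in> P 0"
      using ideal_poly_ringD(2)[OF primeideal_poly_ringD(1)[OF prime[of 0]]] by simp
    let ?E = "mon ` monoms_below (pvars n) (\<lambda>_. Suc (c * q)) :: 'k mpoly2 set"
    have "card C \<le> card ?E"
    proof (rule card_le_card_spanning[where F = "\<lambda>p. p"])
      show "finite ?E"
        by (simp add: finite_card_monoms_below)
      show "finite C"
        using C(2) by (simp add: indep_mod_def)
      show "p \<in> mpoly.span ?E" if "p \<in> C" for p
        using that C(1,4) by (intro exps_le_in_span) auto
      show "a p = 0" if "(\<Sum>p\<in>C. cscale (a p) p) = 0" "p \<in> C" for a p
        using that C(2) 0 by (auto simp: indep_mod_def)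
    qed
    also have "\<dots> \<le> card (monoms_below (pvars n) (\<lambda>_. Suc (c * q)))"
      by (intro card_image_le) (simp add: finite_card_monoms_below)
    also have "\<dots> = Suc (c * q) ^ (2 * n)"
      by (simp add: finite_card_monoms_below card_pvars)
    finally show "Suc q ^ (card Y + l) \<le> Suc (c * q) ^ (2 * n)"
      using C(3) by simp
  qed
qed

lemma prime_height_le:
  fixes Q :: "('k::field) mpoly2 set"
  assumes "Y \<subseteq> pvars n" "\<And>p. p \<in> polys_in Y \<Longrightarrow> p \<in> Q \<Longrightarrow> p = 0"
  shows "prime_height (poly_ring n) Q \<le> enat (2 * n - card Y)"
  unfolding prime_height_def
proof (rule Sup_least)
  fix h assume "h \<in> {enat l |l. \<exists>P. prime_chain (poly_ring n) P l \<and> P l = Q}"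
  then obtain l P where "h = enat l" "prime_chain (poly_ring n) P l" "P l = Q" by auto
  then show "h \<le> enat (2 * n - card Y)"
    using prime_chain_length_le[of n P l Q Y] assms by auto
qed

section \<open>A lower bound for the arithmetical rank\<close>

text \<open>Order of vanishing at the origin: \<open>p\<close> lies in the \<open>k\<close>-th power
  of the ideal generated by the variables. The zero polynomial has every order.\<close>

definition order_ge :: "nat \<Rightarrow> ('v, 'k::field) mpoly \<Rightarrow> bool" where
  "order_ge k p \<longleftrightarrow> (\<forall>m\<in>Poly_Mapping.keys p. k \<le> mdeg m)"

lemma order_ge_0 [simp]: "order_ge 0 p" "order_ge k 0"
  by (simp_all add: order_ge_def)

lemma order_ge_mon: "order_ge k (mon m) \<longleftrightarrow> k \<le> mdeg m"
  by (simp add: order_ge_def)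

lemma order_ge_var [simp]: "order_ge k (var v) \<longleftrightarrow> k \<le> 1"
  by (simp add: order_ge_mon)

lemma order_ge_mono: "order_ge k p \<Longrightarrow> j \<le> k \<Longrightarrow> order_ge j p"
  by (auto simp: order_ge_def intro: order_trans)

lemma order_ge_add: "order_ge k p \<Longrightarrow> order_ge k q \<Longrightarrow> order_ge k (p + q)"
  unfolding order_ge_def using Poly_Mapping.keys_add[of p q] by blast

lemma order_ge_uminus: "order_ge k p \<Longrightarrow> order_ge k (- p)"
  by (simp add: order_ge_def)

lemma order_ge_diff: "order_ge k p \<Longrightarrow> order_ge k q \<Longrightarrow> order_ge k (p - q)"
  using order_ge_add[of k p "- q"] by (simp add: order_ge_uminus)

lemma order_ge_cscale: "order_ge k p \<Longrightarrow> order_ge k (cscale c p)"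
  unfolding order_ge_def using keys_cscale_subset[of c p] by blast

lemma order_ge_sum: "(\<And>i. i \<in> A \<Longrightarrow> order_ge k (f i)) \<Longrightarrow> order_ge k (sum f A)"
  by (induction A rule: infinite_finite_induct) (auto simp: order_ge_add)

lemma order_ge_mult:
  assumes "order_ge j p" "order_ge k q"
  shows "order_ge (j + k) (p * q)"
  unfolding order_ge_def
proof
  fix m assume "m \<in> Poly_Mapping.keys (p * q)"
  then have "m \<in> {a + b |a b. a \<in> Poly_Mapping.keys p \<and> b \<in> Poly_Mapping.keys q}"
    using Poly_Mapping.keys_mult[of p q] by auto
  then obtain a b where "a \<in> Poly_Mapping.keys p" "b \<in> Poly_Mapping.keys q" "m = a + b"
    by auto
  then show "j + k \<le> mdeg m"
    using assms by (auto simp: order_ge_def mdeg_add add_mono)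
qed

lemma order_ge_mult_left: "order_ge k p \<Longrightarrow> order_ge k (q * p)"
  using order_ge_mult[of 0 q k p] by simp

lemma order_ge_power: "order_ge 1 p \<Longrightarrow> order_ge k (p ^ k)"
  by (induction k) (use order_ge_mult[of 1 p] in \<open>auto simp: plus_1_eq_Suc\<close>)

text \<open>Changing \<open>x\<close> by terms of order 2 changes \<open>x ^ t\<close> only from
  order \<open>t + 1\<close> on, by induction with \<open>g ^ Suc t - x ^ Suc t = g * (g ^ t - x ^
  t) + (g - x) * x ^ t\<close>.\<close>

lemma order_ge_power_diff:
  assumes "order_ge 1 x" "order_ge 2 (g - x)"
  shows "order_ge (Suc t) (g ^ t - x ^ t)"
proof (induction t)
  case (Suc t)
  have "order_ge 1 ((g - x) + x)"
    using assms by (intro order_ge_add) (auto intro: order_ge_mono)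
  then have g: "order_ge 1 g" by simp
  have "g ^ Suc t - x ^ Suc t = g * (g ^ t - x ^ t) + (g - x) * x ^ t"
    by (simp add: algebra_simps)
  moreover have "order_ge (1 + Suc t) (g * (g ^ t - x ^ t))"
    by (rule order_ge_mult[OF g Suc])
  moreover have "order_ge (2 + t) ((g - x) * x ^ t)"
    by (rule order_ge_mult[OF assms(2) order_ge_power[OF assms(1)]])
  ultimately show ?case
    by (simp add: order_ge_add plus_1_eq_Suc)
qed simp

text \<open>The ideal generated by the \<open>f i\<close>, enlarged by all polynomials of order at
  least \<open>N\<close>. Explicit sums make it easy to split off one generator.\<close>

definition trunc_ideal ::
    "'v set \<Rightarrow> ('i \<Rightarrow> ('v, 'k::field) mpoly) \<Rightarrow> 'i set \<Rightarrow> nat \<Rightarrow> ('v, 'k) mpoly set" where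
  "trunc_ideal W f I N =
     {(\<Sum>i\<in>I. f i * r i) + z |r z. (\<forall>i. r i \<in> polys_in W) \<and> z \<in> polys_in W \<and> order_ge N z}"

lemma trunc_idealI:
  "(\<And>i. r i \<in> polys_in W) \<Longrightarrow> z \<in> polys_in W \<Longrightarrow> order_ge N z \<Longrightarrow>
    (\<Sum>i\<in>I. f i * r i) + z \<in> trunc_ideal W f I N"
  by (auto simp: trunc_ideal_def)

lemma trunc_ideal_add:
  assumes "p \<in> trunc_ideal W f I N" "q \<in> trunc_ideal W f I N"
  shows "p + q \<in> trunc_ideal W f I N"
proof -
  obtain r z where p: "\<And>i. r i \<in> polys_in W" "z \<in> polys_in W" "order_ge N z"
    "p = (\<Sum>i\<in>I. f i * r i) + z"
    using assms(1) by (auto simp: trunc_ideal_def)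
  obtain r' z' where q: "\<And>i. r' i \<in> polys_in W" "z' \<in> polys_in W" "order_ge N z'"
    "q = (\<Sum>i\<in>I. f i * r' i) + z'"
    using assms(2) by (auto simp: trunc_ideal_def)
  have "p + q = (\<Sum>i\<in>I. f i * (r i + r' i)) + (z + z')"
    unfolding p q by (simp add: distrib_left sum.distrib)
  also have "\<dots> \<in> trunc_ideal W f I N"
    using p q by (intro trunc_idealI polys_in_add order_ge_add)
  finally show ?thesis .
qed

lemma trunc_ideal_mult:
  assumes "p \<in> trunc_ideal W f I N" "h \<in> polys_in W"
  shows "h * p \<in> trunc_ideal W f I N"
proof -
  obtain r z where p: "\<And>i. r i \<in> polys_in W" "z \<in> polys_in W" "order_ge N z"
    "p = (\<Sum>i\<in>I. f i * r i) + z"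
    using assms(1) by (auto simp: trunc_ideal_def)
  have "h * p = (\<Sum>i\<in>I. f i * (h * r i)) + h * z"
    unfolding p by (simp add: distrib_left sum_distrib_left ac_simps)
  also have "\<dots> \<in> trunc_ideal W f I N"
    using p assms(2) by (intro trunc_idealI polys_in_mult order_ge_mult_left)
  finally show ?thesis .
qed

lemma trunc_ideal_order_ge:
  "z \<in> polys_in W \<Longrightarrow> order_ge N z \<Longrightarrow> z \<in> trunc_ideal W f I N"
  using trunc_idealI[of "\<lambda>_. 0" W z N f I] by simp

lemma mult_in_span_image: "p \<in> mpoly.span E \<Longrightarrow> h * p \<in> mpoly.span ((*) h ` E)"
proof (induction rule: mpoly.span_induct_alt)
  case (step c x y)
  have "h * (cscale c x + y) = cscale c (h * x) + h * y"
    by (simp add: distrib_left cscale_mult_right)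
  then show ?case
    using step by (simp add: mpoly.span_add mpoly.span_scale mpoly.span_base)
qed (simp add: mpoly.span_zero)

text \<open>Dropping one generator of positive order multiplies the size of a spanning set by at
  most \<open>N\<close>: rewriting the cofactor of \<open>f j\<close> again and again expands
  \<open>p\<close> in powers of \<open>f j\<close> with coefficients in the span of
  \<open>E\<close>, and \<open>f j ^ N\<close> has order at least \<open>N\<close>.\<close>

lemma span_reduce_generator:
  fixes E :: "('v, 'k::field) mpoly set"
  assumes E: "finite E" "E \<subseteq> polys_in W" and "finite I" "j \<notin> I"
    and f: "f j \<in> polys_in W" "order_ge 1 (f j)"
    and gen: "\<And>p. p \<in> polys_in W \<Longrightarrow> \<exists>b\<in>mpoly.span E. p - b \<in> trunc_ideal W f (insert j I) N"
  obtains E' where "finite E'" "E' \<subseteq> polys_in W" "card E' \<le> N * card E"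
    "\<And>p. p \<in> polys_in W \<Longrightarrow> \<exists>b\<in>mpoly.span E'. p - b \<in> trunc_ideal W f I N"
proof -
  let ?E = "\<lambda>k. \<Union>a<k. (*) (f j ^ a) ` E"
  have *: "\<exists>b r z. b \<in> mpoly.span (?E k) \<and> r \<in> polys_in W \<and> z \<in> trunc_ideal W f I N \<and>
      p = b + f j ^ k * r + z" if p: "p \<in> polys_in W" for p k
  proof (induction k)
    case 0
    show ?case
      using p by (intro exI[of _ 0] exI[of _ p])
        (auto simp: mpoly.span_zero intro: trunc_ideal_order_ge)
  next
    case (Suc k)
    then obtain b r z where b: "b \<in> mpoly.span (?E k)" and r: "r \<in> polys_in W"
      and z: "z \<in> trunc_ideal W f I N" and p: "p = b + f j ^ k * r + z"
      by blast
    obtain b' where b': "b' \<in> mpoly.span E" "r - b' \<in> trunc_ideal W f (insert j I) N"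
      using gen[OF r] by blast
    then obtain s y where s: "\<And>i. s i \<in> polys_in W" "y \<in> polys_in W" "order_ge N y"
      "r - b' = (\<Sum>i\<in>insert j I. f i * s i) + y"
      by (auto simp: trunc_ideal_def)
    define x where "x = (\<Sum>i\<in>I. f i * s i) + y"
    have x: "x \<in> trunc_ideal W f I N"
      unfolding x_def by (rule trunc_idealI[OF s(1-3)])
    have "r = b' + f j * s j + x"
      using s(4) assms(3,4) by (simp add: x_def algebra_simps)
    then have "p = (b + f j ^ k * b') + f j ^ Suc k * s j + (z + f j ^ k * x)"
      unfolding p by (simp add: algebra_simps)
    moreover have "b + f j ^ k * b' \<in> mpoly.span (?E (Suc k))"
    proof (rule mpoly.span_add)
      show "b \<in> mpoly.span (?E (Suc k))"
        using mpoly.span_mono[of "?E k" "?E (Suc k)"] b by (auto simp: lessThan_Suc)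
      show "f j ^ k * b' \<in> mpoly.span (?E (Suc k))"
        using mpoly.span_mono[of "(*) (f j ^ k) ` E" "?E (Suc k)"] mult_in_span_image[OF b'(1)]
        by (auto simp: lessThan_Suc)
    qed
    moreover have "z + f j ^ k * x \<in> trunc_ideal W f I N"
      by (intro trunc_ideal_add z trunc_ideal_mult x polys_in_power f)
    ultimately show ?case
      using s(1) by blast
  qed
  show ?thesis
  proof (rule that[of "?E N"])
    show "finite (?E N)" using E(1) by auto
    show "?E N \<subseteq> polys_in W"
      using E(2) f(1) by (auto intro!: polys_in_mult polys_in_power)
    have "card (?E N) \<le> (\<Sum>a<N. card ((*) (f j ^ a) ` E))"
      by (rule card_UN_le) simp
    also have "\<dots> \<le> (\<Sum>a<N. card E)"
      by (intro sum_mono card_image_le E(1))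
    finally show "card (?E N) \<le> N * card E" by simp
    fix p :: "('v, 'k) mpoly" assume "p \<in> polys_in W"
    from *[OF this, of N] obtain b r z where b: "b \<in> mpoly.span (?E N)" and r: "r \<in> polys_in W"
      and z: "z \<in> trunc_ideal W f I N" and p: "p = b + f j ^ N * r + z"
      by blast
    have "r * f j ^ N \<in> trunc_ideal W f I N"
      using f r order_ge_power by (intro trunc_ideal_order_ge order_ge_mult_left polys_in_mult polys_in_power)
    then have "f j ^ N * r + z \<in> trunc_ideal W f I N"
      using trunc_ideal_add z by (metis mult.commute)
    then show "\<exists>b\<in>mpoly.span (?E N). p - b \<in> trunc_ideal W f I N"
      using b p by (intro bexI[of _ b]) (auto simp: algebra_simps)
  qed
qed

text \<open>Each generator costs a factor \<open>N\<close>; once all are dropped, only polynomials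
  of order at least \<open>N\<close> remain in the truncated ideal.\<close>

lemma span_reduce_generators:
  fixes E :: "('v, 'k::field) mpoly set"
  assumes "finite I" "finite E" "E \<subseteq> polys_in W"
    and "\<And>i. i \<in> I \<Longrightarrow> f i \<in> polys_in W" "\<And>i. i \<in> I \<Longrightarrow> order_ge 1 (f i)"
    and "\<And>p. p \<in> polys_in W \<Longrightarrow> \<exists>b\<in>mpoly.span E. p - b \<in> trunc_ideal W f I N"
  shows "\<exists>E' :: ('v, 'k) mpoly set. finite E' \<and> card E' \<le> N ^ card I * card E \<and>
    (\<forall>p\<in>polys_in W. \<exists>b\<in>mpoly.span E'. order_ge N (p - b))"
  using assms
proof (induction I arbitrary: E rule: finite_induct)
  case empty
  have "\<exists>b\<in>mpoly.span E. order_ge N (p - b)" if "p \<in> polys_in W" for p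
    using empty(5)[OF that] by (auto simp: trunc_ideal_def)
  then show ?case
    using empty(1) by (intro exI[of _ E]) simp
next
  case (insert j I)
  obtain E' :: "('v, 'k) mpoly set" where E': "finite E'" "E' \<subseteq> polys_in W" "card E' \<le> N * card E"
    "\<And>p. p \<in> polys_in W \<Longrightarrow> \<exists>b\<in>mpoly.span E'. p - b \<in> trunc_ideal W f I N"
    by (rule span_reduce_generator[OF insert.prems(1,2) insert.hyps(1,2) insert.prems(3,4)[OF insertI1]
          insert.prems(5)], assumption) (rule that; assumption)
  obtain E'' :: "('v, 'k) mpoly set" where "finite E''" "card E'' \<le> N ^ card I * card E'"
    "\<forall>p\<in>polys_in W. \<exists>b\<in>mpoly.span E''. order_ge N (p - b)"
    using insert.IH[OF E'(1,2) _ _ E'(4)] insert.prems by blast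
  have "card E'' \<le> N ^ card I * (N * card E)"
    using mult_left_mono[OF E'(3), of "N ^ card I"] \<open>card E'' \<le> N ^ card I * card E'\<close> by linarith
  then have "card E'' \<le> N ^ card (insert j I) * card E"
    using insert.hyps by (simp add: mult.assoc mult.left_commute)
  with \<open>finite E''\<close> \<open>\<forall>p\<in>polys_in W. \<exists>b\<in>mpoly.span E''. order_ge N (p - b)\<close> show ?case
    by blast
qed

text \<open>For \<open>v\<close> in \<open>D\<close> the power \<open>g v ^ t\<close> lies in the
  ideal and differs from the \<open>t\<close>-th power of \<open>var v\<close> by terms of order
  above \<open>t\<close>. A monomial divisible by that power can therefore be traded for terms of
  higher order, and from order \<open>N\<close> on everything lies in the truncated ideal.\<close>

lemma span_standard_monomials:
  fixes f :: "'i \<Rightarrow> ('v, 'k::field) mpoly"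
  assumes "D \<subseteq> W"
    and g: "\<And>v. v \<in> D \<Longrightarrow> g v \<in> polys_in W" "\<And>v. v \<in> D \<Longrightarrow> order_ge 2 (g v - var v)"
    and gt: "\<And>v. v \<in> D \<Longrightarrow> \<exists>r. (\<forall>i. r i \<in> polys_in W) \<and> g v ^ t = (\<Sum>i\<in>I. f i * r i)"
    and p: "p \<in> polys_in W"
  shows "\<exists>b\<in>mpoly.span (mon ` monoms_below W (\<lambda>v. if v \<in> D then t else N)).
    p - b \<in> trunc_ideal W f I N"
proof -
  let ?B = "mon ` monoms_below W (\<lambda>v. if v \<in> D then t else N) :: ('v, 'k) mpoly set"
  define S where "S = {b + z |b z. b \<in> mpoly.span ?B \<and> z \<in> trunc_ideal W f I N}"
  have S_span: "b \<in> S" if "b \<in> mpoly.span ?B" for b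
    using that trunc_ideal_order_ge[of 0 W N f I] unfolding S_def by force
  have S_trunc: "z \<in> S" if "z \<in> trunc_ideal W f I N" for z
    using that mpoly.span_zero[of ?B] unfolding S_def by force
  have S_add: "p + q \<in> S" if pq: "p \<in> S" "q \<in> S" for p q
  proof -
    obtain b z where p: "b \<in> mpoly.span ?B" "z \<in> trunc_ideal W f I N" "p = b + z"
      using pq(1) by (auto simp: S_def)
    obtain b' z' where q: "b' \<in> mpoly.span ?B" "z' \<in> trunc_ideal W f I N" "q = b' + z'"
      using pq(2) by (auto simp: S_def)
    have "p + q = (b + b') + (z + z')"
      unfolding p q by simp
    then show ?thesis
      using mpoly.span_add[OF p(1) q(1)] trunc_ideal_add[OF p(2) q(2)] unfolding S_def by blast
  qed
  have S_cscale: "cscale c p \<in> S" if pS: "p \<in> S" for c p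
  proof -
    obtain b z where p: "b \<in> mpoly.span ?B" "z \<in> trunc_ideal W f I N" "p = b + z"
      using pS by (auto simp: S_def)
    have "cscale c p = cscale c b + cscale c z"
      unfolding p by (rule mpoly.scale_right_distrib)
    moreover have "cscale c z \<in> trunc_ideal W f I N"
      unfolding cscale_def using p(2) by (rule trunc_ideal_mult) simp
    ultimately show ?thesis
      using mpoly.span_scale[OF p(1)] unfolding S_def by blast
  qed
  have S_sum: "sum h A \<in> S" if "\<And>i. i \<in> A \<Longrightarrow> h i \<in> S" for h :: "('v \<Rightarrow>\<^sub>0 nat) \<Rightarrow> _" and A
    using that by (induction A rule: infinite_finite_induct) (auto simp: S_add S_span mpoly.span_zero)
  have "\<forall>p\<in>polys_in W. order_ge k p \<longrightarrow> p \<in> S" if "k \<le> N" for k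
    using that
  proof (induction k rule: inc_induct)
    case base
    then show ?case
      by (auto intro: S_trunc trunc_ideal_order_ge)
  next
    case (step k)
    have "mon m \<in> S" if m: "Poly_Mapping.keys m \<subseteq> W" "k \<le> mdeg m" for m
    proof -
      consider "Suc k \<le> mdeg m" | "m \<in> monoms_below W (\<lambda>v. if v \<in> D then t else N)"
        | "mdeg m = k" "m \<notin> monoms_below W (\<lambda>v. if v \<in> D then t else N)"
        using m(2) by linarith
      then show ?thesis
      proof cases
        case 1
        then show ?thesis
          using step.IH m(1) by (auto simp: polys_in_mon order_ge_mon)
      next
        case 2
        then show ?thesis
          by (auto intro: S_span mpoly.span_base)
      next
        case 3
        then obtain v where v: "v \<in> W" "\<not> Poly_Mapping.lookup m v < (if v \<in> D then t else N)"
          using m(1) by (auto simp: monoms_below_def)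
        \<comment> \<open>Otherwise the exponent of \<open>v\<close> would be at least
          \<open>N\<close>, but the degree of \<open>m\<close> is \<open>k < N\<close>.\<close>
        have "v \<in> D"
        proof (rule ccontr)
          assume "v \<notin> D"
          then show False
            using v(2) lookup_le_mdeg[of m v] 3(1) step.hyps by simp
        qed
        then have tv: "t \<le> Poly_Mapping.lookup m v"
          using v(2) by simp
        define m' where "m' = m - Poly_Mapping.single v t"
        have mm': "m = Poly_Mapping.single v t + m'"
          by (rule poly_mapping_eqI)
            (use tv in \<open>auto simp: m'_def lookup_add lookup_minus lookup_single when_def\<close>)
        have m'W: "Poly_Mapping.keys m' \<subseteq> W"
        proof
          fix w assume "w \<in> Poly_Mapping.keys m'"
          then have "w \<in> Poly_Mapping.keys m"
            unfolding mm' by (auto simp: in_keys_iff lookup_add)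
          then show "w \<in> W" using m(1) by blast
        qed
        have deg: "t + mdeg m' = k"
          using 3(1) unfolding mm' mdeg_add by simp
        let ?x = "var v :: ('v, 'k) mpoly"
        have xt: "?x ^ t = mon (Poly_Mapping.single v t)"
          using mon_eval_var[of "Poly_Mapping.single v t"] by simp
        \<comment> \<open>The first summand lies in the truncated ideal; the second has order above
          \<open>k\<close> and falls under the induction hypothesis.\<close>
        have eq: "mon m = mon m' * g v ^ t + cscale (- 1) ((g v ^ t - ?x ^ t) * mon m')"
        proof -
          have "mon m = ?x ^ t * (mon m' :: ('v, 'k) mpoly)"
            unfolding xt mult_single mm' by simp
          then show ?thesis
            by (simp add: algebra_simps)
        qed
        obtain r where r: "\<forall>i. r i \<in> polys_in W" "g v ^ t = (\<Sum>i\<in>I. f i * r i)"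
          using gt[OF \<open>v \<in> D\<close>] by blast
        have "g v ^ t \<in> trunc_ideal W f I N"
          using trunc_idealI[of r W 0 N f I] r by simp
        then have 1: "mon m' * g v ^ t \<in> S"
          using m'W by (intro S_trunc trunc_ideal_mult) (auto simp: polys_in_mon)
        have "order_ge (Suc t + mdeg m') ((g v ^ t - ?x ^ t) * mon m')"
          using g(2)[OF \<open>v \<in> D\<close>] by (intro order_ge_mult order_ge_power_diff) (auto simp: order_ge_mon)
        moreover have "(g v ^ t - ?x ^ t) * mon m' \<in> polys_in W"
          using g(1)[OF \<open>v \<in> D\<close>] v(1) m'W
          by (intro polys_in_mult polys_in_diff polys_in_power) (auto simp: polys_in_mon)
        ultimately have "(g v ^ t - ?x ^ t) * mon m' \<in> S"
          using step.IH deg by auto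
        with 1 show ?thesis
          unfolding eq by (intro S_add S_cscale)
      qed
    qed
    then have "(\<Sum>m\<in>Poly_Mapping.keys p. cscale (Poly_Mapping.lookup p m) (mon m)) \<in> S"
      if "p \<in> polys_in W" "order_ge k p" for p
      using that by (intro S_sum S_cscale) (auto simp: polys_in_def order_ge_def)
    then show ?case
      by (simp add: sum_cscale_mon)
  qed
  from this[of 0] p obtain b z where "b \<in> mpoly.span ?B" "z \<in> trunc_ideal W f I N" "p = b + z"
    by (auto simp: S_def)
  then show ?thesis
    by (intro bexI[of _ b]) auto
qed

text \<open>The left side grows like \<open>q ^ w\<close>, the right side like
  \<open>q ^ (s + (w - d))\<close>.\<close>

lemma exponent_le_of_power_le':
  fixes w s t d :: nat
  assumes "\<And>q. q ^ w \<le> Suc (w * q) ^ s * (t ^ d * Suc (w * q) ^ (w - d))" "d \<le> w"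
  shows "d \<le> s"
proof (rule ccontr)
  assume "\<not> d \<le> s"
  define e where "e = s + (w - d)"
  \<comment> \<open>All factors independent of \<open>q\<close> are collected in \<open>c\<close>,
    so \<open>q = Suc c\<close> already violates the inequality.\<close>
  define c where "c = t ^ d * Suc w ^ e"
  have e: "Suc e \<le> w" using \<open>\<not> d \<le> s\<close> assms(2) by (simp add: e_def)
  let ?q = "Suc c"
  have "?q * ?q ^ e = ?q ^ Suc e"
    by simp
  also have "\<dots> \<le> ?q ^ w"
    using e by (intro power_increasing) auto
  also have "\<dots> \<le> Suc (w * ?q) ^ s * (t ^ d * Suc (w * ?q) ^ (w - d))"
    by (rule assms)
  also have "\<dots> = t ^ d * Suc (w * ?q) ^ e"
    by (simp add: e_def power_add)
  also have "\<dots> \<le> t ^ d * (Suc w * ?q) ^ e"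
    by (intro mult_left_mono power_mono) auto
  also have "\<dots> = c * ?q ^ e"
    unfolding c_def power_mult_distrib by (simp only: mult.assoc)
  finally show False
    by simp
qed

text \<open>Dimension count at the origin, with \<open>w = card W\<close> and
  \<open>d = card D\<close>. The standard monomials, \<open>t ^ d * N ^ (w - d)\<close> in number,
  span modulo the truncated ideal, and dropping the generators costs \<open>N ^ card I\<close>. The
  \<open>q ^ w\<close> monomials with exponents below \<open>q\<close> remain independent modulo
  order \<open>N\<close>. As \<open>N\<close> is linear in \<open>q\<close>, comparing growth gives
  the bound.\<close>

lemma card_le_of_regular_parameters:
  fixes f :: "'i \<Rightarrow> ('v, 'k::field) mpoly"
  assumes "finite W" "D \<subseteq> W" "finite I"
    and f: "\<And>i. i \<in> I \<Longrightarrow> f i \<in> polys_in W" "\<And>i. i \<in> I \<Longrightarrow> order_ge 1 (f i)"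
    and g: "\<And>v. v \<in> D \<Longrightarrow> g v \<in> polys_in W" "\<And>v. v \<in> D \<Longrightarrow> order_ge 2 (g v - var v)"
    and gt: "\<And>v. v \<in> D \<Longrightarrow> \<exists>r. (\<forall>i. r i \<in> polys_in W) \<and> g v ^ t = (\<Sum>i\<in>I. f i * r i)"
  shows "card D \<le> card I"
proof (rule exponent_le_of_power_le')
  show "card D \<le> card W"
    using assms(1,2) by (rule card_mono)
  fix q
  \<comment> \<open>The least choice of this shape that exceeds the bound \<open>card W * q\<close>
    on the degrees of monomials with exponents below \<open>q\<close>.\<close>
  define N where "N = Suc (card W * q)"
  let ?u = "\<lambda>v. if v \<in> D then t else N"
  let ?B = "mon ` monoms_below W ?u :: ('v, 'k) mpoly set"
  have finB: "finite ?B"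
    by (simp add: finite_card_monoms_below(1)[OF assms(1)])
  have BW: "?B \<subseteq> polys_in W"
    by (auto simp: polys_in_mon monoms_below_def)
  have "\<exists>E :: ('v, 'k) mpoly set. finite E \<and> card E \<le> N ^ card I * card ?B \<and>
      (\<forall>p\<in>polys_in W. \<exists>b\<in>mpoly.span E. order_ge N (p - b))"
    by (rule span_reduce_generators[OF assms(3) finB BW f span_standard_monomials[OF assms(2) g gt]])
  then obtain E :: "('v, 'k) mpoly set" where E: "finite E" "card E \<le> N ^ card I * card ?B"
    "\<And>p. p \<in> polys_in W \<Longrightarrow> \<exists>b\<in>mpoly.span E. order_ge N (p - b)"
    by blast
  let ?M = "monoms_below W (\<lambda>_. q)"
  have degM: "mdeg m < N" if "m \<in> ?M" for m
  proof -
    have "mdeg m = (\<Sum>v\<in>W. Poly_Mapping.lookup m v)"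
      using that assms(1) by (intro mdeg_superset) (auto simp: monoms_below_def)
    also have "\<dots> \<le> (\<Sum>v\<in>W. q)"
      using that by (intro sum_mono) (auto simp: monoms_below_def)
    finally show ?thesis by (simp add: N_def)
  qed
  have "\<forall>m\<in>?M. \<exists>b\<in>mpoly.span E. order_ge N (mon m - b)"
    by (intro ballI E(3)) (auto simp: polys_in_mon monoms_below_def)
  then obtain b where b: "\<And>m. m \<in> ?M \<Longrightarrow> b m \<in> mpoly.span E"
    "\<And>m. m \<in> ?M \<Longrightarrow> order_ge N (mon m - b m)"
    by metis
  have "card ?M \<le> card E"
  proof (rule card_le_card_spanning[OF E(1) finite_card_monoms_below(1)[OF assms(1)] b(1)])
    fix a m assume a: "(\<Sum>m\<in>?M. cscale (a m) (b m)) = 0" and m: "m \<in> ?M"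
    have "order_ge N (\<Sum>m\<in>?M. cscale (a m) (mon m - b m))"
      by (intro order_ge_sum order_ge_cscale b)
    also have "(\<Sum>m\<in>?M. cscale (a m) (mon m - b m)) = (\<Sum>m\<in>?M. cscale (a m) (mon m))"
      using a by (simp add: mpoly.scale_right_diff_distrib sum_subtractf)
    finally have "Poly_Mapping.lookup (\<Sum>m\<in>?M. cscale (a m) (mon m)) m = 0"
      using degM[OF m] unfolding order_ge_def by (meson in_keys_iff leD)
    moreover have "Poly_Mapping.lookup (\<Sum>m\<in>?M. cscale (a m) (mon m)) m =
        (\<Sum>m'\<in>?M. if m' = m then a m' else 0)"
      unfolding lookup_sum by (intro sum.cong) (auto simp: lookup_single when_def)
    ultimately show "a m = 0"
      using finite_card_monoms_below(1)[OF assms(1), of "\<lambda>_. q"] m by simp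
  qed
  also have "card E \<le> N ^ card I * card (monoms_below W ?u)"
    using E(2) card_image_le[OF finite_card_monoms_below(1)[OF assms(1), of ?u],
        of "mon :: _ \<Rightarrow> ('v, 'k) mpoly"]
    by (meson le_trans mult_le_mono2)
  also have "card (monoms_below W ?u) = t ^ card D * N ^ (card W - card D)"
  proof -
    have "(\<Prod>v\<in>W. ?u v) = (\<Prod>v\<in>W - D. ?u v) * (\<Prod>v\<in>D. ?u v)"
      using assms(1,2) by (rule prod.subset_diff[rotated])
    also have "\<dots> = N ^ card (W - D) * t ^ card D"
      by simp
    finally show ?thesis
      using assms(1,2) finite_subset[OF assms(2,1)]
      by (simp add: finite_card_monoms_below(2) card_Diff_subset)
  qed
  finally show "q ^ card W \<le>
      Suc (card W * q) ^ card I * (t ^ card D * Suc (card W * q) ^ (card W - card D))"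
    by (simp add: finite_card_monoms_below(2)[OF assms(1)] N_def)
qed

section \<open>Translation to a point where all columns agree\<close>

text \<open>
  Moves the point where every column of the generic matrix is \<open>(1, 0)\<close> to the origin; the extra
  summand \<open>var (2, r)\<close> makes \<open>var (2, j)\<close> the linear part of the image of \<open>minor r j\<close>.
\<close>

definition recenter :: "nat \<Rightarrow> nat \<times> nat \<Rightarrow> ('k::field) mpoly2" where
  "recenter r = (\<lambda>(i, j). if i = 1 then 1 + var (1, j)
     else if j = r then var (2, r) else var (2, j) + var (2, r))"

lemma polys_in_recenter:
  assumes "r \<in> {1..n}" "p \<in> polys_in (pvars n)"
  shows "subst (recenter r) p \<in> polys_in (pvars n)"
  using assms(2)
  by (rule polys_in_subst[rotated])
    (use assms(1) in \<open>auto simp: recenter_def pvars_def intro!: polys_in_add\<close>)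

lemma subst_recenter_xvar:
  "subst (recenter r) (xvar 1 j) = 1 + var (1, j)"
  "subst (recenter r) (xvar 2 r) = var (2, r)"
  "j \<noteq> r \<Longrightarrow> subst (recenter r) (xvar 2 j) = var (2, j) + var (2, r)"
  by (simp_all add: xvar_eq_var recenter_def)

lemma order_ge_recenter_xvar2: "order_ge 1 (subst (recenter r) (xvar 2 j))"
  by (cases "j = r") (simp_all add: subst_recenter_xvar order_ge_add)

lemma order_ge_recenter_minor: "order_ge 1 (subst (recenter r) (minor i j))"
  unfolding minor_def subst_diff subst_mult
  by (intro order_ge_diff order_ge_mult_left order_ge_recenter_xvar2)

lemma order_ge_recenter_minor_root:
  assumes "j \<noteq> r"
  shows "order_ge 2 (subst (recenter r) (minor r j) - var (2, j) :: ('k::field) mpoly2)"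
proof -
  let ?x = "\<lambda>i j. var (i, j) :: 'k mpoly2"
  have "subst (recenter r) (minor r j) - ?x 2 j =
      ?x 1 r * ?x 2 j + ?x 1 r * ?x 2 r - ?x 1 j * ?x 2 r"
    unfolding minor_def subst_diff subst_mult subst_recenter_xvar subst_recenter_xvar(3)[OF assms]
    by (simp add: algebra_simps)
  moreover have "order_ge 2 (?x a b * ?x c d)" for a b c d
    using order_ge_mult[of 1 "?x a b" 1 "?x c d"] by simp
  ultimately show ?thesis
    by (simp only: order_ge_add order_ge_diff)
qed

text \<open>The minor lies in \<open>J\<close> after localising at the chosen point: the multiplier
  \<open>M\<close> takes the value 1 there.\<close>

definition locally_parallel :: "nat \<Rightarrow> nat \<Rightarrow> ('k::field) mpoly2 set \<Rightarrow> nat \<Rightarrow> nat \<Rightarrow> bool" where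
  "locally_parallel n r J a b \<longleftrightarrow>
     (\<exists>M\<in>polys_in (pvars n). order_ge 1 (subst (recenter r) M - 1) \<and> M * minor a b \<in> J)"

text \<open>From \<open>xvar 1 b * minor a c = xvar 1 a * minor b c + xvar 1 c * minor a b\<close>,
  where \<open>xvar 1 b\<close> has the value 1 at the chosen point and so may join the
  multiplier.\<close>

lemma locally_parallel_trans:
  assumes J: "ideal J (poly_ring n)" and "a \<in> {1..n}" "b \<in> {1..n}" "c \<in> {1..n}"
    and "locally_parallel n r J a b" "locally_parallel n r J b c"
  shows "locally_parallel n r J a c"
proof -
  obtain M where M: "M \<in> polys_in (pvars n)" "order_ge 1 (subst (recenter r) M - 1)"
    "M * minor a b \<in> J"
    using assms(5) by (auto simp: locally_parallel_def)
  obtain M' where M': "M' \<in> polys_in (pvars n)" "order_ge 1 (subst (recenter r) M' - 1)"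
    "M' * minor b c \<in> J"
    using assms(6) by (auto simp: locally_parallel_def)
  have unit_mult: "order_ge 1 (p * q - 1)" if "order_ge 1 (p - 1)" "order_ge 1 (q - 1)"
    for p q :: "'a mpoly2"
  proof -
    have "order_ge 1 (q * (p - 1) + (q - 1))"
      using that by (intro order_ge_add order_ge_mult_left)
    then show ?thesis
      by (simp add: algebra_simps)
  qed
  let ?M = "M * M' * xvar 1 b"
  have "?M * minor a c =
      (M * xvar 1 a) * (M' * minor b c) + (M' * xvar 1 c) * (M * minor a b)"
    by (simp add: minor_def algebra_simps)
  also have "\<dots> \<in> J"
    using M(1) M'(1) assms(2-4)
    by (intro ideal_poly_ringD(3)[OF J ideal_poly_ringD(4)[OF J M'(3)] ideal_poly_ringD(4)[OF J M(3)]]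
        polys_in_mult polys_in_xvar) auto
  finally have "?M * minor a c \<in> J" .
  moreover have "order_ge 1 (subst (recenter r) ?M - 1)"
    unfolding subst_mult subst_recenter_xvar
    by (intro unit_mult M M') simp
  moreover have "?M \<in> polys_in (pvars n)"
    using M M' assms(3) by (intro polys_in_mult polys_in_xvar) auto
  ultimately show ?thesis
    unfolding locally_parallel_def by blast
qed

text \<open>Connectedness makes every column locally parallel to the column \<open>r\<close>. The
  resulting \<open>n - 1\<close> elements \<open>M j * minor r j\<close> of the ideal have, after
  recentering, the distinct variables \<open>var (2, j)\<close> as linear parts, so they serve as
  the \<open>g v\<close> of the dimension count.\<close>

lemma arith_rank_binomial_edge_ideal_ge:
  fixes G :: "nat pair_pre_digraph"
  assumes V: "parcs G \<subseteq> {1..n} \<times> {1..n}" "sym (parcs G)"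
    and conn: "\<And>i j. i \<in> {1..n} \<Longrightarrow> j \<in> {1..n} \<Longrightarrow> (i, j) \<in> (parcs G)\<^sup>*"
  shows "enat (n - 1) \<le> arith_rank (poly_ring n :: ('k::field) mpoly2 ring) (binomial_edge_ideal n G)"
  unfolding arith_rank_def
proof (rule Inf_greatest, safe)
  let ?R = "poly_ring n :: 'k mpoly2 ring"
  fix s and f :: "nat \<Rightarrow> 'k mpoly2"
  assume f: "f ` {1..s} \<subseteq> binomial_edge_ideal n G"
    and rad: "radical ?R (binomial_edge_ideal n G) = radical ?R (Idl\<^bsub>?R\<^esub> (f ` {1..s}))"
  define J :: "'k mpoly2 set" where "J = binomial_edge_ideal n G"
  note J = genideal_poly_ring[OF edge_minors_subset[OF V(1)], where 'a = 'k,
      folded binomial_edge_ideal_minor, folded J_def]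
  have edge: "minor i j \<in> J" if "(i, j) \<in> parcs G" for i j
    unfolding J_def by (rule minor_in_binomial_edge_ideal[OF V that])
  show "enat (n - 1) \<le> enat s"
  proof (cases "n = 0")
    case False
    define r :: nat where "r = 1"
    have r: "r \<in> {1..n}" using False by (simp add: r_def)
    let ?T = "subst (recenter r) :: 'k mpoly2 \<Rightarrow> 'k mpoly2"
    have par: "locally_parallel n r J r j" if "j \<in> {1..n}" for j
    proof -
      have "locally_parallel n r J r j \<and> j \<in> {1..n}" using conn[OF r that]
      proof (induction rule: rtrancl_induct)
        case base
        show ?case
          using r ideal_poly_ringD(2)[OF J(1)]
          by (auto simp: locally_parallel_def minor_def intro!: bexI[of _ 1])
      next
        case (step b c)
        have "c \<in> {1..n}" using step.hyps(2) V(1) by auto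
        moreover have "locally_parallel n r J b c"
          using edge[OF step.hyps(2)] by (auto simp: locally_parallel_def intro!: bexI[of _ 1])
        ultimately show ?case
          using locally_parallel_trans[OF J(1) r] step.IH by blast
      qed
      then show ?thesis by blast
    qed
    then obtain M where M: "\<And>j. j \<in> {1..n} \<Longrightarrow> M j \<in> polys_in (pvars n)"
      "\<And>j. j \<in> {1..n} \<Longrightarrow> order_ge 1 (?T (M j) - 1)"
      "\<And>j. j \<in> {1..n} \<Longrightarrow> M j * minor r j \<in> J"
      unfolding locally_parallel_def by metis
    define D where "D = (\<lambda>j. (2 :: nat, j)) ` ({1..n} - {r})"
    define g where "g v = ?T (M (snd v) * minor r (snd v))" for v :: "nat \<times> nat"
    have fW: "f ` {1..s} \<subseteq> polys_in (pvars n)"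
      using f ideal_poly_ringD(1)[OF J(1)] unfolding J_def by blast
    note F = genideal_poly_ring[OF fW]
    have "\<exists>t. (M j * minor r j) ^ t \<in> Idl\<^bsub>?R\<^esub> (f ` {1..s})" if "j \<in> {1..n}" for j
      using M(3)[OF that] rad radical_superset[OF J(1)] unfolding radical_poly_ring J_def by blast
    then obtain t where t: "\<And>j. j \<in> {1..n} \<Longrightarrow> (M j * minor r j) ^ t j \<in> Idl\<^bsub>?R\<^esub> (f ` {1..s})"
      by metis
    \<comment> \<open>One exponent has to serve all \<open>j\<close> at once.\<close>
    define t' where "t' = Max (t ` {1..n})"
    have gW: "M j * minor r j \<in> polys_in (pvars n)" if "j \<in> {1..n}" for j
      using M(1) that r by (intro polys_in_mult polys_in_minor)
    have t': "(M j * minor r j) ^ t' \<in> Idl\<^bsub>?R\<^esub> (f ` {1..s})" if "j \<in> {1..n}" for j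
    proof -
      have "t j \<le> t'" unfolding t'_def using that by (intro Max_ge) auto
      then have "(M j * minor r j) ^ t' = (M j * minor r j) ^ (t' - t j) * (M j * minor r j) ^ t j"
        by (simp flip: power_add)
      also have "\<dots> \<in> Idl\<^bsub>?R\<^esub> (f ` {1..s})"
        using that gW by (intro ideal_poly_ringD(4)[OF F(1)] t polys_in_power)
      finally show ?thesis .
    qed
    have "card D \<le> card {1..s}"
    proof (rule card_le_of_regular_parameters)
      show "finite (pvars n)" "D \<subseteq> pvars n" "finite {1..s}"
        by (auto simp: D_def)
      fix i assume i: "i \<in> {1..s}"
      show "?T (f i) \<in> polys_in (pvars n)"
        using fW i by (intro polys_in_recenter r) auto
      \<comment> \<open>The polynomials that vanish at the chosen point form an ideal. It contains
        all edge minors, hence every \<open>f i\<close>.\<close>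
      let ?I = "{p \<in> polys_in (pvars n). order_ge 1 (?T p)}"
      have "ideal ?I ?R"
        by (rule ideal_poly_ringI)
          (auto simp: subst_add subst_mult polys_in_add polys_in_mult order_ge_add order_ge_mult_left)
      then have "J \<subseteq> ?I"
        using edge_minors_subset[OF V(1)] order_ge_recenter_minor by (intro J(3)) auto
      then show "order_ge 1 (?T (f i))"
        using f i unfolding J_def by blast
    next
      fix v assume "v \<in> D"
      then obtain j where v: "v = (2, j)" "j \<in> {1..n}" "j \<noteq> r"
        unfolding D_def by blast
      show "g v \<in> polys_in (pvars n)"
        unfolding g_def using gW[OF v(2)] by (intro polys_in_recenter r) (simp add: v)
      define h where "h = ?T (minor r j) - var (2, j)"
      have h: "order_ge 2 h"
        unfolding h_def by (rule order_ge_recenter_minor_root[OF v(3)])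
      have "g v - var v = h + (?T (M j) - 1) * var (2, j) + (?T (M j) - 1) * h"
        unfolding g_def h_def v subst_mult by (simp add: algebra_simps)
      moreover have "order_ge (1 + 1) ((?T (M j) - 1) * var (2, j))"
        by (rule order_ge_mult[OF M(2)[OF v(2)]]) simp
      ultimately show "order_ge 2 (g v - var v)"
        using h by (simp add: order_ge_add order_ge_mult_left)
      obtain q where q: "\<And>i. q i \<in> polys_in (pvars n)"
        "(M j * minor r j) ^ t' = (\<Sum>i\<in>{1..s}. f i * q i)"
        using genideal_poly_ring_combination[OF _ fW t'[OF v(2)]] by blast
      have "g v ^ t' = (\<Sum>i\<in>{1..s}. ?T (f i) * ?T (q i))"
        unfolding g_def v snd_conv subst_power[symmetric] q(2) by (simp add: subst_sum subst_mult)
      then show "\<exists>r'. (\<forall>i. r' i \<in> polys_in (pvars n)) \<and> g v ^ t' = (\<Sum>i\<in>{1..s}. ?T (f i) * r' i)"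
        using q(1) by (intro exI[of _ "\<lambda>i. ?T (q i)"]) (auto intro: polys_in_recenter r)
    qed
    moreover have "card D = n - 1"
      unfolding D_def using r by (subst card_image) (auto simp: inj_on_def)
    ultimately show ?thesis by simp
  qed simp
qed

section \<open>Kernels of monomial substitutions\<close>

lemma mon_eval_cong:
  "(\<And>v. v \<in> Poly_Mapping.keys m \<Longrightarrow> \<sigma> v = \<tau> v) \<Longrightarrow> mon_eval \<sigma> m = mon_eval \<tau> m"
  unfolding mon_eval_def by (intro prod.cong) auto

text \<open>The additive map on exponent vectors induced by sending each variable \<open>v\<close>
  to the monomial \<open>t v\<close>; multiples of \<open>t v\<close> are written as iterated
  addition.\<close>

definition mono_image :: "('v \<Rightarrow> ('w \<Rightarrow>\<^sub>0 nat)) \<Rightarrow> ('v \<Rightarrow>\<^sub>0 nat) \<Rightarrow> ('w \<Rightarrow>\<^sub>0 nat)" where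
  "mono_image t m = (\<Sum>v\<in>Poly_Mapping.keys m. ((+) (t v) ^^ Poly_Mapping.lookup m v) 0)"

lemma lookup_mono_image:
  "Poly_Mapping.lookup (mono_image t m) w =
     (\<Sum>v\<in>Poly_Mapping.keys m. Poly_Mapping.lookup m v * Poly_Mapping.lookup (t v) w)"
proof -
  have "Poly_Mapping.lookup (((+) a ^^ k) 0) w = k * Poly_Mapping.lookup a w"
    for a :: "'a \<Rightarrow>\<^sub>0 nat" and k
    by (induction k) (auto simp: lookup_add)
  then show ?thesis
    by (simp add: mono_image_def lookup_sum)
qed

lemma mon_eval_mon:
  "mon_eval (\<lambda>v. mon (t v)) m = (mon (mono_image t m) :: ('w, 'k::comm_ring_1) mpoly)"
proof -
  have pow: "mon a ^ k = (mon (((+) a ^^ k) 0) :: ('w, 'k) mpoly)" for a k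
    by (induction k) (auto simp: mult_single)
  have "(\<Prod>v\<in>A. mon (h v) :: ('w, 'k) mpoly) = mon (\<Sum>v\<in>A. h v)" for A and h :: "'a \<Rightarrow> 'w \<Rightarrow>\<^sub>0 nat"
  proof (induction A rule: infinite_finite_induct)
    case (insert x F)
    show ?case
      unfolding sum.insert[OF insert.hyps] prod.insert[OF insert.hyps] insert.IH
      by (simp add: mult_single)
  qed auto
  then show ?thesis
    by (simp add: mon_eval_def mono_image_def pow)
qed

text \<open>Congruences modulo an ideal are compatible with products, by
  \<open>p * p' - q * q' = (p - q) * p' + q * (p' - q')\<close>.\<close>

lemma mon_eval_diff_in_ideal:
  assumes Q: "ideal Q (poly_ring n)"
    and "\<And>v. v \<in> Poly_Mapping.keys m \<Longrightarrow> a v \<in> polys_in (pvars n)"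
    "\<And>v. v \<in> Poly_Mapping.keys m \<Longrightarrow> b v \<in> polys_in (pvars n)"
    "\<And>v. v \<in> Poly_Mapping.keys m \<Longrightarrow> a v - b v \<in> Q"
  shows "mon_eval a m - mon_eval b m \<in> Q"
proof -
  have step: "p * p' - q * q' \<in> Q" if "p - q \<in> Q" "p' - q' \<in> Q" "p' \<in> polys_in (pvars n)" "q \<in> polys_in (pvars n)"
    for p q p' q'
  proof -
    have "(p - q) * p' + q * (p' - q') \<in> Q"
      by (intro ideal_poly_ringD(3)[OF Q ideal_poly_ringD(5)[OF Q that(1,3)] ideal_poly_ringD(4)[OF Q that(2,4)]])
    then show ?thesis
      by (simp add: algebra_simps)
  qed
  have pow: "p ^ k - q ^ k \<in> Q" if "p - q \<in> Q" "p \<in> polys_in (pvars n)" "q \<in> polys_in (pvars n)" for p q k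
    by (induction k) (auto intro: step that polys_in_power simp: ideal_poly_ringD(2)[OF Q])
  have "(\<Prod>v\<in>A. a v ^ e v) - (\<Prod>v\<in>A. b v ^ e v) \<in> Q" if "A \<subseteq> Poly_Mapping.keys m" for A and e :: "_ \<Rightarrow> nat"
    using that
  proof (induction A rule: infinite_finite_induct)
    case (insert x A)
    have "x \<in> Poly_Mapping.keys m" using insert.prems by simp
    then have "a x ^ e x - b x ^ e x \<in> Q" "b x ^ e x \<in> polys_in (pvars n)"
      using pow assms(2-4) by (auto intro: polys_in_power)
    moreover have "(\<Prod>v\<in>A. a v ^ e v) \<in> polys_in (pvars n)"
      using insert.prems assms(2) by (intro polys_in_prod polys_in_power) auto
    ultimately show ?case
      using step insert.IH insert.prems by (simp add: insert.hyps)
  qed (use ideal_poly_ringD(2)[OF Q] in auto)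
  then show ?thesis
    unfolding mon_eval_def by blast
qed

text \<open>The kernel of a monomial map is spanned by differences of monomials with equal image. In
  each fibre of \<open>\<tau>\<close> the coefficients add up to zero, so replacing every monomial
  by a representative of its fibre leaves zero and changes the sum only by elements of
  \<open>Q\<close>.\<close>

lemma sum_mon_in_ideal:
  fixes \<tau> :: "_ \<Rightarrow> ('w \<Rightarrow>\<^sub>0 nat)" and c :: "_ \<Rightarrow> 'k::field"
  assumes "finite K" "(\<Sum>m\<in>K. cscale (c m) (mon (\<tau> m))) = 0" "0 \<in> Q"
    and Q: "\<And>a b. a \<in> Q \<Longrightarrow> b \<in> Q \<Longrightarrow> a + b \<in> Q" "\<And>c a. a \<in> Q \<Longrightarrow> cscale c a \<in> Q"
    and diff: "\<And>m m'. m \<in> K \<Longrightarrow> m' \<in> K \<Longrightarrow> \<tau> m = \<tau> m' \<Longrightarrow> mon m - mon m' \<in> Q"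
  shows "(\<Sum>m\<in>K. cscale (c m) (mon m)) \<in> Q"
proof -
  define rep where "rep \<mu> = (SOME m. m \<in> K \<and> \<tau> m = \<mu>)" for \<mu>
  have rep: "rep (\<tau> m) \<in> K \<and> \<tau> (rep (\<tau> m)) = \<tau> m" if "m \<in> K" for m
    unfolding rep_def by (rule someI) (use that in auto)
  have A: "(\<Sum>m\<in>A. cscale (c m) (mon m - mon (rep (\<tau> m)))) \<in> Q" if "A \<subseteq> K" for A
    using that
  proof (induction A rule: infinite_finite_induct)
    case (insert x A)
    then show ?case
      using rep[of x] diff[of x "rep (\<tau> x)"] by (auto intro!: Q)
  qed (use assms(3) in auto)
  have "(\<Sum>m\<in>K. cscale (c m) (mon (rep (\<tau> m)) :: (_, 'k) mpoly)) = 0"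
  proof -
    have coeff: "(\<Sum>m | m \<in> K \<and> \<tau> m = \<mu>. c m) = 0" for \<mu>
    proof -
      have "(\<Sum>m | m \<in> K \<and> \<tau> m = \<mu>. c m) = (\<Sum>m\<in>K. if \<tau> m = \<mu> then c m else 0)"
        by (rule sum.inter_filter[OF assms(1)])
      also have "\<dots> = Poly_Mapping.lookup (\<Sum>m\<in>K. cscale (c m) (mon (\<tau> m))) \<mu>"
        unfolding lookup_sum by (intro sum.cong) (auto simp: lookup_single when_def)
      finally show ?thesis
        using assms(2) by simp
    qed
    have "(\<Sum>m\<in>K. cscale (c m) (mon (rep (\<tau> m)) :: (_, 'k) mpoly)) =
        (\<Sum>\<mu>\<in>\<tau> ` K. \<Sum>m | m \<in> K \<and> \<tau> m = \<mu>. cscale (c m) (mon (rep (\<tau> m))))"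
      by (rule sum.image_gen[OF assms(1)])
    also have "\<dots> = (\<Sum>\<mu>\<in>\<tau> ` K. cscale (\<Sum>m | m \<in> K \<and> \<tau> m = \<mu>. c m) (mon (rep \<mu>)))"
      unfolding mpoly.scale_sum_left by (intro sum.cong) auto
    also have "\<dots> = 0"
      by (simp add: coeff)
    finally show ?thesis .
  qed
  then show ?thesis
    using A[of K] by (simp add: mpoly.scale_right_diff_distrib sum_subtractf)
qed

section \<open>Prime ideals as kernels\<close>

text \<open>Only the source is restricted to \<open>pvars n\<close>: in the target, variables such
  as \<open>(3, c)\<close> are available as parameters.\<close>

definition ker_ideal :: "nat \<Rightarrow> (nat \<times> nat \<Rightarrow> ('k::field) mpoly2) \<Rightarrow> 'k mpoly2 set" where
  "ker_ideal n \<sigma> = {p \<in> polys_in (pvars n). subst \<sigma> p = 0}"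

text \<open>The target has no zero divisors; the lexicographic order on index pairs supplies the
  order on monomials behind this.\<close>

lemma primeideal_ker_ideal: "primeideal (ker_ideal n \<sigma>) (poly_ring n)"
proof (rule primeideal_poly_ringI)
  show "ideal (ker_ideal n \<sigma>) (poly_ring n)"
    by (rule ideal_poly_ringI)
      (auto simp: ker_ideal_def subst_add subst_mult polys_in_add polys_in_mult)
qed (auto simp: ker_ideal_def subst_mult)

section \<open>Building chains of primes\<close>

definition has_prime_chain :: "nat \<Rightarrow> nat \<Rightarrow> ('k::field) mpoly2 set \<Rightarrow> bool" where
  "has_prime_chain n l Q \<longleftrightarrow> (\<exists>P. prime_chain (poly_ring n) P l \<and> P l = Q)"

lemma has_prime_chain_0: "primeideal Q (poly_ring n) \<Longrightarrow> has_prime_chain n 0 Q"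
  unfolding has_prime_chain_def prime_chain_def by (intro exI[of _ "\<lambda>_. Q"]) auto

lemma has_prime_chain_Suc:
  assumes "has_prime_chain n l Q" "primeideal Q' (poly_ring n)" "Q \<subset> Q'"
  shows "has_prime_chain n (Suc l) Q'"
proof -
  obtain P where P: "prime_chain (poly_ring n) P l" "P l = Q"
    using assms(1) by (auto simp: has_prime_chain_def)
  have "prime_chain (poly_ring n) (P(Suc l := Q')) (Suc l)"
    using P assms(2,3) by (auto simp: prime_chain_def less_Suc_eq le_Suc_eq)
  then show ?thesis
    unfolding has_prime_chain_def by (intro exI[of _ "P(Suc l := Q')"]) auto
qed

text \<open>Enlarging the top prime keeps all inclusions below it strict.\<close>

lemma has_prime_chain_superset:
  assumes "has_prime_chain n l Q" "primeideal Q' (poly_ring n)" "Q \<subseteq> Q'"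
  shows "has_prime_chain n l Q'"
proof -
  obtain P where P: "prime_chain (poly_ring n) P l" "P l = Q"
    using assms(1) by (auto simp: has_prime_chain_def)
  have "prime_chain (poly_ring n) (P(l := Q')) l"
    unfolding prime_chain_def
  proof (intro conjI allI impI)
    fix i assume "i \<le> l"
    then show "primeideal ((P(l := Q')) i) (poly_ring n)"
      using P assms(2) by (auto simp: prime_chain_def)
  next
    fix i assume "i < l"
    then have "P i \<subset> P (Suc i)"
      using P by (auto simp: prime_chain_def)
    then show "(P(l := Q')) i \<subset> (P(l := Q')) (Suc i)"
      using \<open>i < l\<close> P(2) assms(3) by auto
  qed
  then show ?thesis
    unfolding has_prime_chain_def by (intro exI[of _ "P(l := Q')"]) auto
qed

lemma prime_height_ge: "has_prime_chain n l Q \<Longrightarrow> enat l \<le> prime_height (poly_ring n) Q"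
  unfolding has_prime_chain_def prime_height_def by (intro Sup_upper) auto

text \<open>A further substitution can only enlarge the kernel, and \<open>w\<close> witnesses that
  it does.\<close>

lemma has_prime_chain_subst:
  assumes "has_prime_chain n l (ker_ideal n \<sigma>)" "w \<in> polys_in (pvars n)"
    "subst \<sigma> w \<noteq> 0" "subst \<psi> (subst \<sigma> w) = 0"
  shows "has_prime_chain n (Suc l) (ker_ideal n (\<lambda>v. subst \<psi> (\<sigma> v)))"
proof (rule has_prime_chain_Suc[OF assms(1) primeideal_ker_ideal])
  have "w \<in> ker_ideal n (\<lambda>v. subst \<psi> (\<sigma> v)) - ker_ideal n \<sigma>"
    using assms(2-4) by (simp add: ker_ideal_def subst_subst)
  moreover have "ker_ideal n \<sigma> \<subseteq> ker_ideal n (\<lambda>v. subst \<psi> (\<sigma> v))"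
    by (auto simp: ker_ideal_def subst_subst[symmetric])
  ultimately show "ker_ideal n \<sigma> \<subset> ker_ideal n (\<lambda>v. subst \<psi> (\<sigma> v))"
    by blast
qed

section \<open>The height is at most \<open>n - 1\<close>\<close>

text \<open>The generic matrix whose second row is a multiple of the first: the top entries stay
  free and \<open>var (3, 0)\<close> is the common ratio.\<close>

definition rank_one :: "nat \<times> nat \<Rightarrow> ('k::field) mpoly2" where
  "rank_one = (\<lambda>(i, j). if i = 1 then var (1, j) else var (1, j) * var (3, 0))"

lemma minor_in_ker_rank_one:
  "i \<in> {1..n} \<Longrightarrow> j \<in> {1..n} \<Longrightarrow> minor i j \<in> ker_ideal n rank_one"
  unfolding ker_ideal_def
  by (simp add: polys_in_minor) (simp add: minor_def xvar_eq_var subst_diff subst_mult rank_one_def)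

text \<open>The substitution is injective on monomials in these variables: the exponent of
  \<open>(3, 0)\<close> in the image recovers that of \<open>(2, 1)\<close>, after which the
  exponents of the \<open>(1, c)\<close> can be read off.\<close>

lemma ker_rank_one_independent:
  fixes p :: "('k::field) mpoly2"
  assumes "p \<in> polys_in (insert (2, 1) ({1} \<times> {1..n}))" "subst rank_one p = 0"
  shows "p = 0"
proof -
  let ?t = "\<lambda>(i, j). if i = 1 then Poly_Mapping.single (1 :: nat, j) 1
    else Poly_Mapping.single (1, j) 1 + Poly_Mapping.single (3, 0 :: nat) (1 :: nat)"
  let ?K = "Poly_Mapping.keys p"
  have r1: "rank_one v = mon (?t v)" for v
    by (cases v) (simp add: rank_one_def mult_single)
  have K: "Poly_Mapping.keys m \<subseteq> insert (2, 1) ({1} \<times> {1..n})" if "m \<in> ?K" for m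
    using assms(1) that by (auto simp: polys_in_def)
  have t3: "Poly_Mapping.lookup (mono_image ?t m) (3, 0) = Poly_Mapping.lookup m (2, 1)" if "m \<in> ?K" for m
  proof -
    have "Poly_Mapping.lookup (mono_image ?t m) (3, 0) =
        (\<Sum>v\<in>Poly_Mapping.keys m. if v = (2, 1) then Poly_Mapping.lookup m v else 0)"
      unfolding lookup_mono_image using K[OF that]
      by (intro sum.cong) (auto simp: lookup_add lookup_single when_def split: if_splits)
    then show ?thesis
      by (simp add: in_keys_iff)
  qed
  have t1: "Poly_Mapping.lookup (mono_image ?t m) (1, c) =
      Poly_Mapping.lookup m (1, c) + (if c = 1 then Poly_Mapping.lookup m (2, 1) else 0)" if "m \<in> ?K" for m c
  proof -
    have "Poly_Mapping.lookup (mono_image ?t m) (1, c) =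
        (\<Sum>v\<in>Poly_Mapping.keys m. (if v = (1, c) then Poly_Mapping.lookup m v else 0) +
          (if v = (2, 1) then if c = 1 then Poly_Mapping.lookup m v else 0 else 0))"
      unfolding lookup_mono_image using K[OF that]
      by (intro sum.cong) (auto simp: lookup_add lookup_single when_def split: if_splits)
    then show ?thesis
      by (simp add: sum.distrib in_keys_iff)
  qed
  have "m = m'" if m: "m \<in> ?K" "m' \<in> ?K" "mono_image ?t m = mono_image ?t m'" for m m'
  proof (rule poly_mapping_eqI)
    fix v
    have 2: "Poly_Mapping.lookup m (2, 1) = Poly_Mapping.lookup m' (2, 1)"
      using t3[OF m(1)] t3[OF m(2)] m(3) by simp
    have 1: "Poly_Mapping.lookup m (1, c) = Poly_Mapping.lookup m' (1, c)" for c
      using t1[OF m(1), of c] t1[OF m(2), of c] unfolding m(3) 2 by linarith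
    show "Poly_Mapping.lookup m v = Poly_Mapping.lookup m' v"
    proof (cases "v \<in> insert (2, 1) ({1} \<times> {1..n})")
      case True
      then show ?thesis using 1 2 by auto
    next
      case False
      then have "v \<notin> Poly_Mapping.keys m" "v \<notin> Poly_Mapping.keys m'"
        using K m by blast+
      then show ?thesis by (simp add: in_keys_iff)
    qed
  qed
  moreover have "(\<Sum>m\<in>?K. cscale (Poly_Mapping.lookup p m) (mon (mono_image ?t m))) = (0 :: 'k mpoly2)"
    using assms(2) unfolding subst_def cscale_def r1 mon_eval_mon .
  \<comment> \<open>Here \<open>Q\<close> is \<open>{0}\<close>: monomials with equal images are
    equal, so their differences vanish.\<close>
  ultimately have "(\<Sum>m\<in>?K. cscale (Poly_Mapping.lookup p m) (mon m)) \<in> {0}"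
    by (intro sum_mon_in_ideal[where \<tau> = "mono_image ?t"]) auto
  then show ?thesis
    by (simp add: sum_cscale_mon)
qed

text \<open>The kernel of \<open>rank_one\<close> is a prime over the ideal, and
  \<open>n + 1\<close> of the \<open>2 * n\<close> variables are independent modulo it.\<close>

lemma height_binomial_edge_ideal_le:
  fixes G :: "nat pair_pre_digraph"
  assumes "parcs G \<subseteq> {1..n} \<times> {1..n}" "1 \<le> n"
  shows "height (poly_ring n :: ('k::field) mpoly2 ring) (binomial_edge_ideal n G) \<le> enat (n - 1)"
proof -
  let ?Q = "ker_ideal n rank_one :: 'k mpoly2 set"
  let ?Y = "insert (2, 1) ({1} \<times> {1..n}) :: (nat \<times> nat) set"
  have "binomial_edge_ideal n G \<subseteq> ?Q"
    unfolding binomial_edge_ideal_minor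
    using assms(1)
    by (intro genideal_poly_ring(3)[OF edge_minors_subset[OF assms(1)]]
        primeideal_poly_ringD(1)[OF primeideal_ker_ideal]) (auto intro!: minor_in_ker_rank_one)
  then have "height (poly_ring n) (binomial_edge_ideal n G :: 'k mpoly2 set) \<le> prime_height (poly_ring n) ?Q"
    unfolding height_def using primeideal_ker_ideal[of n rank_one] by (intro Inf_lower) blast
  also have "\<dots> \<le> enat (2 * n - card ?Y)"
    using assms(2) by (intro prime_height_le) (auto simp: ker_ideal_def intro: ker_rank_one_independent)
  also have "card ?Y = Suc n"
    by (subst card_insert_disjoint) (auto simp: card_cartesian_product)
  also have "2 * n - Suc n = n - 1"
    by linarith
  finally show ?thesis .
qed

section \<open>The height is at least \<open>n - 1\<close>\<close>

lemma mon_neq_0 [simp]: "mon m \<noteq> 0"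
  by (metis lookup_single_eq lookup_zero zero_neq_one)

text \<open>Setting the variables \<open>(1, a)\<close> and \<open>(2, b)\<close> to 1 and all
  others to 0 turns the minor into 1.\<close>

lemma minor_neq_0:
  assumes "a \<noteq> b"
  shows "minor a b \<noteq> (0 :: ('k::field) mpoly2)"
proof
  assume "minor a b = (0 :: 'k mpoly2)"
  then have "subst (\<lambda>v. if v = (1, a) \<or> v = (2, b) then 1 else 0) (minor a b :: 'k mpoly2) = (0 :: 'k mpoly2)"
    by simp
  then show False
    using assms by (simp add: minor_def xvar_eq_var subst_diff subst_mult)
qed

text \<open>
  \<open>A\<close> is the set of columns that have been specialised so far: columns in \<open>S\<close> become zero, any
  other column \<open>c\<close> becomes a multiple of the column \<open>r c\<close>. Specialising one more column
  lengthens the chain of kernels by two or by one.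
\<close>

definition star_param :: "nat set \<Rightarrow> (nat \<Rightarrow> nat) \<Rightarrow> nat set \<Rightarrow> nat \<times> nat \<Rightarrow> ('k::field) mpoly2" where
  "star_param S r A = (\<lambda>(i, c). if c \<in> A \<and> (i = 1 \<or> i = 2)
     then if c \<in> S then 0 else var (3, c) * var (i, r c) else var (i, c))"

lemma has_prime_chain_star_param:
  fixes S N :: "nat set"
  assumes "S \<subseteq> {1..n}" "N \<subseteq> {1..n}" "S \<inter> N = {}"
    and r: "\<And>c. c \<in> N \<Longrightarrow> r c \<in> {1..n} - S - N"
    and "A \<subseteq> S \<union> N"
  shows "has_prime_chain n (2 * card (A \<inter> S) + card (A \<inter> N))
    (ker_ideal n (star_param S r A :: nat \<times> nat \<Rightarrow> ('k::field) mpoly2))"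
proof -
  have "finite A"
    using assms(1,2,5) finite_subset by (meson finite_Un finite_atLeastAtMost)
  then show ?thesis
    using assms(5)
  proof (induction A rule: finite_induct)
    case empty
    show ?case
      using has_prime_chain_0[OF primeideal_ker_ideal] by simp
  next
    case (insert c A)
    let ?\<sigma> = "star_param S r A :: nat \<times> nat \<Rightarrow> 'k mpoly2"
    let ?l = "2 * card (A \<inter> S) + card (A \<inter> N)"
    have IH: "has_prime_chain n ?l (ker_ideal n ?\<sigma>)"
      using insert.IH insert.prems by blast
    have cn: "c \<in> {1..n}"
      using insert.prems assms(1,2) by blast
    have fin: "finite (A \<inter> S)" "finite (A \<inter> N)"
      using insert.hyps by auto
    \<comment> \<open>Representatives are never specialised themselves, so substituting for column
      \<open>c\<close> leaves the images of the earlier columns alone.\<close>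
    have A_root: "r d \<noteq> c \<and> r d \<notin> A" if "d \<in> A" "d \<notin> S" for d
      using that insert.prems r[of d] by blast
    show ?case
    proof (cases "c \<in> S")
      case True
      let ?\<psi> = "\<lambda>k v. if v = (k :: nat, c) then 0 else var v :: 'k mpoly2"
      \<comment> \<open>The two entries of column \<open>c\<close> are set to zero one after the
        other; each of them witnesses one strict inclusion.\<close>
      have chain1: "has_prime_chain n (Suc ?l) (ker_ideal n (\<lambda>v. subst (?\<psi> 1) (?\<sigma> v)))"
        using cn insert.hyps
        by (intro has_prime_chain_subst[OF IH, of "var (1, c)"]) (auto simp: star_param_def)
      have chain2: "has_prime_chain n (Suc (Suc ?l))
          (ker_ideal n (\<lambda>v. subst (?\<psi> 2) (subst (?\<psi> 1) (?\<sigma> v))))"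
        using cn insert.hyps
        by (intro has_prime_chain_subst[OF chain1, of "var (2, c)"]) (auto simp: star_param_def)
      have "(\<lambda>v. subst (?\<psi> 2) (subst (?\<psi> 1) (?\<sigma> v))) = star_param S r (insert c A)"
      proof
        fix v :: "nat \<times> nat"
        obtain i d where v: "v = (i, d)" by (cases v)
        have "d \<in> A \<Longrightarrow> d \<notin> S \<Longrightarrow> d \<noteq> c \<and> r d \<noteq> c"
          using A_root True by blast
        then show "subst (?\<psi> 2) (subst (?\<psi> 1) (?\<sigma> v)) = star_param S r (insert c A) v"
          using True insert.hyps(2)
          by (auto simp: v star_param_def subst_mult simp del: mult_single)
      qed
      moreover have "2 * card (insert c A \<inter> S) + card (insert c A \<inter> N) = Suc (Suc ?l)"
        using True assms(3) insert.hyps(2) fin by (auto simp: Int_insert_left)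
      ultimately show ?thesis
        using chain2 by simp
    next
      case False
      then have cN: "c \<in> N" using insert.prems by blast
      let ?\<psi> = "\<lambda>(i, d). if d = c \<and> (i = 1 \<or> i = 2) then var (3, c) * var (i, r c)
        else var (i, d) :: 'k mpoly2"
      have rc: "r c \<noteq> c" "r c \<in> {1..n}" "r c \<notin> A"
        using r[OF cN] cN insert.prems by auto
      \<comment> \<open>The minor of \<open>c\<close> and its representative is untouched by the
        earlier specialisations and is killed by this one, which gives one strict inclusion.\<close>
      have \<sigma>: "subst ?\<sigma> (minor c (r c)) = minor c (r c)"
        using insert.hyps(2) rc by (simp add: minor_def xvar_eq_var subst_diff subst_mult star_param_def)
      have \<psi>: "subst ?\<psi> (minor c (r c)) = 0"
        using rc by (simp add: minor_def xvar_eq_var subst_diff subst_mult algebra_simps del: mult_single)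
      have chain: "has_prime_chain n (Suc ?l) (ker_ideal n (\<lambda>v. subst ?\<psi> (?\<sigma> v)))"
        using cn rc minor_neq_0[of c "r c"] \<sigma> \<psi>
        by (intro has_prime_chain_subst[OF IH polys_in_minor[OF cn rc(2)]]) auto
      have "(\<lambda>v. subst ?\<psi> (?\<sigma> v)) = star_param S r (insert c A)"
      proof
        fix v :: "nat \<times> nat"
        obtain i d where v: "v = (i, d)" by (cases v)
        show "subst ?\<psi> (?\<sigma> v) = star_param S r (insert c A) v"
          using False insert.hyps(2) A_root[of d]
          by (auto simp: v star_param_def subst_mult simp del: mult_single)
      qed
      moreover have "2 * card (insert c A \<inter> S) + card (insert c A \<inter> N) = Suc ?l"
        using False cN insert.hyps(2) fin by (auto simp: Int_insert_left)
      ultimately show ?thesis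
        using chain by simp
    qed
  qed
qed

text \<open>Monomials involving a column of \<open>S\<close> lie in \<open>Q\<close> and map to
  zero. For the others it suffices that monomials with equal images are congruent modulo
  \<open>Q\<close>. Modulo \<open>Q\<close> a column \<open>c\<close> of \<open>N\<close> is a
  multiple of column \<open>r c\<close>, with a ratio whose denominator is a nonzero entry of column
  \<open>r c\<close>. After clearing denominators, each monomial is congruent to a polynomial that
  depends only on its image, and the denominators cancel because \<open>Q\<close> is prime.\<close>

lemma ker_star_param_subset:
  fixes Q :: "('k::field) mpoly2 set"
  assumes Q: "primeideal Q (poly_ring n)"
    and S: "S = {c \<in> {1..n}. xvar 1 c \<in> Q \<and> xvar 2 c \<in> Q}"
    and N: "N = {c \<in> {1..n} - S. r c \<noteq> c}"
    and r: "\<And>c. c \<in> {1..n} - S \<Longrightarrow> r c \<in> {1..n} - S"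
    and par: "\<And>c. c \<in> {1..n} - S \<Longrightarrow> minor c (r c) \<in> Q"
  shows "ker_ideal n (star_param S r (S \<union> N)) \<subseteq> Q"
proof
  fix f :: "'k mpoly2" assume f: "f \<in> ker_ideal n (star_param S r (S \<union> N))"
  note QI = primeideal_poly_ringD(1)[OF Q]
  note I = ideal_poly_ringD[OF QI]
  let ?\<Phi> = "star_param S r (S \<union> N) :: nat \<times> nat \<Rightarrow> 'k mpoly2"
  have fW: "f \<in> polys_in (pvars n)" and f0: "subst ?\<Phi> f = 0"
    using f by (auto simp: ker_ideal_def)
  \<comment> \<open>The row of an entry of column \<open>c\<close> that is nonzero modulo
    \<open>Q\<close>, for \<open>c\<close> outside \<open>S\<close>.\<close>
  define k where "k c = (if xvar 1 c \<in> Q then 2 else 1 :: nat)" for c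
  have k: "k c = 1 \<or> k c = 2" for c by (simp add: k_def)
  have pivot: "xvar (k c) c \<notin> Q" if "c \<in> {1..n} - S" for c
    using that by (auto simp: k_def S)
  \<comment> \<open>For \<open>c\<close> in \<open>N\<close>, column \<open>c\<close> equals
    \<open>?t c / ?p c\<close> times column \<open>r c\<close> modulo \<open>Q\<close>. The
    substitution \<open>?\<rho>\<close> inserts the numerators for the parameters
    \<open>(3, c)\<close>; \<open>?\<kappa>\<close> collects the denominators.\<close>
  let ?p = "\<lambda>c. if c \<in> N then xvar (k (r c)) (r c) else 1 :: 'k mpoly2"
  let ?t = "\<lambda>c. xvar (k (r c)) c :: 'k mpoly2"
  let ?\<kappa> = "\<lambda>(i :: nat, c). ?p c"
  let ?\<rho> = "\<lambda>(i :: nat, c). if i = 3 then ?t c else var (i, c)"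
  let ?\<kappa>' = "\<lambda>(i :: nat, c). if i = 3 then ?p c else 1"
  let ?G = "{m. Poly_Mapping.keys m \<subseteq> {1 :: nat, 2} \<times> ({1..n} - S)}"
  have v: "v \<in> {1 :: nat, 2} \<times> ({1..n} - S)" if "m \<in> ?G" "v \<in> Poly_Mapping.keys m" for m v
    using that by blast
  have \<Phi>: "?\<Phi> (i, c) = (if c \<in> N then var (3, c) * var (i, r c) else var (i, c))"
    if "i = 1 \<or> i = 2" "c \<in> {1..n} - S" for i c
    using that by (auto simp: star_param_def)
  \<comment> \<open>The denominator of a monomial is determined by its image, since the exponent of
    \<open>(3, c)\<close> counts the factors from column \<open>c\<close>.\<close>
  have \<kappa>: "mon_eval ?\<kappa> m = subst ?\<kappa>' (subst ?\<Phi> (mon m))" if m: "m \<in> ?G" for m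
    unfolding subst_mon subst_mon_eval
  proof (rule mon_eval_cong)
    fix w assume "w \<in> Poly_Mapping.keys m"
    then obtain i c where "w = (i, c)" "i = 1 \<or> i = 2" "c \<in> {1..n} - S"
      using v[OF m] by blast
    then show "?\<kappa> w = subst ?\<kappa>' (?\<Phi> w)"
      using \<Phi>[of i c] by (auto simp: subst_mult simp del: mult_single)
  qed
  have \<kappa>W: "?\<kappa> w \<in> polys_in (pvars n)" and \<kappa>Q: "?\<kappa> w \<notin> Q"
    if mw: "m \<in> ?G" "w \<in> Poly_Mapping.keys m" for m w
  proof -
    obtain i c where w: "w = (i, c)" "c \<in> {1..n} - S"
      using v[OF mw] by blast
    then show "?\<kappa> w \<in> polys_in (pvars n)"
      using r[of c] k by (auto intro!: polys_in_xvar)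
    show "?\<kappa> w \<notin> Q"
      using w r[of c] pivot[of "r c"] primeideal_poly_ringD(2)[OF Q] by auto
  qed
  have cong: "mon_eval ?\<kappa> m * mon m - subst ?\<rho> (subst ?\<Phi> (mon m)) \<in> Q" if m: "m \<in> ?G" for m
  proof -
    have "mon_eval (\<lambda>w. ?\<kappa> w * var w) m - mon_eval (\<lambda>w. subst ?\<rho> (?\<Phi> w)) m \<in> Q"
    proof (rule mon_eval_diff_in_ideal[OF QI])
      fix w assume w: "w \<in> Poly_Mapping.keys m"
      then obtain i c where ic: "w = (i, c)" "i = 1 \<or> i = 2" "c \<in> {1..n} - S"
        using v[OF m] by blast
      show "?\<kappa> w * var w \<in> polys_in (pvars n)"
        using \<kappa>W[OF m w] ic by (intro polys_in_mult) auto
      have rho: "subst ?\<rho> (?\<Phi> w) = (if c \<in> N then ?t c * var (i, r c) else var (i, c))"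
        using \<Phi>[OF ic(2,3)] ic(1,2) by (auto simp: subst_mult simp del: mult_single)
      show "subst ?\<rho> (?\<Phi> w) \<in> polys_in (pvars n)"
        unfolding rho using ic r[OF ic(3)] k[of "r c"] by (auto intro!: polys_in_mult polys_in_xvar)
      show "?\<kappa> w * var w - subst ?\<rho> (?\<Phi> w) \<in> Q"
      proof (cases "c \<in> N")
        case True
        have "?\<kappa> w * var w - subst ?\<rho> (?\<Phi> w) =
            xvar (k (r c)) (r c) * xvar i c - xvar (k (r c)) c * xvar i (r c)"
          unfolding rho using True ic(1) by (simp add: xvar_eq_var del: mult_single)
        also have "\<dots> \<in> {0, minor c (r c), - minor c (r c)}"
          using ic(2) k[of "r c"] by (auto simp: minor_def algebra_simps)
        also have "\<dots> \<subseteq> Q"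
          using par[OF ic(3)] I(2,6) by auto
        finally show ?thesis .
      next
        case False
        then show ?thesis
          unfolding rho using ic(1) I(2) by simp
      qed
    qed
    moreover have "mon_eval (\<lambda>w. ?\<kappa> w * var w) m = mon_eval ?\<kappa> m * mon m"
      unfolding mon_eval_var[of m, symmetric]
      by (simp add: mon_eval_def power_mult_distrib prod.distrib)
    ultimately show ?thesis
      by (simp add: subst_mon_eval)
  qed
  have diff: "mon m - mon m' \<in> Q"
    if m: "m \<in> ?G" "m' \<in> ?G" "subst ?\<Phi> (mon m) = subst ?\<Phi> (mon m')" for m m'
  proof -
    have "mon_eval ?\<kappa> m' = mon_eval ?\<kappa> m"
      unfolding \<kappa>[OF m(1)] \<kappa>[OF m(2)] m(3) ..
    with I(7)[OF cong[OF m(1)] cong[OF m(2)]] have "mon_eval ?\<kappa> m * (mon m - mon m') \<in> Q"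
      unfolding m(3) by (simp add: algebra_simps del: mult_single)
    moreover have "mon_eval ?\<kappa> m \<notin> Q"
      by (rule primeideal_poly_ring_mon_eval[OF Q \<kappa>W[OF m(1)] \<kappa>Q[OF m(1)]])
    moreover have "mon_eval ?\<kappa> m \<in> polys_in (pvars n)"
      by (rule polys_in_mon_eval[OF \<kappa>W[OF m(1)]])
    moreover have "mon m - mon m' \<in> polys_in (pvars n)"
      using m(1,2) by (intro polys_in_diff) (auto simp: polys_in_mon pvars_def)
    ultimately show ?thesis
      using primeideal_poly_ringD(3)[OF Q] by blast
  qed
  let ?tt = "\<lambda>(i, c). if c \<in> N then Poly_Mapping.single (3 :: nat, c) 1 + Poly_Mapping.single (i, r c) 1
    else Poly_Mapping.single (i, c) (1 :: nat)"
  have \<Phi>_mon: "subst ?\<Phi> (mon m) = mon (mono_image ?tt m)" if m: "m \<in> ?G" for m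
    unfolding subst_mon mon_eval_mon[of ?tt m, symmetric]
  proof (rule mon_eval_cong)
    fix w assume "w \<in> Poly_Mapping.keys m"
    then obtain i c where "w = (i, c)" "i = 1 \<or> i = 2" "c \<in> {1..n} - S"
      using v[OF m] by blast
    then show "?\<Phi> w = mon (?tt w)"
      using \<Phi>[of i c] by (auto simp: mult_single)
  qed
  let ?K = "Poly_Mapping.keys f"
  \<comment> \<open>A monomial outside \<open>?G\<close> contains a variable from a column of
    \<open>S\<close>.\<close>
  have bad: "subst ?\<Phi> (mon m) = 0 \<and> mon m \<in> Q" if m: "m \<in> ?K - ?G" for m
  proof -
    have "Poly_Mapping.keys m \<subseteq> pvars n"
      using m fW by (auto simp: polys_in_def)
    then obtain i c where ic: "(i, c) \<in> Poly_Mapping.keys m" "i = 1 \<or> i = 2" "c \<in> S"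
      using m by (force simp: pvars_def)
    have "m = Poly_Mapping.single (i, c) 1 + (m - Poly_Mapping.single (i, c) 1)"
      using ic(1) by (intro poly_mapping_eqI) (auto simp: lookup_add lookup_minus lookup_single when_def in_keys_iff)
    then obtain m' where m': "m = Poly_Mapping.single (i, c) 1 + m'" by blast
    have split: "mon m = var (i, c) * (mon m' :: 'k mpoly2)"
      by (simp add: m' mult_single)
    have "Poly_Mapping.keys m' \<subseteq> Poly_Mapping.keys m"
      unfolding m' by (auto simp: in_keys_iff lookup_add)
    then have "mon m' \<in> polys_in (pvars n)"
      using \<open>Poly_Mapping.keys m \<subseteq> pvars n\<close> by (auto simp: polys_in_mon)
    moreover have "var (i, c) \<in> Q"
      using ic(2,3) by (auto simp: S xvar_eq_var)
    ultimately have "mon m \<in> Q"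
      unfolding split by (intro I(5))
    moreover have "subst ?\<Phi> (mon m) = 0"
      unfolding split subst_mult using ic by (simp add: star_param_def)
    ultimately show ?thesis by blast
  qed
  have split: "sum h ?K = sum h (?K \<inter> ?G) + sum h (?K - ?G)" for h :: "_ \<Rightarrow> 'k mpoly2"
    by (rule sum.Int_Diff) simp
  have "(\<Sum>m\<in>?K. cscale (Poly_Mapping.lookup f m) (subst ?\<Phi> (mon m))) = 0"
    using f0 unfolding subst_mon unfolding subst_def cscale_def .
  moreover have "(\<Sum>m\<in>?K - ?G. cscale (Poly_Mapping.lookup f m) (subst ?\<Phi> (mon m))) = 0"
  proof (rule sum.neutral, rule ballI)
    fix m assume "m \<in> ?K - ?G"
    then show "cscale (Poly_Mapping.lookup f m) (subst ?\<Phi> (mon m)) = 0"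
      using bad[of m] by (simp del: subst_mon)
  qed
  moreover have "(\<Sum>m\<in>?K \<inter> ?G. cscale (Poly_Mapping.lookup f m) (subst ?\<Phi> (mon m))) =
      (\<Sum>m\<in>?K \<inter> ?G. cscale (Poly_Mapping.lookup f m) (mon (mono_image ?tt m)))"
    by (intro sum.cong refl arg_cong[where f = "cscale _"] \<Phi>_mon) blast
  ultimately have "(\<Sum>m\<in>?K \<inter> ?G. cscale (Poly_Mapping.lookup f m) (mon (mono_image ?tt m))) = (0 :: 'k mpoly2)"
    unfolding split by simp
  then have "(\<Sum>m\<in>?K \<inter> ?G. cscale (Poly_Mapping.lookup f m) (mon m)) \<in> Q"
  proof (rule sum_mon_in_ideal[rotated])
    show "mon m - mon m' \<in> Q" if "m \<in> ?K \<inter> ?G" "m' \<in> ?K \<inter> ?G" "mono_image ?tt m = mono_image ?tt m'" for m m'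
      using that by (intro diff) (auto simp: \<Phi>_mon simp del: subst_mon)
  qed (use I ideal_poly_ring_cscale[OF QI] in auto)
  moreover have "(\<Sum>m\<in>?K - ?G. cscale (Poly_Mapping.lookup f m) (mon m)) \<in> Q"
    using bad by (intro ideal_poly_ring_sum[OF QI] ideal_poly_ring_cscale[OF QI]) blast
  ultimately have "(\<Sum>m\<in>?K. cscale (Poly_Mapping.lookup f m) (mon m)) \<in> Q"
    unfolding split by (rule I(3))
  then show "f \<in> Q"
    by (simp add: sum_cscale_mon)
qed

text \<open>
  The hypothesis says that deleting any vertex set \<open>S\<close> leaves at most \<open>card S + 1\<close> connected
  components; \<open>r\<close> picks a representative of each component.
\<close>

lemma height_binomial_edge_ideal_ge:
  fixes G :: "nat pair_pre_digraph"
  assumes V: "parcs G \<subseteq> {1..n} \<times> {1..n}" "sym (parcs G)"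
    and comp: "\<And>S. S \<subseteq> {1..n} \<Longrightarrow> \<exists>r. (\<forall>c\<in>{1..n} - S. r c \<in> {1..n} - S \<and> r (r c) = r c \<and>
        (c, r c) \<in> (parcs G \<inter> (- S) \<times> (- S))\<^sup>*) \<and> card (r ` ({1..n} - S)) \<le> Suc (card S)"
  shows "enat (n - 1) \<le> height (poly_ring n :: ('k::field) mpoly2 ring) (binomial_edge_ideal n G)"
  unfolding height_def
proof (rule Inf_greatest, safe)
  fix Q :: "'k mpoly2 set"
  assume Q: "primeideal Q (poly_ring n)" and JQ: "binomial_edge_ideal n G \<subseteq> Q"
  note QI = primeideal_poly_ringD(1)[OF Q]
  note I = ideal_poly_ringD[OF QI]
  define S where "S = {c \<in> {1..n}. xvar 1 c \<in> Q \<and> xvar 2 c \<in> Q}"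
  have SV: "S \<subseteq> {1..n}" by (auto simp: S_def)
  obtain r where r: "\<And>c. c \<in> {1..n} - S \<Longrightarrow> r c \<in> {1..n} - S"
    "\<And>c. c \<in> {1..n} - S \<Longrightarrow> r (r c) = r c"
    "\<And>c. c \<in> {1..n} - S \<Longrightarrow> (c, r c) \<in> (parcs G \<inter> (- S) \<times> (- S))\<^sup>*"
    "card (r ` ({1..n} - S)) \<le> Suc (card S)"
    using comp[OF SV] by blast
  define N where "N = {c \<in> {1..n} - S. r c \<noteq> c}"
  have edge: "minor i j \<in> Q" if "(i, j) \<in> parcs G" for i j
    using minor_in_binomial_edge_ideal[OF V that] JQ by blast
  have par: "minor c (r c) \<in> Q" if c: "c \<in> {1..n} - S" for c
  proof -
    have "minor c d \<in> Q \<and> d \<in> {1..n} - S" if "(c, d) \<in> (parcs G \<inter> (- S) \<times> (- S))\<^sup>*" for d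
      using that
    proof (induction rule: rtrancl_induct)
      case base
      then show ?case using c I(2) by (simp add: minor_def)
    next
      case (step d e)
      have de: "d \<in> {1..n}" "e \<in> {1..n}" "e \<notin> S" "d \<notin> S" "c \<in> {1..n}"
        using step.hyps(2) V(1) c by auto
      \<comment> \<open>Parallelism passes through column \<open>d\<close> because some entry of it
        is nonzero modulo \<open>Q\<close>: that entry can be cancelled from the product.\<close>
      have *: "xvar i d * minor c e \<in> Q" if i: "i = 1 \<or> i = 2" for i
      proof -
        have "xvar i d * minor c e = xvar i c * minor d e + xvar i e * (minor c d :: 'k mpoly2)"
          using i by (auto simp: minor_def algebra_simps)
        moreover have "xvar i c * minor d e \<in> Q" "xvar i e * minor c d \<in> Q"
          using step.IH step.hyps(2) edge i de by (auto intro!: I(4) polys_in_xvar)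
        ultimately show ?thesis
          using I(3) by simp
      qed
      obtain i where i: "i = 1 \<or> i = 2" "xvar i d \<notin> Q"
        using de by (auto simp: S_def)
      have "xvar i d \<in> Q \<or> minor c e \<in> Q"
        using i de by (intro primeideal_poly_ringD(3)[OF Q] * polys_in_xvar polys_in_minor)
      then show ?case using i(2) de by blast
    qed
    then show ?thesis using r(3)[OF c] by blast
  qed
  have NV: "N \<subseteq> {1..n}" "S \<inter> N = {}" by (auto simp: N_def)
  have rN: "r c \<in> {1..n} - S - N" if "c \<in> N" for c
    using r(1,2)[of c] that by (auto simp: N_def)
  let ?l = "2 * card ((S \<union> N) \<inter> S) + card ((S \<union> N) \<inter> N)"
  have "has_prime_chain n ?l (ker_ideal n (star_param S r (S \<union> N) :: _ \<Rightarrow> 'k mpoly2))"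
    by (rule has_prime_chain_star_param[OF SV NV rN]) auto
  moreover have "ker_ideal n (star_param S r (S \<union> N)) \<subseteq> Q"
    by (rule ker_star_param_subset[OF Q S_def N_def r(1) par])
  ultimately have "enat ?l \<le> prime_height (poly_ring n) Q"
    using has_prime_chain_superset[OF _ Q] prime_height_ge by blast
  \<comment> \<open>The columns outside \<open>S\<close> and \<open>N\<close> are the
    representatives, at most \<open>card S + 1\<close> of them, so \<open>n\<close> is at most
    \<open>2 * card S + card N + 1\<close>.\<close>
  moreover have "n - 1 \<le> ?l"
  proof -
    have "{1..n} - S - N \<subseteq> r ` ({1..n} - S)"
      by (force simp: N_def)
    then have "card ({1..n} - S - N) \<le> Suc (card S)"
      using r(4) card_mono[of "r ` ({1..n} - S)" "{1..n} - S - N"] by simp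
    moreover have "card ({1..n} - S - N) = n - card S - card N"
    proof -
      have "N \<subseteq> {1..n} - S" by (auto simp: N_def)
      then have "card ({1..n} - S - N) = card ({1..n} - S) - card N"
        by (intro card_Diff_subset) (auto intro: finite_subset)
      also have "card ({1..n} - S) = n - card S"
        using card_Diff_subset[OF _ SV] finite_subset[OF SV] by simp
      finally show ?thesis .
    qed
    moreover have "(S \<union> N) \<inter> S = S" "(S \<union> N) \<inter> N = N" by auto
    ultimately show ?thesis by simp
  qed
  ultimately show "enat (n - 1) \<le> prime_height (poly_ring n) Q"
    by (meson enat_ord_simps(1) order_trans)
qed

section \<open>Complete graphs with paths attached\<close>

text \<open>
  Every vertex \<open>w\<close> outside the complete graph has a neighbour \<open>par w\<close> that is closer to it, and
  \<open>par\<close> is injective since every vertex carries at most one path.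
\<close>

definition parent_structure ::
    "'a pair_pre_digraph \<Rightarrow> 'a pair_pre_digraph \<Rightarrow> ('a \<Rightarrow> 'a) \<Rightarrow> ('a \<Rightarrow> nat) \<Rightarrow> bool" where
  "parent_structure K G par rk \<longleftrightarrow>
     pverts K \<subseteq> pverts G \<and>
     (\<forall>w\<in>pverts G - pverts K. par w \<in> pverts G \<and> rk (par w) < rk w) \<and>
     inj_on par (pverts G - pverts K) \<and>
     parcs G = parcs K \<union> (\<Union>w\<in>pverts G - pverts K. {(w, par w), (par w, w)})"

text \<open>Each new vertex gets its predecessor on the path as parent. The set \<open>X\<close>
  records the vertices of \<open>K\<close> that already carry a path; as \<open>x\<close> is not
  among them, no old vertex has the parent \<open>x\<close>, and \<open>par\<close> stays
  injective.\<close>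

lemma parent_structure_clique_sum:
  assumes G': "parent_structure K G' par rk" "par ` (pverts G' - pverts K) \<inter> pverts K = X"
    and x: "x \<in> pverts K" "x \<notin> X" and sum: "clique_sum G' x T G" and path: "path_with_end T x"
  shows "\<exists>par rk. parent_structure K G par rk \<and>
    par ` (pverts G - pverts K) \<inter> pverts K = insert x X"
proof -
  obtain p where p: "p \<noteq> []" "distinct p" "hd p = x" "T = path_graph p"
    using path by (auto simp: path_with_end_def)
  let ?V = "pverts G'"
  have V: "?V \<inter> set p = {x}" "set p \<noteq> {x}" and G: "pverts G = ?V \<union> set p"
    "parcs G = parcs G' \<union> parcs (path_graph p)"
    using sum by (auto simp: clique_sum_def p(4) path_graph_def)
  have p0: "p ! 0 = x"
    using p(1,3) by (simp add: hd_conv_nth)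
  have len: "1 < length p"
  proof (rule ccontr)
    assume "\<not> 1 < length p"
    then have "length p = 1" using p(1) by (cases p) auto
    then have "p = [x]" using p0 by (cases p) auto
    then show False using V(2) by simp
  qed
  define idx where "idx w = (SOME i. i < length p \<and> p ! i = w)" for w
  have idx: "idx (p ! i) = i" if i: "i < length p" for i
  proof -
    have "idx (p ! i) < length p \<and> p ! idx (p ! i) = p ! i"
      unfolding idx_def by (rule someI) (use i in auto)
    then show ?thesis
      using nth_eq_iff_index_eq[OF p(2)] i by blast
  qed
  define par' where "par' w = (if w \<in> ?V then par w else p ! (idx w - 1))" for w
  \<comment> \<open>Ranks on the new path start from \<open>rk x\<close>, so they also decrease
    across the gluing vertex.\<close>
  define rk' where "rk' w = (if w \<in> ?V then rk w else rk x + idx w)" for w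
  have KV: "pverts K \<subseteq> ?V" and par: "\<And>w. w \<in> ?V - pverts K \<Longrightarrow> par w \<in> ?V \<and> rk (par w) < rk w"
    and inj: "inj_on par (?V - pverts K)"
    and arcs: "parcs G' = parcs K \<union> (\<Union>w\<in>?V - pverts K. {(w, par w), (par w, w)})"
    using G'(1) by (auto simp: parent_structure_def)
  have xV: "x \<in> ?V" using V(1) by auto
  have pV: "p ! i \<in> ?V \<longleftrightarrow> i = 0" if i: "i < length p" for i
  proof
    assume "p ! i \<in> ?V"
    then have "p ! i \<in> {x}"
      unfolding V(1)[symmetric] using nth_mem[OF i] by (rule IntI)
    then have "p ! i = p ! 0"
      by (simp add: p0)
    then show "i = 0"
      using nth_eq_iff_index_eq[OF p(2) i, of 0] p(1) by simp
  qed (use p0 xV in simp)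
  define New where "New = (\<lambda>i. p ! Suc i) ` {i. Suc i < length p}"
  have New: "pverts G - pverts K = (?V - pverts K) \<union> New"
  proof -
    have "set p - ?V = New"
    proof
      show "set p - ?V \<subseteq> New"
      proof
        fix w assume w: "w \<in> set p - ?V"
        then obtain i where "i < length p" "w = p ! i"
          by (auto simp: in_set_conv_nth)
        with w xV p0 show "w \<in> New"
          by (cases i) (auto simp: New_def)
      qed
      show "New \<subseteq> set p - ?V"
        using pV by (auto simp: New_def)
    qed
    then show ?thesis
      using G(1) KV by blast
  qed
  have par_old: "par' w = par w" if "w \<in> ?V - pverts K" for w
    using that by (simp add: par'_def)
  have par_new: "par' (p ! Suc i) = p ! i" if "Suc i < length p" for i
    using that pV[of "Suc i"] idx[of "Suc i"] by (simp add: par'_def)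
  have par_notin: "par w \<noteq> x" if "w \<in> ?V - pverts K" for w
    using that G'(2) x by blast
  have "parent_structure K G par' rk'"
    unfolding parent_structure_def
  proof (intro conjI ballI)
    show "pverts K \<subseteq> pverts G" using KV G(1) by blast
    fix w assume "w \<in> pverts G - pverts K"
    then consider "w \<in> ?V - pverts K" | i where "Suc i < length p" "w = p ! Suc i"
      unfolding New New_def by blast
    then have "par' w \<in> pverts G \<and> rk' (par' w) < rk' w"
    proof cases
      case 1
      then show ?thesis
        using par[OF 1] G(1) by (simp add: par_old rk'_def)
    next
      case 2
      have "rk' (p ! i) < rk' (p ! Suc i)"
        using 2(1) pV[of i] pV[of "Suc i"] idx[of i] idx[of "Suc i"] p0 by (auto simp: rk'_def)
      then show ?thesis
        using 2 G(1) by (simp add: par_new)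
    qed
    then show "par' w \<in> pverts G" "rk' (par' w) < rk' w" by blast+
  next
    show "inj_on par' (pverts G - pverts K)"
      unfolding New inj_on_Un
    proof (intro conjI)
      show "inj_on par' (?V - pverts K)"
        using inj by (subst inj_on_cong[of _ _ par]) (auto simp: par_old)
      show "inj_on par' New"
        using nth_eq_iff_index_eq[OF p(2)] by (auto simp: inj_on_def New_def par_new)
      show "par' ` (?V - pverts K - New) \<inter> par' ` (New - (?V - pverts K)) = {}"
      proof (rule ccontr)
        assume "\<not> ?thesis"
        then obtain w i where w: "w \<in> ?V - pverts K" "Suc i < length p" "par' w = par' (p ! Suc i)"
          by (auto simp: New_def)
        then have eq: "par w = p ! i" by (simp add: par_old par_new)
        \<comment> \<open>A parent shared by an old and a new vertex is an old vertex on the path,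
          so it could only be \<open>x\<close>.\<close>
        then have "i = 0" using par[OF w(1)] pV[of i] w(2) by simp
        then show False using eq p0 par_notin[OF w(1)] by simp
      qed
    qed
    have "parcs (path_graph p) = (\<Union>w\<in>New. {(w, par' w), (par' w, w)})"
      by (auto simp: path_graph_def New_def par_new)
    then show "parcs G = parcs K \<union> (\<Union>w\<in>pverts G - pverts K. {(w, par' w), (par' w, w)})"
      unfolding New G(2) arcs by (auto simp: par_old)
  qed
  moreover have "par' ` (pverts G - pverts K) \<inter> pverts K = insert x X"
  proof -
    have "par' ` New \<inter> pverts K = {x}"
    proof
      show "par' ` New \<inter> pverts K \<subseteq> {x}"
      proof
        fix y assume "y \<in> par' ` New \<inter> pverts K"
        then obtain i where i: "Suc i < length p" "y = p ! i" "y \<in> ?V"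
          using KV by (auto simp: New_def par_new)
        then show "y \<in> {x}" using pV[of i] p0 by auto
      qed
      have "x = par' (p ! Suc 0)"
        using len p0 par_new[of 0] by simp
      then show "{x} \<subseteq> par' ` New \<inter> pverts K"
        using len x(1) unfolding New_def by auto
    qed
    moreover have "par' ` (?V - pverts K) = par ` (?V - pverts K)"
      by (intro image_cong) (auto simp: par_old)
    ultimately show ?thesis
      by (simp only: New image_Un Int_Un_distrib2 G'(2) Un_insert_right Un_empty_right)
  qed
  ultimately show ?thesis by blast
qed

text \<open>Induction on the number of paths. The set of used attachment vertices is carried along,
  so that injectivity of \<open>v\<close> makes the next one fresh.\<close>

lemma parent_structure_iterated_clique_sum:
  assumes "iterated_clique_sum K v T s G" "v ` {1..s} \<subseteq> pverts K" "inj_on v {1..s}"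
    and "\<And>h. h \<in> {1..s} \<Longrightarrow> path_with_end (T h) (v h)"
  shows "\<exists>par rk. parent_structure K G par rk \<and>
    par ` (pverts G - pverts K) \<inter> pverts K = v ` {1..s}"
  using assms
proof (induction s arbitrary: G)
  case 0
  then show ?case by (auto simp: parent_structure_def)
next
  case (Suc s)
  obtain G' where G': "iterated_clique_sum K v T s G'" "clique_sum G' (v (Suc s)) (T (Suc s)) G"
    using Suc.prems(1) by auto
  have ins: "{1..Suc s} = insert (Suc s) {1..s}" by auto
  obtain par rk where G'_parent: "parent_structure K G' par rk"
    "par ` (pverts G' - pverts K) \<inter> pverts K = v ` {1..s}"
    using Suc.IH[OF G'(1)] Suc.prems(2-4) unfolding ins by auto
  have "v (Suc s) \<notin> v ` {1..s}"
    using Suc.prems(3) unfolding ins by auto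
  moreover have "v (Suc s) \<in> pverts K" "path_with_end (T (Suc s)) (v (Suc s))"
    using Suc.prems(2,4) by auto
  ultimately show ?case
    unfolding ins image_insert
    using parent_structure_clique_sum[OF G'_parent _ _ G'(2)] by simp
qed

lemma sym_rtrancl_restrict: "sym E \<Longrightarrow> sym ((E \<inter> A \<times> A)\<^sup>*)"
  by (rule sym_rtrancl) (auto simp: sym_def)

text \<open>
  Each component of the graph without \<open>S\<close> contains either the rest of the complete graph or a
  vertex whose parent lies in \<open>S\<close>.
\<close>

lemma parent_structure_components:
  assumes "parent_structure K G par rk" "finite (pverts G)" "sym (parcs G)"
    and complete: "\<And>x y. x \<in> pverts K \<Longrightarrow> y \<in> pverts K \<Longrightarrow> x \<noteq> y \<Longrightarrow> (x, y) \<in> parcs K"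
    and S: "S \<subseteq> pverts G"
  shows "\<exists>r. (\<forall>c\<in>pverts G - S. r c \<in> pverts G - S \<and> r (r c) = r c \<and>
      (c, r c) \<in> (parcs G \<inter> (- S) \<times> (- S))\<^sup>*) \<and> card (r ` (pverts G - S)) \<le> Suc (card S)"
proof -
  let ?V = "pverts G"
  define E where "E = (parcs G \<inter> (- S) \<times> (- S))\<^sup>*"
  have KV: "pverts K \<subseteq> ?V" and par: "\<And>w. w \<in> ?V - pverts K \<Longrightarrow> par w \<in> ?V \<and> rk (par w) < rk w"
    and inj: "inj_on par (?V - pverts K)"
    and arcs: "parcs G = parcs K \<union> (\<Union>w\<in>?V - pverts K. {(w, par w), (par w, w)})"
    using assms(1) by (auto simp: parent_structure_def)
  have symE: "(a, b) \<in> E \<Longrightarrow> (b, a) \<in> E" for a b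
    unfolding E_def using sym_rtrancl_restrict[OF assms(3)] by (rule symD)
  have transE: "(a, b) \<in> E \<Longrightarrow> (b, c) \<in> E \<Longrightarrow> (a, c) \<in> E" for a b c
    unfolding E_def by (rule rtrancl_trans)
  \<comment> \<open>A surviving vertex of the complete graph. If there is none, \<open>q\<close> is
    arbitrary, and the intersection in \<open>Top\<close> discards it.\<close>
  define q where "q = (SOME q. q \<in> pverts K - S)"
  have q: "q \<in> pverts K - S" if "c \<in> pverts K - S" for c
    unfolding q_def by (rule someI[where P = "\<lambda>q. q \<in> pverts K - S", OF that])
  define W where "W = {w \<in> ?V - pverts K - S. par w \<in> S}"
  define Top where "Top = ({q} \<inter> (pverts K - S)) \<union> W"
  \<comment> \<open>Follow parents, with decreasing rank, until the complete graph or a vertex with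
    its parent in \<open>S\<close> is reached.\<close>
  have top: "\<exists>d\<in>Top. (c, d) \<in> E" if "c \<in> ?V - S" for c
    using that
  proof (induction "rk c" arbitrary: c rule: less_induct)
    case less
    show ?case
    proof (cases "c \<in> pverts K")
      case True
      then have "q \<in> pverts K - S" using less.prems by (intro q[of c]) simp
      moreover have "(c, q) \<in> E"
      proof (cases "c = q")
        case False
        then have "(c, q) \<in> parcs G"
          using complete[of c q] True \<open>q \<in> _\<close> arcs by blast
        then show ?thesis
          unfolding E_def using \<open>q \<in> _\<close> less.prems by (intro r_into_rtrancl) auto
      qed (simp add: E_def)
      ultimately show ?thesis by (auto simp: Top_def)
    next
      case False
      then have c: "c \<in> ?V - pverts K" using less.prems by blast
      show ?thesis
      proof (cases "par c \<in> S")
        case True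
        then have "c \<in> Top" using c less.prems by (auto simp: Top_def W_def)
        then show ?thesis by (auto simp: E_def)
      next
        case False
        then have "(c, par c) \<in> E"
          unfolding E_def using arcs c less.prems by (intro r_into_rtrancl) auto
        moreover obtain d where "d \<in> Top" "(par c, d) \<in> E"
          using less.hyps[of "par c"] par[OF c] False by auto
        ultimately show ?thesis using transE by blast
      qed
    qed
  qed
  define r where "r c = (SOME d. d \<in> Top \<and> (c, d) \<in> E)" for c
  have r: "r c \<in> Top \<and> (c, r c) \<in> E" if c: "c \<in> ?V - S" for c
    unfolding r_def by (rule someI_ex) (use top[OF c] in blast)
  \<comment> \<open>Connected vertices are related to the same elements of \<open>Top\<close>, so
    the choice operator selects the same representative for them.\<close>
  have rr: "r (r c) = r c" if "c \<in> ?V - S" for c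
  proof -
    have "(r c, d) \<in> E \<longleftrightarrow> (c, d) \<in> E" for d
      using r[OF that] symE transE by blast
    then show ?thesis
      unfolding r_def[of "r c"] r_def[of c, symmetric] by (simp add: r_def)
  qed
  have TopV: "Top \<subseteq> ?V - S"
    using KV by (auto simp: Top_def W_def)
  have finW: "finite W"
    using assms(2) by (auto simp: W_def)
  have "card (r ` (?V - S)) \<le> card Top"
    using r finW by (intro card_mono) (auto simp: Top_def)
  also have "\<dots> \<le> card ({q} \<inter> (pverts K - S)) + card W"
    unfolding Top_def by (rule card_Un_le)
  also have "card ({q} \<inter> (pverts K - S)) \<le> card {q}"
    by (intro card_mono) auto
  also have "card W \<le> card S"
  proof (rule card_inj_on_le)
    show "inj_on par W"
      by (rule inj_on_subset[OF inj]) (auto simp: W_def)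
    show "par ` W \<subseteq> S" by (auto simp: W_def)
    show "finite S" using S assms(2) by (rule finite_subset)
  qed
  finally have "card (r ` (?V - S)) \<le> Suc (card S)" by simp
  moreover have "\<forall>c\<in>?V - S. r c \<in> ?V - S \<and> r (r c) = r c \<and> (c, r c) \<in> E"
    using r rr TopV by blast
  ultimately show ?thesis unfolding E_def by blast
qed

theorem corollary3p9:
  fixes n s :: nat
    and G K4 :: "nat pair_pre_digraph"
    and v :: "nat \<Rightarrow> nat"
    and T :: "nat \<Rightarrow> nat pair_pre_digraph"
  assumes "n \<ge> 6"
    and "pair_graph G" and "pverts G = {1..n}" and "connected (with_proj G)"
    and "complete_digraph 4 (with_proj K4)"
    and "subgraph (with_proj K4) (with_proj G)"
    and "s \<ge> 2" and "v ` {1..s} \<subseteq> pverts K4" and "inj_on v {1..s}"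
    and "\<And>h. h \<in> {1..s} \<Longrightarrow> path_with_end (T h) (v h)"
    and "iterated_clique_sum K4 v T s G"
  shows "set_theoretic_complete_intersection
           (poly_ring n :: ('k::field) mpoly2 ring) (binomial_edge_ideal n G)"
proof -
  let ?R = "poly_ring n :: 'k mpoly2 ring"
  let ?J = "binomial_edge_ideal n G :: 'k mpoly2 set"
  interpret G: pair_graph G by fact
  have V: "parcs G \<subseteq> {1..n} \<times> {1..n}"
    using G.in_arcsD1 G.in_arcsD2 assms(3) by auto
  have sym: "sym (parcs G)"
    using G.arcs_symmetric by (auto intro: symI)
  have K: "card (pverts K4) = 4" "parcs K4 = {(u, v). (u, v) \<in> pverts K4 \<times> pverts K4 \<and> u \<noteq> v}"
    using assms(5) by (auto simp: complete_digraph_pair_def)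
  have complete: "(x, y) \<in> parcs K4" if "x \<in> pverts K4" "y \<in> pverts K4" "x \<noteq> y" for x y
    using that K(2) by blast
  obtain par rk where ps: "parent_structure K4 G par rk"
    and roots: "par ` (pverts G - pverts K4) \<inter> pverts K4 = v ` {1..s}"
    using parent_structure_iterated_clique_sum[OF assms(11,8,9,10)] by blast
  have comp: "\<exists>r. (\<forall>c\<in>{1..n} - S. r c \<in> {1..n} - S \<and> r (r c) = r c \<and>
      (c, r c) \<in> (parcs G \<inter> (- S) \<times> (- S))\<^sup>*) \<and> card (r ` ({1..n} - S)) \<le> Suc (card S)"
    if "S \<subseteq> {1..n}" for S
    by (rule parent_structure_components[OF ps, unfolded assms(3)])
      (use sym complete that in \<open>simp_all only: finite_atLeastAtMost\<close>)
  have "1 \<in> {1..s}" "2 \<in> {1..s}"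
    using assms(7) by auto
  then have v12: "v 1 \<noteq> v 2" "v 1 \<in> pverts K4" "v 2 \<in> pverts K4"
    using assms(8,9) by (auto dest: inj_onD)
  \<comment> \<open>The attachment vertices are exactly the vertices of the complete graph that are
    parents; \<open>a\<close> and \<open>b\<close> become the first further vertices on the paths at
    \<open>v 1\<close> and \<open>v 2\<close>.\<close>
  have "v 1 \<in> par ` (pverts G - pverts K4)" "v 2 \<in> par ` (pverts G - pverts K4)"
    using roots \<open>1 \<in> {1..s}\<close> \<open>2 \<in> {1..s}\<close> by blast+
  then obtain a b where ab: "{a, b} \<subseteq> {1..n} - pverts K4" "par a = v 1" "par b = v 2"
    unfolding assms(3) by auto
  have "finite (pverts K4)"
    by (rule card_ge_0_finite) (simp add: K(1))
  then have "card (pverts K4 - {v 1, v 2}) = 2"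
    using v12 K(1) by (subst card_Diff_subset) auto
  then obtain c d where cd: "pverts K4 - {v 1, v 2} = {c, d}" "c \<noteq> d"
    by (auto simp: card_2_iff)
  have K4: "pverts K4 = {v 1, v 2, c, d}" "distinct [v 1, v 2, c, d]"
    using cd v12 by auto
  have arcs: "parcs G = parcs K4 \<union> (\<Union>w\<in>{1..n} - pverts K4. {(w, par w), (par w, w)})"
    and KV: "pverts K4 \<subseteq> {1..n}"
    using ps by (auto simp: parent_structure_def assms(3))
  have "arith_rank ?R ?J \<le> enat (n - 1)"
  proof (rule arith_rank_K4_whiskers_le[OF V sym _ K4(2), folded K4(1), where par = par and a = a and b = b])
    show "pverts K4 \<subseteq> {1..n}" by (rule KV)
    show "(x, y) \<in> parcs G" if "x \<in> pverts K4" "y \<in> pverts K4" "x \<noteq> y" for x y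
      using complete[OF that] arcs by blast
    show "x \<in> pverts K4 \<and> y \<in> pverts K4 \<or> x \<in> {1..n} - pverts K4 \<and> y = par x \<or>
        y \<in> {1..n} - pverts K4 \<and> x = par y" if "(x, y) \<in> parcs G" for x y
      using that unfolding arcs K(2) by blast
    show "(w, par w) \<in> parcs G" if "w \<in> {1..n} - pverts K4" for w
      using that arcs by blast
  qed (rule ab)+
  moreover have "enat (n - 1) \<le> arith_rank ?R ?J"
  proof (rule arith_rank_binomial_edge_ideal_ge[OF V sym])
    fix i j assume ij: "i \<in> {1..n}" "j \<in> {1..n}"
    \<comment> \<open>For \<open>S = {}\<close> the component bound leaves a single representative,
      to which every vertex is joined.\<close>
    obtain r where r: "\<forall>c\<in>{1..n}. (c, r c) \<in> (parcs G)\<^sup>*" "card (r ` {1..n}) \<le> Suc 0"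
    proof -
      obtain r where "\<forall>c\<in>{1..n} - {}. r c \<in> {1..n} - {} \<and> r (r c) = r c \<and>
          (c, r c) \<in> (parcs G \<inter> (- {}) \<times> (- {}))\<^sup>*"
        "card (r ` ({1..n} - {})) \<le> Suc (card ({} :: nat set))"
        using comp[OF empty_subsetI] by (elim exE conjE) (rule that)
      then show ?thesis
        by (intro that[of r]) simp_all
    qed
    have "\<forall>x\<in>r ` {1..n}. \<forall>y\<in>r ` {1..n}. x = y"
      using r(2) card_le_Suc0_iff_eq[of "r ` {1..n}"] by (simp only: finite_imageI finite_atLeastAtMost)
    then have "r i = r j"
      using imageI[OF ij(1), of r] imageI[OF ij(2), of r] by blast
    moreover have "(r j, j) \<in> (parcs G)\<^sup>*"
      by (rule symD[OF sym_rtrancl[OF sym] bspec[OF r(1) ij(2)]])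
    ultimately show "(i, j) \<in> (parcs G)\<^sup>*"
      using bspec[OF r(1) ij(1)] by simp
  qed
  moreover have "enat (n - 1) \<le> height ?R ?J"
    by (rule height_binomial_edge_ideal_ge[OF V sym comp])
  moreover have "height ?R ?J \<le> enat (n - 1)"
    using assms(1) by (intro height_binomial_edge_ideal_le V) simp
  ultimately show ?thesis
    unfolding set_theoretic_complete_intersection_def by (metis order_antisym)
qed

end
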